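(* Let $\beta\ge0$ and let $\eta\in\mathcal P_u^\beta(\mathcal T_* )$ be a true law, i.e. the law of a random tree that has i.i.d. vertex marks with law $\nu$ and i.i.d. edge marks (independent of the vertex marks) with law $\xi$, both independent of the tree structure, with $\mathbb E_\eta[\deg(o)]=\beta$. Then the following identity is satisfied: $\mathcal I_{\beta,\eta}=\widetilde{\mathcal I}_{\beta,\eta}$ (as functions on $\mathcal P(\mathcal G_*[\mathcal X;\mathcal Y])$).
   Context: Spaces. $\mathcal X,\mathcal Y$ are nonempty finite sets, $\nu\in\mathcal P(\mathcal X)$, $\xi\in\mathcal P(\mathcal Y\times\mathcal Y)$, $\bar\xi(y,y')=\frac12[\xi(y,y')+\xi(y',y)]$. A marked graph (locally finite) carries a mark $x_v\in\mathcal X$ at each vertex and, on each edge $\{u,v\}$, marks $(y_{(u,v)},y_{(v,u)})\in\mathcal Y\times\mathcal Y$, with $y_{(u,v)}$ associated with $u$. Edge marks with law $\xi$ means that for each edge a pair is sampled from $\xi$ and assigned to the two endpoints in uniformly random order, so that $(y_{(u,v)},y_{(v,u)})$ has law $\bar\xi$. $\mathcal G_*[\mathcal X;\mathcal Y]$ is the Polish space of isomorphism classes of connected rooted marked graphs with the local topology; $\mathcal T_*$ is the subset of trees and $\mathcal T_{*,h}$ the set of trees of depth at most $h$ ($\mathcal T_{*,0}=\mathcal X$). A subscript $h$ denotes truncation to the depth-$h$ ball about the root (for pairs in $\mathcal T_*\times\mathcal Y$ it acts on the tree only). $N_o(\tau)$ is the set of neighbors of the root $o$, $\deg(o)$ its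 degree. For $\rho\in\mathcal P(\mathcal G_* )$: $\rho_h$ is the law of the truncation and $\rho_o$ the law of the root mark. $H(\cdot\|\cdot)$ is relative entropy. $\mathbf T$ denotes a random tree; the root's children are labeled $1,\dots,\deg(o)$ uniformly at random, so $1$ is a uniform random child. Unimodularity. $\rho\in\mathcal P(\mathcal G_* )$ is unimodular if $\mathbb E_\rho[\sum_{v}f(\mathbf G,o,v)]=\mathbb E_\rho[\sum_vf(\mathbf G,v,o)]$ for every measurable $f\ge0$ on the space of isomorphism classes of doubly rooted marked graphs. $\mathcal P_u^\beta(\mathcal T_* )$ is the set of unimodular measures on $\mathcal T_*$ with mean root degree $\beta$. Cutting and size-biasing. For an edge $\{u,v\}$ of a tree $\tau$, $\tau(v\setminus u)\in\mathcal T_*\times\mathcal Y$ is the pair consisting of the component of $v$, rooted at $v$, after deleting $\{u,v\}$, and the mark $y_{(v,u)}$; if $\{u,v\}$ is not an edge of $\tau$, $\tau(v\setminus u):=0$. For $\rho_h\in\mathcal P(\mathcal T_{*,h})$, $h\ge1$, with $0<\mathbb E_{\rho_h}[\deg(o)]<\infty$, put $\frac{d\bar\rho_h}{d\rho_h}(\tau)=\deg_\tau(o)/\mathbb E_{\rho_h}[\deg(o)]$ and let $\bar\rho_h^{1,o}\in\mathcal P((\mathcal T_{*,h-1}\times\mathcal Y)^2)$ be the law of $(\mathbf T(1\setminus o)_{h-1},\mathbf T(o\setminus1)_{h-1})$ under $\bar\rho_h$, $\bar\rho_h^1$ its first marginal, $\bar\rho_h^{1|o}$ the conditional law of the first coordinate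 given the second (a version is fixed; its choice is inconsequential). $\rho_h$ is admissible if $\bar\rho_h^{1,o}$ is symmetric (every $\rho\in\mathcal P_u^\beta(\mathcal T_* )$, $\beta>0$, has all $\rho_h$ admissible). The same notation is used for $\eta_1$ and for $\rho_h^*$ below, giving $\bar\eta_1^{1,o},\bar\eta_1^1,\bar\eta_1^{1|o}$ and $(\bar\rho_h^* )^{1,o}$. One-step extension. For admissible $\rho_h$ with mean root degree in $(0,\infty)$ and $\tau,\tau'\in\mathcal T_{*,h-1}\times\mathcal Y$ with $\bar\rho_h^{1,o}(\tau,\tau')>0$, let $$\hat P_{h,\rho_h}(\tau,\tau')(\tilde\tau)=\rho_h\big(\mathbf T(o\setminus1)_h=\tilde\tau\,\big|\,\mathbf T(o\setminus1)_{h-1}=\tau,\ \mathbf T(1\setminus o)_{h-1}=\tau'\big),\qquad\tilde\tau\in\mathcal T_{*,h}\times\mathcal Y,$$ the conditional law under $\rho_h$ (that is, with $\mathbf T$ of law $\rho_h$) of $\mathbf T(o\setminus1)_h$. For $h\ge2$, $\rho_h^*\in\mathcal P(\mathcal T_{*,h})$ is the law obtained by sampling $\mathbf T\sim\rho_{h-1}$ and, independently for each $v\in N_o(\mathbf T)$, replacing $\mathbf T(v\setminus o)_{h-2}$ by a sample from $\hat P_{h-1,\rho_{h-1}}(\mathbf T(v\setminus o)_{h-2},\mathbf T(o\setminus v)_{h-2})$ (a single vertex is left unchanged). For $h\ge2$ define the probability measures $\check\rho_h=\rho_h^*$ and $\hat\rho_h$ by $$\frac{d\hat\rho_h}{d\rho_h^*}(\tau)=\prod_{v\in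 N_o(\tau)}\frac{d\bar\rho_h^{1,o}}{d(\bar\rho_h^* )^{1,o}}(\tau(v\setminus o)_{h-1},\tau(o\setminus v)_{h-1}).$$ For $h=1$ and $\rho_1\ll\eta_1$ define the probability measures $\check\rho_1,\hat\rho_1$ by $$\frac{d\check\rho_1}{d\eta_1}(\tau)=\prod_{v\in N_o(\tau)}\frac{d\bar\rho_1^1}{d\bar\eta_1^1}(\tau(v\setminus o)_0),\quad\frac{d\hat\rho_1}{d\eta_1}(\tau)=\prod_{v\in N_o(\tau)}\frac{d\bar\rho_1^{1|o}}{d\bar\eta_1^{1|o}}(\tau(v\setminus o)_0\mid\tau(o\setminus v)_0).$$ Functionals on $\mathcal P(\mathcal G_* )$. $$\mathcal I_{\beta,\eta}(\rho)=\begin{cases}H(\rho_o\|\nu)&\text{if }\beta=0\text{ and }\mathbb E_\rho[\deg(o)]=0,\\ \frac12\sum_{h\ge1}[H(\rho_h\|\check\rho_h)+H(\rho_h\|\hat\rho_h)]&\text{if }\beta>0,\ \rho\in\mathcal P_u^\beta(\mathcal T_* ),\ \rho_1\ll\eta_1,\\ \infty&\text{otherwise.}\end{cases}$$ $\widetilde{\mathcal I}_{\beta,\eta}(\rho)$ equals: (i) $H(\rho_o\|\nu)$ if $\beta=0$ and $\mathbb E_\rho[\deg(o)]=0$; (ii) $H(\rho_1\|\eta_1)-\frac\beta2H(\bar\rho_1^{1,o}\|\bar\eta_1^{1,o})+\sum_{h\ge2}\left[H(\rho_h\|\rho_h^* )-\frac\beta2H(\bar\rho_h^{1,o}\|(\bar\rho_h^*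 )^{1,o})\right]$ if $\beta>0$, $\rho\in\mathcal P_u^\beta(\mathcal T_* )$, $\rho_1\ll\eta_1$ and $\mathbb E_\rho[\deg(o)\log\deg(o)]<\infty$ (convention $0\log0=0$); (iii) $\infty$ otherwise. *)

theory Defs
  imports "HOL-Probability.Probability"
begin

section \<open>Marked graphs\<close>

text \<open>
  Connected locally finite graphs are countable, so the vertices are taken from \<^typ>\<open>nat\<close>.
  \<open>emark G u v\<close> is the mark $y_{(u,v)}$, i.e. the mark of the edge $\{u,v\}$ associated with \<open>u\<close>.
  Mark values outside the vertex set resp. outside the edges are irrelevant: isomorphisms ignore
  them.
\<close>

record ('x, 'y) mgraph =
  verts :: "nat set"
  adj :: "nat \<Rightarrow> nat \<Rightarrow> bool"
  vmark :: "nat \<Rightarrow> 'x"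
  emark :: "nat \<Rightarrow> nat \<Rightarrow> 'y"

definition nbrs :: "('x, 'y) mgraph \<Rightarrow> nat \<Rightarrow> nat set" where
  "nbrs G u = {v. adj G u v}"

definition conn_lf_graph :: "('x, 'y) mgraph \<Rightarrow> bool" where
  "conn_lf_graph G \<longleftrightarrow>
     (\<forall>u v. adj G u v \<longrightarrow> u \<in> verts G \<and> v \<in> verts G \<and> u \<noteq> v \<and> adj G v u) \<and>
     (\<forall>u\<in>verts G. finite (nbrs G u)) \<and>
     (\<forall>u\<in>verts G. \<forall>v\<in>verts G. (adj G)\<^sup>*\<^sup>* u v)"

definition is_cycle :: "('x, 'y) mgraph \<Rightarrow> nat list \<Rightarrow> bool" where
  "is_cycle G c \<longleftrightarrow> length c \<ge> 3 \<and> distinct c \<and>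
     (\<forall>i<length c. adj G (c ! i) (c ! (Suc i mod length c)))"

definition acyclic_graph :: "('x, 'y) mgraph \<Rightarrow> bool" where
  "acyclic_graph G \<longleftrightarrow> (\<nexists>c. is_cycle G c)"

definition induced :: "('x, 'y) mgraph \<Rightarrow> nat set \<Rightarrow> ('x, 'y) mgraph" where
  "induced G S = G\<lparr>verts := verts G \<inter> S, adj := (\<lambda>u v. u \<in> S \<and> v \<in> S \<and> adj G u v)\<rparr>"

definition graph_ball :: "('x, 'y) mgraph \<Rightarrow> nat \<Rightarrow> nat \<Rightarrow> nat set" where
  "graph_ball G u h = {v \<in> verts G. \<exists>n\<le>h. (adj G ^^ n) u v}"

definition delete_edge :: "('x, 'y) mgraph \<Rightarrow> nat \<Rightarrow> nat \<Rightarrow> ('x, 'y) mgraph" where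
  "delete_edge G u v = G\<lparr>adj := (\<lambda>a b. adj G a b \<and> {a, b} \<noteq> {u, v})\<rparr>"

definition graph_component :: "('x, 'y) mgraph \<Rightarrow> nat \<Rightarrow> nat set" where
  "graph_component G v = {w \<in> verts G. (adj G)\<^sup>*\<^sup>* v w}"

definition graph_iso :: "(nat \<Rightarrow> nat) \<Rightarrow> ('x, 'y) mgraph \<Rightarrow> ('x, 'y) mgraph \<Rightarrow> bool" where
  "graph_iso f G H \<longleftrightarrow> bij_betw f (verts G) (verts H) \<and>
     (\<forall>u\<in>verts G. vmark H (f u) = vmark G u) \<and>
     (\<forall>u\<in>verts G. \<forall>v\<in>verts G. adj H (f u) (f v) = adj G u v \<and>
        (adj G u v \<longrightarrow> emark H (f u) (f v) = emark G u v))"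

lemma graph_iso_id: "graph_iso id G G"
  by (simp add: graph_iso_def)

lemma graph_iso_comp: "graph_iso f G H \<Longrightarrow> graph_iso g H K \<Longrightarrow> graph_iso (g \<circ> f) G K"
  unfolding graph_iso_def by (auto intro: bij_betw_trans dest: bij_betwE)

lemma graph_iso_inv:
  assumes "graph_iso f G H"
  shows "graph_iso (inv_into (verts G) f) H G"
proof -
  let ?g = "inv_into (verts G) f"
  have b: "bij_betw f (verts G) (verts H)" using assms by (simp add: graph_iso_def)
  have g: "?g u \<in> verts G" "f (?g u) = u" if "u \<in> verts H" for u
    using b that by (auto simp: bij_betw_def inv_into_into f_inv_into_f)
  show ?thesis
    unfolding graph_iso_def
  proof (intro conjI ballI impI)
    show "bij_betw ?g (verts H) (verts G)" using b by (rule bij_betw_inv_into)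
  next
    fix u assume "u \<in> verts H"
    then show "vmark G (?g u) = vmark H u" using assms g unfolding graph_iso_def by metis
  next
    fix u v assume uv: "u \<in> verts H" "v \<in> verts H"
    then show "adj G (?g u) (?g v) = adj H u v" using assms g unfolding graph_iso_def by metis
  next
    fix u v assume "u \<in> verts H" "v \<in> verts H" "adj H u v"
    then show "emark G (?g u) (?g v) = emark H u v" using assms g unfolding graph_iso_def by metis
  qed
qed

section \<open>Isomorphism classes and the local topology\<close>

definition rooted_iso :: "('x, 'y) mgraph \<times> nat \<Rightarrow> ('x, 'y) mgraph \<times> nat \<Rightarrow> bool" where
  "rooted_iso R S \<longleftrightarrow> (case (R, S) of ((G, u), (H, v)) \<Rightarrow>
     conn_lf_graph G \<and> conn_lf_graph H \<and> u \<in> verts G \<and> v \<in> verts H \<and>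
     (\<exists>f. graph_iso f G H \<and> f u = v))"

definition birooted_iso ::
    "('x, 'y) mgraph \<times> nat \<times> nat \<Rightarrow> ('x, 'y) mgraph \<times> nat \<times> nat \<Rightarrow> bool" where
  "birooted_iso R S \<longleftrightarrow> (case (R, S) of ((G, u, u'), (H, v, v')) \<Rightarrow>
     conn_lf_graph G \<and> conn_lf_graph H \<and>
     u \<in> verts G \<and> u' \<in> verts G \<and> v \<in> verts H \<and> v' \<in> verts H \<and>
     (\<exists>f. graph_iso f G H \<and> f u = v \<and> f u' = v'))"

definition single_vertex :: "('x, 'y) mgraph" where
  "single_vertex = \<lparr>verts = {0}, adj = (\<lambda>_ _. False), vmark = undefined, emark = undefined\<rparr>"

lemma conn_lf_single_vertex: "conn_lf_graph single_vertex"
  by (auto simp: conn_lf_graph_def single_vertex_def nbrs_def)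

lemma verts_single_vertex: "verts single_vertex = {0}"
  by (simp add: single_vertex_def)

text \<open>
  \<open>gstar\<close> and \<open>gstar2\<close> are the sets of isomorphism classes of connected, locally finite marked
  graphs with one resp. two roots. The mark spaces are finite types.
\<close>

quotient_type ('x, 'y) gstar = "('x, 'y) mgraph \<times> nat" / partial: rooted_iso
proof (rule part_equivpI)
  have "rooted_iso ((single_vertex, 0) :: ('x, 'y) mgraph \<times> nat) (single_vertex, 0)"
    unfolding rooted_iso_def
    by (auto simp: conn_lf_single_vertex verts_single_vertex intro!: exI[of _ id] graph_iso_id)
  then show "\<exists>R :: ('x, 'y) mgraph \<times> nat. rooted_iso R R"
    by blast
  show "symp (rooted_iso :: ('x, 'y) mgraph \<times> nat \<Rightarrow> _)"
  proof (rule sympI)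
    fix R S :: "('x, 'y) mgraph \<times> nat"
    obtain G u H v where [simp]: "R = (G, u)" "S = (H, v)" by (cases R, cases S)
    assume a: "rooted_iso R S"
    then obtain f where f: "graph_iso f G H" "f u = v" by (auto simp: rooted_iso_def)
    have "inj_on f (verts G)" using f by (auto simp: graph_iso_def bij_betw_def)
    then show "rooted_iso S R"
      using a f graph_iso_inv[OF f(1)] by (auto simp: rooted_iso_def)
  qed
  show "transp (rooted_iso :: ('x, 'y) mgraph \<times> nat \<Rightarrow> _)"
  proof (rule transpI)
    fix R S T :: "('x, 'y) mgraph \<times> nat"
    obtain G u H v K w where [simp]: "R = (G, u)" "S = (H, v)" "T = (K, w)"
      by (cases R, cases S, cases T)
    assume a: "rooted_iso R S" "rooted_iso S T"
    then obtain f g where "graph_iso f G H" "f u = v" "graph_iso g H K" "g v = w"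
      by (auto simp: rooted_iso_def)
    then have "graph_iso (g \<circ> f) G K \<and> (g \<circ> f) u = w" by (auto intro: graph_iso_comp)
    then show "rooted_iso R T" using a by (auto simp: rooted_iso_def)
  qed
qed

quotient_type ('x, 'y) gstar2 = "('x, 'y) mgraph \<times> nat \<times> nat" / partial: birooted_iso
proof (rule part_equivpI)
  have "birooted_iso ((single_vertex, 0, 0) :: ('x, 'y) mgraph \<times> nat \<times> nat) (single_vertex, 0, 0)"
    unfolding birooted_iso_def
    by (auto simp: conn_lf_single_vertex verts_single_vertex intro!: exI[of _ id] graph_iso_id)
  then show "\<exists>R :: ('x, 'y) mgraph \<times> nat \<times> nat. birooted_iso R R"
    by blast
  show "symp (birooted_iso :: ('x, 'y) mgraph \<times> nat \<times> nat \<Rightarrow> _)"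
  proof (rule sympI)
    fix R S :: "('x, 'y) mgraph \<times> nat \<times> nat"
    obtain G u u' H v v' where [simp]: "R = (G, u, u')" "S = (H, v, v')"
      by (cases R, cases S)
    assume a: "birooted_iso R S"
    then obtain f where f: "graph_iso f G H" "f u = v" "f u' = v'"
      by (auto simp: birooted_iso_def)
    have "inj_on f (verts G)" using f by (auto simp: graph_iso_def bij_betw_def)
    then show "birooted_iso S R"
      using a f graph_iso_inv[OF f(1)] by (auto simp: birooted_iso_def)
  qed
  show "transp (birooted_iso :: ('x, 'y) mgraph \<times> nat \<times> nat \<Rightarrow> _)"
  proof (rule transpI)
    fix R S T :: "('x, 'y) mgraph \<times> nat \<times> nat"
    obtain G u u' H v v' K w w' where [simp]: "R = (G, u, u')" "S = (H, v, v')" "T = (K, w, w')"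
      by (cases R, cases S, cases T)
    assume a: "birooted_iso R S" "birooted_iso S T"
    then obtain f g where "graph_iso f G H" "f u = v" "f u' = v'"
        "graph_iso g H K" "g v = w" "g v' = w'"
      by (auto simp: birooted_iso_def)
    then have "graph_iso (g \<circ> f) G K \<and> (g \<circ> f) u = w \<and> (g \<circ> f) u' = w'"
      by (auto intro: graph_iso_comp)
    then show "birooted_iso R T" using a by (auto simp: birooted_iso_def)
  qed
qed

text \<open>
  Notions on isomorphism classes are defined through the chosen representative \<open>rep_gstar\<close>; all
  of them that do not mention individual vertices are independent of the choice.
\<close>

definition g_graph :: "('x, 'y) gstar \<Rightarrow> ('x, 'y) mgraph" where
  "g_graph g = fst (rep_gstar g)"

definition g_root :: "('x, 'y) gstar \<Rightarrow> nat" where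
  "g_root g = snd (rep_gstar g)"

definition root_nbrs :: "('x, 'y) gstar \<Rightarrow> nat set" where
  "root_nbrs g = nbrs (g_graph g) (g_root g)"

definition root_deg :: "('x, 'y) gstar \<Rightarrow> nat" where
  "root_deg g = card (root_nbrs g)"

definition root_mark :: "('x, 'y) gstar \<Rightarrow> 'x" where
  "root_mark g = vmark (g_graph g) (g_root g)"

definition trunc :: "nat \<Rightarrow> ('x, 'y) gstar \<Rightarrow> ('x, 'y) gstar" where
  "trunc h g = abs_gstar (induced (g_graph g) (graph_ball (g_graph g) (g_root g) h), g_root g)"

definition tstar :: "('x, 'y) gstar set" where
  "tstar = {g. acyclic_graph (g_graph g)}"

definition near_root2 :: "nat \<Rightarrow> ('x, 'y) gstar2 \<Rightarrow> bool" where
  "near_root2 h g = (case rep_gstar2 g of (G, u, v) \<Rightarrow> v \<in> graph_ball G u h)"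

text \<open>Only meaningful if \<open>near_root2 h g\<close>: otherwise the second root is not in the ball.\<close>

definition trunc2 :: "nat \<Rightarrow> ('x, 'y) gstar2 \<Rightarrow> ('x, 'y) gstar2" where
  "trunc2 h g = (case rep_gstar2 g of (G, u, v) \<Rightarrow> abs_gstar2 (induced G (graph_ball G u h), u, v))"

text \<open>
  Local topology. As the mark spaces are finite (hence discrete), a neighbourhood base of \<open>g\<close> is
  given by the graphs that have the same depth-\<open>h\<close> ball as \<open>g\<close>, for \<open>h = 0, 1, 2, \<dots>\<close>; for two
  roots, \<open>h\<close> is at least the distance of the roots.
\<close>

instantiation gstar :: (type, type) topological_space
begin

definition open_gstar :: "('a, 'b) gstar set \<Rightarrow> bool" where
  "open_gstar = generate_topology (range (\<lambda>(h, g). {g'. trunc h g' = trunc h g}))"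

instance
  by standard (auto simp: open_gstar_def intro: generate_topology.intros)

end

instantiation gstar2 :: (type, type) topological_space
begin

definition open_gstar2 :: "('a, 'b) gstar2 set \<Rightarrow> bool" where
  "open_gstar2 = generate_topology
     ((\<lambda>(h, g). {g'. near_root2 h g' \<and> trunc2 h g' = trunc2 h g}) ` {(h, g). near_root2 h g})"

instance
  by standard (auto simp: open_gstar2_def intro: generate_topology.intros)

end

section \<open>Unimodular measures\<close>

definition prob_gstar :: "('x, 'y) gstar measure set" where
  "prob_gstar = {\<rho>. prob_space \<rho> \<and> sets \<rho> = sets borel}"

definition unimodular :: "('x, 'y) gstar measure \<Rightarrow> bool" where
  "unimodular \<rho> \<longleftrightarrow> (\<forall>f :: ('x, 'y) gstar2 \<Rightarrow> ennreal. f \<in> borel_measurable borel \<longrightarrow>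
     (\<integral>\<^sup>+g. (\<integral>\<^sup>+v. f (abs_gstar2 (g_graph g, g_root g, v)) \<partial>count_space (verts (g_graph g))) \<partial>\<rho>) =
     (\<integral>\<^sup>+g. (\<integral>\<^sup>+v. f (abs_gstar2 (g_graph g, v, g_root g)) \<partial>count_space (verts (g_graph g))) \<partial>\<rho>))"

definition mean_deg :: "('x, 'y) gstar measure \<Rightarrow> ennreal" where
  "mean_deg \<rho> = (\<integral>\<^sup>+g. of_nat (root_deg g) \<partial>\<rho>)"

definition unimod_trees :: "real \<Rightarrow> ('x, 'y) gstar measure set" where
  "unimod_trees \<beta> =
     {\<rho> \<in> prob_gstar. (AE g in \<rho>. g \<in> tstar) \<and> unimodular \<rho> \<and> mean_deg \<rho> = ennreal \<beta>}"

text \<open>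
  The law $\rho_h$ of the depth-\<open>h\<close> truncation. It is discrete since there are only countably many
  isomorphism classes of finite graphs with marks in finite sets.
\<close>

definition trunc_law :: "nat \<Rightarrow> ('x, 'y) gstar measure \<Rightarrow> ('x, 'y) gstar pmf" where
  "trunc_law h \<rho> = embed_pmf (\<lambda>t. measure \<rho> {g. trunc h g = t})"

definition root_law :: "('x, 'y) gstar measure \<Rightarrow> 'x measure" where
  "root_law \<rho> = distr \<rho> (count_space UNIV) root_mark"

section \<open>True laws\<close>

text \<open>The law $\bar\xi$: a pair sampled from $\xi$, put in uniformly random order.\<close>

definition symmetrize :: "('y \<times> 'y) pmf \<Rightarrow> ('y \<times> 'y) pmf" where
  "symmetrize \<xi> = bind_pmf \<xi> (\<lambda>p. map_pmf (\<lambda>b. if b then p else prod.swap p) (bernoulli_pmf (1/2)))"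

lemma pmf_symmetrize: "pmf (symmetrize \<xi>) (y, y') = (pmf \<xi> (y, y') + pmf \<xi> (y', y)) / 2"
proof -
  have swap: "prod.swap -` {(y, y')} = {(y', y)}"
    by auto
  have eq: "symmetrize \<xi> = bind_pmf (bernoulli_pmf (1/2))
      (\<lambda>b. if b then \<xi> else map_pmf prod.swap \<xi>)"
    unfolding symmetrize_def map_pmf_def
    by (subst bind_commute_pmf) (auto intro!: bind_pmf_cong simp: bind_return_pmf')
  show ?thesis
    unfolding eq by (simp add: pmf_bind pmf_map swap measure_pmf_single)
qed

definition put_marks ::
    "(nat \<Rightarrow> 'x) \<Rightarrow> (nat \<times> nat \<Rightarrow> 'y \<times> 'y) \<Rightarrow> (unit, unit) gstar \<Rightarrow> ('x, 'y) gstar" where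
  "put_marks x p g = abs_gstar
     (\<lparr>verts = verts (g_graph g), adj = adj (g_graph g), vmark = x,
       emark = (\<lambda>u v. if u < v then fst (p (u, v)) else snd (p (v, u)))\<rparr>, g_root g)"

text \<open>
  The law obtained by putting i.i.d. marks on a fixed unmarked graph; the edge $\{u,v\}$ with
  $u < v$ gets the pair $p(u,v) = (y_{(u,v)}, y_{(v,u)})$ of law $\bar\xi$.
\<close>

definition iid_marking :: "'x pmf \<Rightarrow> ('y \<times> 'y) pmf \<Rightarrow> (unit, unit) gstar \<Rightarrow> ('x, 'y) gstar measure" where
  "iid_marking \<nu> \<xi> g =
     distr (PiM UNIV (\<lambda>_. measure_pmf \<nu>) \<Otimes>\<^sub>M PiM UNIV (\<lambda>_. measure_pmf (symmetrize \<xi>))) borel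
       (\<lambda>(x, p). put_marks x p g)"

text \<open>Given the tree structure, of law \<open>\<theta>\<close>, the marks of \<open>\<eta>\<close> are distributed as above.\<close>

definition true_law :: "'x pmf \<Rightarrow> ('y \<times> 'y) pmf \<Rightarrow> ('x, 'y) gstar measure \<Rightarrow> bool" where
  "true_law \<nu> \<xi> \<eta> \<longleftrightarrow> (\<exists>\<theta>\<in>prob_gstar. (AE g in \<theta>. g \<in> tstar) \<and>
     (\<forall>A\<in>sets borel. emeasure \<eta> A = (\<integral>\<^sup>+g. emeasure (iid_marking \<nu> \<xi> g) A \<partial>\<theta>)))"

section \<open>Cutting and size-biasing\<close>

definition trunc_branch :: "nat \<Rightarrow> ('x, 'y) gstar \<times> 'y \<Rightarrow> ('x, 'y) gstar \<times> 'y" where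
  "trunc_branch h = map_prod (trunc h) id"

text \<open>\<open>cut_branch G v u\<close> is $\tau(v \setminus u)$, where \<open>{u, v}\<close> is assumed to be an edge.\<close>

definition cut_branch :: "('x, 'y) mgraph \<Rightarrow> nat \<Rightarrow> nat \<Rightarrow> ('x, 'y) gstar \<times> 'y" where
  "cut_branch G v u =
     (abs_gstar (induced (delete_edge G u v) (graph_component (delete_edge G u v) v), v),
      emark G v u)"

text \<open>$\tau(v \setminus o)_h$ and $\tau(o \setminus v)_h$ for a neighbour \<open>v\<close> of the root \<open>o\<close>.\<close>

definition child_branch :: "nat \<Rightarrow> ('x, 'y) gstar \<Rightarrow> nat \<Rightarrow> ('x, 'y) gstar \<times> 'y" where
  "child_branch h \<tau> v = trunc_branch h (cut_branch (g_graph \<tau>) v (g_root \<tau>))"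

definition root_branch :: "nat \<Rightarrow> ('x, 'y) gstar \<Rightarrow> nat \<Rightarrow> ('x, 'y) gstar \<times> 'y" where
  "root_branch h \<tau> v = trunc_branch h (cut_branch (g_graph \<tau>) (g_root \<tau>) v)"

definition branch_pair ::
    "nat \<Rightarrow> ('x, 'y) gstar \<Rightarrow> nat \<Rightarrow> (('x, 'y) gstar \<times> 'y) \<times> (('x, 'y) gstar \<times> 'y)" where
  "branch_pair h \<tau> v = (child_branch h \<tau> v, root_branch h \<tau> v)"

definition size_biased :: "('x, 'y) gstar pmf \<Rightarrow> ('x, 'y) gstar pmf" where
  "size_biased \<mu> = embed_pmf (\<lambda>\<tau>. real (root_deg \<tau>) /
     measure_pmf.expectation \<mu> (\<lambda>\<tau>. real (root_deg \<tau>)) * pmf \<mu> \<tau>)"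

text \<open>
  \<open>edge_law h \<mu>\<close> is $\bar\mu_h^{1,o}$ for a law \<open>\<mu>\<close> on trees of depth at most \<open>h\<close>, $h \ge 1$.
  The size-biased law only charges trees with nonempty \<open>root_nbrs\<close>.
\<close>

definition edge_law ::
    "nat \<Rightarrow> ('x, 'y) gstar pmf \<Rightarrow> ((('x, 'y) gstar \<times> 'y) \<times> (('x, 'y) gstar \<times> 'y)) pmf" where
  "edge_law h \<mu> = bind_pmf (size_biased \<mu>)
     (\<lambda>\<tau>. map_pmf (branch_pair (h - 1) \<tau>) (pmf_of_set (root_nbrs \<tau>)))"

text \<open>
  A version of the conditional law of the first coordinate given the second; \<open>d\<close> is its value
  where the second coordinate has probability 0.
\<close>

definition cond_fst :: "('b \<Rightarrow> 'a pmf) \<Rightarrow> ('a \<times> 'b) pmf \<Rightarrow> 'b \<Rightarrow> 'a pmf" where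
  "cond_fst d J b = (if b \<in> snd ` set_pmf J then map_pmf fst (cond_pmf J {p. snd p = b}) else d b)"

section \<open>One-step extension\<close>

text \<open>
  \<open>step_kernel h \<mu> t t'\<close> is $\hat P_{h,\mu}(t,t')$. The conditioning event requires that the root has
  a child, so it may as well be computed under \<open>\<mu>\<close> conditioned to have positive root degree.
\<close>

definition step_kernel :: "nat \<Rightarrow> ('x, 'y) gstar pmf \<Rightarrow>
    ('x, 'y) gstar \<times> 'y \<Rightarrow> ('x, 'y) gstar \<times> 'y \<Rightarrow> (('x, 'y) gstar \<times> 'y) pmf" where
  "step_kernel h \<mu> t t' = map_pmf fst
     (cond_pmf
       (bind_pmf (cond_pmf \<mu> {\<tau>. root_nbrs \<tau> \<noteq> {}})
         (\<lambda>\<tau>. map_pmf (\<lambda>v. (root_branch h \<tau> v, branch_pair (h - 1) \<tau> v))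
                (pmf_of_set (root_nbrs \<tau>))))
       {(_, s', s). s = t \<and> s' = t'})"

text \<open>
  \<open>glue \<tau> s\<close> replaces the branch of \<open>\<tau>\<close> at each neighbour \<open>v\<close> of the root \<open>o\<close> (including the mark
  $y_{(v,o)}$) by \<open>s v\<close>; the root mark and the marks $y_{(o,v)}$ are kept. The new root is \<open>0\<close>, and
  \<open>branch_vertex v w\<close> is the copy of the vertex \<open>w\<close> of \<open>s v\<close>.
\<close>

definition branch_vertex :: "nat \<Rightarrow> nat \<Rightarrow> nat" where
  "branch_vertex v w = Suc (prod_encode (v, w))"

definition glue :: "('x, 'y) gstar \<Rightarrow> (nat \<Rightarrow> ('x, 'y) gstar \<times> 'y) \<Rightarrow> ('x, 'y) gstar" where
  "glue \<tau> s = abs_gstar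
     (\<lparr>verts = insert 0 {branch_vertex v w | v w. v \<in> root_nbrs \<tau> \<and> w \<in> verts (g_graph (fst (s v)))},
       adj = (\<lambda>a b.
         (\<exists>v\<in>root_nbrs \<tau>. {a, b} = {0, branch_vertex v (g_root (fst (s v)))}) \<or>
         (\<exists>v\<in>root_nbrs \<tau>. \<exists>w w'. adj (g_graph (fst (s v))) w w' \<and>
            a = branch_vertex v w \<and> b = branch_vertex v w')),
       vmark = (\<lambda>a. case a of
           0 \<Rightarrow> root_mark \<tau>
         | Suc m \<Rightarrow> (case prod_decode m of (v, w) \<Rightarrow> vmark (g_graph (fst (s v))) w)),
       emark = (\<lambda>a b. case a of
           0 \<Rightarrow> (case b of
               0 \<Rightarrow> undefined
             | Suc n \<Rightarrow> emark (g_graph \<tau>) (g_root \<tau>) (fst (prod_decode n)))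
         | Suc m \<Rightarrow> (case prod_decode m of (v, w) \<Rightarrow> (case b of
               0 \<Rightarrow> snd (s v)
             | Suc n \<Rightarrow> emark (g_graph (fst (s v))) w (snd (prod_decode n)))))\<rparr>, 0)"

text \<open>For $h \ge 2$, \<open>star_law h \<rho>\<close> is $\rho_h^*$.\<close>

definition star_law :: "nat \<Rightarrow> ('x, 'y) gstar measure \<Rightarrow> ('x, 'y) gstar pmf" where
  "star_law h \<rho> = bind_pmf (trunc_law (h - 1) \<rho>) (\<lambda>\<tau>. map_pmf (glue \<tau>)
     (Pi_pmf (root_nbrs \<tau>) undefined
       (\<lambda>v. step_kernel (h - 1) (trunc_law (h - 1) \<rho>)
              (child_branch (h - 2) \<tau> v) (root_branch (h - 2) \<tau> v))))"

text \<open>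
  The version of $\bar\rho_1^{1|o}$ is chosen to agree with $\bar\eta_1^{1|o}$ where the second
  marginal of $\bar\rho_1^{1,o}$ vanishes, so that it is absolutely continuous with respect to
  $\bar\eta_1^{1|o}$ everywhere.
\<close>

definition cond_law_eta ::
    "('x, 'y) gstar measure \<Rightarrow> ('x, 'y) gstar \<times> 'y \<Rightarrow> (('x, 'y) gstar \<times> 'y) pmf" where
  "cond_law_eta \<eta> = cond_fst (\<lambda>_. map_pmf fst (edge_law 1 (trunc_law 1 \<eta>))) (edge_law 1 (trunc_law 1 \<eta>))"

definition cond_law_rho ::
    "('x, 'y) gstar measure \<Rightarrow> ('x, 'y) gstar measure \<Rightarrow>
     ('x, 'y) gstar \<times> 'y \<Rightarrow> (('x, 'y) gstar \<times> 'y) pmf" where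
  "cond_law_rho \<eta> \<rho> = cond_fst (cond_law_eta \<eta>) (edge_law 1 (trunc_law 1 \<rho>))"

definition check_law :: "('x, 'y) gstar measure \<Rightarrow> ('x, 'y) gstar measure \<Rightarrow> nat \<Rightarrow> ('x, 'y) gstar measure" where
  "check_law \<eta> \<rho> h =
     (if h = 1 then
        density (measure_pmf (trunc_law 1 \<eta>)) (\<lambda>\<tau>. \<Prod>v\<in>root_nbrs \<tau>.
          RN_deriv (measure_pmf (map_pmf fst (edge_law 1 (trunc_law 1 \<eta>))))
                   (measure_pmf (map_pmf fst (edge_law 1 (trunc_law 1 \<rho>))))
                   (child_branch 0 \<tau> v))
      else measure_pmf (star_law h \<rho>))"

definition hat_law :: "('x, 'y) gstar measure \<Rightarrow> ('x, 'y) gstar measure \<Rightarrow> nat \<Rightarrow> ('x, 'y) gstar measure" where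
  "hat_law \<eta> \<rho> h =
     (if h = 1 then
        density (measure_pmf (trunc_law 1 \<eta>)) (\<lambda>\<tau>. \<Prod>v\<in>root_nbrs \<tau>.
          RN_deriv (measure_pmf (cond_law_eta \<eta> (root_branch 0 \<tau> v)))
                   (measure_pmf (cond_law_rho \<eta> \<rho> (root_branch 0 \<tau> v)))
                   (child_branch 0 \<tau> v))
      else
        density (measure_pmf (star_law h \<rho>)) (\<lambda>\<tau>. \<Prod>v\<in>root_nbrs \<tau>.
          RN_deriv (measure_pmf (edge_law h (star_law h \<rho>)))
                   (measure_pmf (edge_law h (trunc_law h \<rho>)))
                   (branch_pair (h - 1) \<tau> v)))"

section \<open>The functionals\<close>

text \<open>
  Relative entropy $H(\mu \| \mu')$ of probability measures, with values in $[0,\infty]$. If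
  $\mu \ll \mu'$, the negative part of $\log \frac{d\mu}{d\mu'}$ is $\mu$-integrable, so failure of
  integrability means that the integral is $\infty$.
\<close>

definition rel_entropy :: "'a measure \<Rightarrow> 'a measure \<Rightarrow> ereal" where
  "rel_entropy \<mu> \<mu>' =
     (if absolutely_continuous \<mu>' \<mu> \<and> integrable \<mu> (entropy_density (exp 1) \<mu>' \<mu>)
      then ereal (KL_divergence (exp 1) \<mu>' \<mu>) else \<infinity>)"

definition deg_log_deg :: "('x, 'y) gstar measure \<Rightarrow> ennreal" where
  "deg_log_deg \<rho> = (\<integral>\<^sup>+g. ennreal (real (root_deg g) * ln (real (root_deg g))) \<partial>\<rho>)"

definition rate_I ::
    "'x pmf \<Rightarrow> real \<Rightarrow> ('x, 'y) gstar measure \<Rightarrow> ('x, 'y) gstar measure \<Rightarrow> ereal" where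
  "rate_I \<nu> \<beta> \<eta> \<rho> =
     (if \<beta> = 0 \<and> mean_deg \<rho> = 0 then rel_entropy (root_law \<rho>) (measure_pmf \<nu>)
      else if \<beta> > 0 \<and> \<rho> \<in> unimod_trees \<beta> \<and>
              absolutely_continuous (measure_pmf (trunc_law 1 \<eta>)) (measure_pmf (trunc_law 1 \<rho>))
      then 1 / 2 * (\<Sum>h. rel_entropy (measure_pmf (trunc_law (h + 1) \<rho>)) (check_law \<eta> \<rho> (h + 1)) +
                         rel_entropy (measure_pmf (trunc_law (h + 1) \<rho>)) (hat_law \<eta> \<rho> (h + 1)))
      else \<infinity>)"

text \<open>Differences are taken in \<^typ>\<open>ereal\<close>, where $\infty - \infty = \infty$.\<close>

definition rate_I_tilde ::
    "'x pmf \<Rightarrow> real \<Rightarrow> ('x, 'y) gstar measure \<Rightarrow> ('x, 'y) gstar measure \<Rightarrow> ereal" where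
  "rate_I_tilde \<nu> \<beta> \<eta> \<rho> =
     (if \<beta> = 0 \<and> mean_deg \<rho> = 0 then rel_entropy (root_law \<rho>) (measure_pmf \<nu>)
      else if \<beta> > 0 \<and> \<rho> \<in> unimod_trees \<beta> \<and>
              absolutely_continuous (measure_pmf (trunc_law 1 \<eta>)) (measure_pmf (trunc_law 1 \<rho>)) \<and>
              deg_log_deg \<rho> < \<infinity>
      then (rel_entropy (measure_pmf (trunc_law 1 \<rho>)) (measure_pmf (trunc_law 1 \<eta>))
              - ereal (\<beta> / 2) * rel_entropy (measure_pmf (edge_law 1 (trunc_law 1 \<rho>)))
                                             (measure_pmf (edge_law 1 (trunc_law 1 \<eta>))))
           + (\<Sum>h. rel_entropy (measure_pmf (trunc_law (h + 2) \<rho>)) (measure_pmf (star_law (h + 2) \<rho>))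
              - ereal (\<beta> / 2) * rel_entropy (measure_pmf (edge_law (h + 2) (trunc_law (h + 2) \<rho>)))
                                             (measure_pmf (edge_law (h + 2) (star_law (h + 2) \<rho>))))
      else \<infinity>)"

end

theory Submission
  imports Defs
begin

text \<open>
  Both functionals are sums over the depth \<open>h\<close>, and the identity holds term by term: the sum over the
  root's children of a function of the pair of branches at the child has \<open>\<rho>_h\<close>-mean \<open>\<beta>\<close> times its mean
  under \<open>edge_law h \<rho>_h\<close>, so taking the logarithm of the density of \<open>hat_law\<close> gives
  $H(\rho_h \| \hat\rho_h) = H(\rho_h \| \rho_h^*) - \beta H(\bar\rho_h^{1,o} \| (\bar\rho_h^*)^{1,o})$.
  If $H(\rho_h \| \rho_h^*)$ is finite, then so is the subtracted entropy, because \<open>hat_law\<close> has mass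
  at most 1; this in turn holds because, given the ball of radius \<open>h - 1\<close>, the branches at the
  children are independent under $\rho_h^*$. For \<open>h = 1\<close> the edge law has finite support, and the two
  densities combine to the one of the edge law since unimodularity makes its two marginals equal.
  Finally, as the one-step extension is not size-biased, finiteness of $H(\rho_2 \| \rho_2^*)$ forces
  a finite \<open>deg * ln deg\<close> moment, so no moment condition is needed in \<open>rate_I\<close>.
  All of this rests on one decomposition: a tree is its root with a finite family of branches glued
  to it, and \<open>mk\<close> performs the gluing on isomorphism classes.
\<close>

section \<open>Balls, components and isomorphisms\<close>

text \<open>The delicate point is infinite values. In the extended reals
  \<open>\<infinity> - x = \<infinity>\<close> for every \<open>x\<close>, so a depth at which the
  entropy against \<open>star_law\<close> is infinite is harmless. At the other depths the edge
  entropy has to be shown finite before anything is subtracted. The log density is a sum over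
  children in which terms might cancel; two one-sided bounds exclude this: negative parts of log
  ratios are always integrable, by \<open>ln x \<le> x - 1\<close>, and a density of bounded mass
  controls the positive part of the whole sum. Independence helps with the mass because gluing
  longer branches does not change, to depth \<open>n + 1\<close>, what each child sees of the rest
  of the tree; every factor of the density thus depends on a single draw. The degree moment comes
  from the same inequality with another product density, namely degree over a constant. A uniform
  constant exists because finite mark spaces leave only finitely many pairs of depth 0 branches.
  Vertices of an isomorphism class have no canonical names, so children are always matched by
  bijections that preserve the branches.\<close>

definition sgraph :: "('x, 'y) mgraph \<Rightarrow> bool" where
  "sgraph G \<longleftrightarrow>
     (\<forall>u v. adj G u v \<longrightarrow> u \<in> verts G \<and> v \<in> verts G \<and> u \<noteq> v \<and> adj G v u) \<and>
     (\<forall>u\<in>verts G. finite (nbrs G u))"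

text \<open>Restricting to a vertex set or deleting an edge may destroy connectivity but keeps
  \<open>sgraph\<close>. Connectivity is then restored separately for balls and components.\<close>

lemma conn_lf_graph_iff:
  "conn_lf_graph G \<longleftrightarrow> sgraph G \<and> (\<forall>u\<in>verts G. \<forall>v\<in>verts G. (adj G)\<^sup>*\<^sup>* u v)"
  by (auto simp: conn_lf_graph_def sgraph_def)

lemma sgraphD:
  assumes "sgraph G" "adj G u v"
  shows "u \<in> verts G" "v \<in> verts G" "u \<noteq> v" "adj G v u"
  using assms by (auto simp: sgraph_def)

lemma conn_lf_sgraph: "conn_lf_graph G \<Longrightarrow> sgraph G"
  by (simp add: conn_lf_graph_iff)

lemma finite_nbrs:
  assumes "sgraph G"
  shows "finite (nbrs G u)"
proof (cases "u \<in> verts G")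
  case True
  then show ?thesis using assms by (simp add: sgraph_def)
next
  case False
  then have "nbrs G u = {}" using assms by (auto simp: sgraph_def nbrs_def)
  then show ?thesis by simp
qed

lemma induced_simps [simp]:
  "verts (induced G S) = verts G \<inter> S"
  "adj (induced G S) u v \<longleftrightarrow> u \<in> S \<and> v \<in> S \<and> adj G u v"
  "vmark (induced G S) = vmark G" "emark (induced G S) = emark G"
  by (auto simp: induced_def)

lemma delete_edge_simps [simp]:
  "verts (delete_edge G u v) = verts G"
  "adj (delete_edge G u v) a b \<longleftrightarrow> adj G a b \<and> {a, b} \<noteq> {u, v}"
  "vmark (delete_edge G u v) = vmark G" "emark (delete_edge G u v) = emark G"
  by (auto simp: delete_edge_def)

lemma induced_induced: "S \<subseteq> B \<Longrightarrow> induced (induced G B) S = induced G S"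
  by (auto simp: induced_def fun_eq_iff intro!: mgraph.equality)

lemma delete_edge_induced: "delete_edge (induced G B) u v = induced (delete_edge G u v) B"
  by (auto simp: induced_def delete_edge_def fun_eq_iff)

lemma sgraph_induced: "sgraph G \<Longrightarrow> sgraph (induced G S)"
  unfolding sgraph_def nbrs_def
  by (auto elim!: finite_subset[rotated])

lemma sgraph_delete_edge: "sgraph G \<Longrightarrow> sgraph (delete_edge G u v)"
  unfolding sgraph_def nbrs_def
  by (auto elim!: finite_subset[rotated] simp: insert_commute)

lemma relpowp_verts:
  assumes "sgraph G" "u \<in> verts G" "(adj G ^^ n) u v"
  shows "v \<in> verts G"
  using assms(3)
  using assms(2) by (cases n) (auto dest: sgraphD[OF assms(1)])

lemma graph_ball_subset: "graph_ball G u h \<subseteq> verts G"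
  by (auto simp: graph_ball_def)

lemma root_in_graph_ball: "u \<in> verts G \<Longrightarrow> u \<in> graph_ball G u h"
  by (auto simp: graph_ball_def intro!: exI[of _ 0])

lemma graph_ball_mono: "h \<le> k \<Longrightarrow> graph_ball G u h \<subseteq> graph_ball G u k"
  by (auto simp: graph_ball_def) (meson order_trans)

lemma graph_ball_0: "u \<in> verts G \<Longrightarrow> graph_ball G u 0 = {u}"
  by (auto simp: graph_ball_def)

lemma graph_component_subset: "graph_component G u \<subseteq> verts G"
  by (auto simp: graph_component_def)

lemma graph_ball_component: "graph_ball G u h \<subseteq> graph_component G u"
  by (auto simp: graph_ball_def graph_component_def rtranclp_power)

lemma graph_component_eq: "graph_component G u = (\<Union>h. graph_ball G u h)"
  by (auto simp: graph_ball_def graph_component_def rtranclp_power)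

lemma graph_ball_step:
  assumes "sgraph G" "a \<in> graph_ball G u h" "adj G a b"
  shows "b \<in> graph_ball G u (Suc h)"
proof -
  obtain n where n: "n \<le> h" "(adj G ^^ n) u a"
    using assms by (auto simp: graph_ball_def)
  have "(adj G ^^ Suc n) u b" using n assms(3) by auto
  then show ?thesis using n(1) sgraphD[OF assms(1,3)] unfolding graph_ball_def by blast
qed

lemma finite_graph_ball:
  assumes "sgraph G" "u \<in> verts G"
  shows "finite (graph_ball G u h)"
proof (induction h)
  case 0
  then show ?case using assms by (simp add: graph_ball_0)
next
  case (Suc h)
  have "graph_ball G u (Suc h) \<subseteq> insert u (\<Union>a\<in>graph_ball G u h. nbrs G a)"
  proof
    fix b assume "b \<in> graph_ball G u (Suc h)"
    then obtain n where n: "n \<le> Suc h" "(adj G ^^ n) u b" by (auto simp: graph_ball_def)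
    show "b \<in> insert u (\<Union>a\<in>graph_ball G u h. nbrs G a)"
    proof (cases n)
      case 0
      then show ?thesis using n by auto
    next
      case (Suc m)
      then obtain a where "(adj G ^^ m) u a" "adj G a b" using n by auto
      then have "a \<in> graph_ball G u h" "b \<in> nbrs G a"
        using n Suc relpowp_verts[OF assms] by (auto simp: graph_ball_def nbrs_def)
      then show ?thesis by blast
    qed
  qed
  then show ?case
    by (rule finite_subset) (auto intro: Suc finite_nbrs[OF assms(1)])
qed

text \<open>Every initial piece of a walk of length at most \<open>h\<close> ends inside the ball of
  radius \<open>h\<close>, so the walk survives restriction to any set containing that ball.\<close>

lemma relpowp_induced:
  assumes "sgraph G" "u \<in> verts G" "graph_ball G u h \<subseteq> B" "(adj G ^^ n) u w" "n \<le> h"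
  shows "(adj (induced G B) ^^ n) u w"
  using assms(4,5)
proof (induction n arbitrary: w)
  case 0
  then show ?case by simp
next
  case (Suc n)
  then obtain a where a: "(adj G ^^ n) u a" "adj G a w" by auto
  have "(adj G ^^ n) u a \<Longrightarrow> n \<le> h \<Longrightarrow> a \<in> B" "w \<in> B"
    using assms(3) relpowp_verts[OF assms(1,2) a(1)] relpowp_verts[OF assms(1,2) Suc.prems(1)]
      Suc.prems unfolding graph_ball_def by blast+
  then have "adj (induced G B) a w" using a Suc.prems by simp
  then show ?case using Suc.IH[OF a(1)] Suc.prems by auto
qed

lemma graph_ball_induced:
  assumes "sgraph G" "u \<in> verts G" "graph_ball G u h \<subseteq> B"
  shows "graph_ball (induced G B) u h = graph_ball G u h"
proof
  have "(adj (induced G B) ^^ n) u w \<Longrightarrow> (adj G ^^ n) u w" for n w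
    by (rule relpowp_mono[of "adj (induced G B)"]) auto
  then show "graph_ball (induced G B) u h \<subseteq> graph_ball G u h"
    by (auto simp: graph_ball_def)
  show "graph_ball G u h \<subseteq> graph_ball (induced G B) u h"
  proof
    fix w assume w: "w \<in> graph_ball G u h"
    then obtain n where "n \<le> h" "(adj G ^^ n) u w" by (auto simp: graph_ball_def)
    then show "w \<in> graph_ball (induced G B) u h"
      using relpowp_induced[OF assms] w assms(3) unfolding graph_ball_def by auto
  qed
qed

lemma rtranclp_adj_sym:
  assumes "sgraph G" "(adj G)\<^sup>*\<^sup>* u v"
  shows "(adj G)\<^sup>*\<^sup>* v u"
  using assms(2)
proof (induction rule: rtranclp_induct)
  case (step b c)
  then show ?case using sgraphD(4)[OF assms(1)] by (meson converse_rtranclp_into_rtranclp)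
qed simp

lemma conn_lf_graphI:
  assumes "sgraph G" "\<And>v. v \<in> verts G \<Longrightarrow> (adj G)\<^sup>*\<^sup>* r v"
  shows "conn_lf_graph G"
  unfolding conn_lf_graph_iff using assms rtranclp_adj_sym[OF assms(1)]
  by (meson rtranclp_trans)

lemma conn_lf_ball:
  assumes "sgraph G" "u \<in> verts G"
  shows "conn_lf_graph (induced G (graph_ball G u h))"
proof (rule conn_lf_graphI[where r = u])
  show "sgraph (induced G (graph_ball G u h))" by (rule sgraph_induced[OF assms(1)])
  fix v assume "v \<in> verts (induced G (graph_ball G u h))"
  then obtain n where "n \<le> h" "(adj G ^^ n) u v" by (auto simp: graph_ball_def)
  then show "(adj (induced G (graph_ball G u h)))\<^sup>*\<^sup>* u v"
    using relpowp_induced[OF assms order_refl] relpowp_imp_rtranclp by metis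
qed

lemma in_graph_component: "u \<in> verts G \<Longrightarrow> u \<in> graph_component G u"
  by (simp add: graph_component_def)

lemma conn_lf_component:
  assumes "sgraph G" "u \<in> verts G"
  shows "conn_lf_graph (induced G (graph_component G u))"
proof (rule conn_lf_graphI[where r = u])
  show "sgraph (induced G (graph_component G u))" by (rule sgraph_induced[OF assms(1)])
  fix v assume "v \<in> verts (induced G (graph_component G u))"
  then obtain n where n: "(adj G ^^ n) u v" by (auto simp: graph_component_def rtranclp_power)
  \<comment> \<open>A walk of length \<open>n\<close> lies in the ball of radius \<open>n\<close>,
    which is part of the component whatever \<open>n\<close> is.\<close>
  show "(adj (induced G (graph_component G u)))\<^sup>*\<^sup>* u v"
    using relpowp_induced[OF assms graph_ball_component n order_refl] by (rule relpowp_imp_rtranclp)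
qed

section \<open>Invariance of balls, components and edge deletion under isomorphism\<close>

lemma graph_iso_inj: "graph_iso f G H \<Longrightarrow> inj_on f (verts G)"
  by (auto simp: graph_iso_def bij_betw_def)

lemma graph_iso_verts: "graph_iso f G H \<Longrightarrow> u \<in> verts G \<Longrightarrow> f u \<in> verts H"
  by (auto simp: graph_iso_def bij_betw_def)

lemma graph_iso_adj:
  "graph_iso f G H \<Longrightarrow> u \<in> verts G \<Longrightarrow> v \<in> verts G \<Longrightarrow> adj H (f u) (f v) \<longleftrightarrow> adj G u v"
  by (auto simp: graph_iso_def)

lemma graph_iso_image: "graph_iso f G H \<Longrightarrow> f ` verts G = verts H"
  by (auto simp: graph_iso_def bij_betw_def)

lemma graph_iso_relpowp:
  assumes "graph_iso f G H" "sgraph G" "u \<in> verts G" "(adj G ^^ n) u v"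
  shows "(adj H ^^ n) (f u) (f v)"
  using assms(4)
proof (induction n arbitrary: v)
  case (Suc n)
  then obtain a where a: "(adj G ^^ n) u a" "adj G a v" by auto
  then have "adj H (f a) (f v)"
    using graph_iso_adj[OF assms(1)] sgraphD[OF assms(2) a(2)] by simp
  then show ?case using Suc.IH[OF a(1)] by auto
qed simp

lemma graph_iso_ball:
  assumes "graph_iso f G H" "sgraph G" "sgraph H" "u \<in> verts G"
  shows "f ` graph_ball G u h = graph_ball H (f u) h"
proof
  show "f ` graph_ball G u h \<subseteq> graph_ball H (f u) h"
    using graph_iso_relpowp[OF assms(1,2,4)] graph_iso_verts[OF assms(1)]
    by (auto simp: graph_ball_def)
  show "graph_ball H (f u) h \<subseteq> f ` graph_ball G u h"
  proof
    fix w assume w: "w \<in> graph_ball H (f u) h"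
    let ?g = "inv_into (verts G) f"
    have g: "graph_iso ?g H G" by (rule graph_iso_inv[OF assms(1)])
    have fg: "f (?g w) = w" "?g (f u) = u"
      using w graph_iso_image[OF assms(1)] graph_iso_inj[OF assms(1)] assms(4)
      by (auto simp: graph_ball_def f_inv_into_f)
    have "?g w \<in> graph_ball G u h"
      using w graph_iso_relpowp[OF g assms(3) graph_iso_verts[OF assms(1,4)]]
        graph_iso_verts[OF g] fg by (auto simp: graph_ball_def)
    then show "w \<in> f ` graph_ball G u h" using fg by (metis imageI)
  qed
qed

lemma graph_iso_component:
  assumes "graph_iso f G H" "sgraph G" "sgraph H" "u \<in> verts G"
  shows "f ` graph_component G u = graph_component H (f u)"
  by (simp add: graph_component_eq image_UN graph_iso_ball[OF assms])

lemma graph_iso_induced: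
  assumes "graph_iso f G H" "S \<subseteq> verts G"
  shows "graph_iso f (induced G S) (induced H (f ` S))"
proof -
  have inj: "inj_on f (verts G)" by (rule graph_iso_inj[OF assms(1)])
  have "f ` (verts G \<inter> S) = verts H \<inter> f ` S"
    using assms graph_iso_image[OF assms(1)] by auto
  then have "bij_betw f (verts G \<inter> S) (verts H \<inter> f ` S)"
    using inj by (auto simp: bij_betw_def intro: inj_on_subset)
  then show ?thesis using assms unfolding graph_iso_def by auto
qed

lemma graph_iso_delete_edge:
  assumes "graph_iso f G H" "u \<in> verts G" "v \<in> verts G"
  shows "graph_iso f (delete_edge G u v) (delete_edge H (f u) (f v))"
proof -
  have "{f a, f b} = {f u, f v} \<longleftrightarrow> {a, b} = {u, v}" if "a \<in> verts G" "b \<in> verts G" for a b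
    using graph_iso_inj[OF assms(1)] that assms(2,3) by (auto simp: doubleton_eq_iff inj_on_def)
  then show ?thesis using assms(1) unfolding graph_iso_def by auto
qed

section \<open>Isomorphism classes\<close>

definition rooted :: "('x, 'y) mgraph \<times> nat \<Rightarrow> bool" where
  "rooted R \<longleftrightarrow> conn_lf_graph (fst R) \<and> snd R \<in> verts (fst R)"

lemma rooted_iso_refl_iff: "rooted_iso R R \<longleftrightarrow> rooted R"
  by (auto simp: rooted_iso_def rooted_def split: prod.splits intro!: exI[of _ id] graph_iso_id)

lemma rooted_iso_iff:
  "rooted_iso R S \<longleftrightarrow> rooted R \<and> rooted S \<and> (\<exists>f. graph_iso f (fst R) (fst S) \<and> f (snd R) = snd S)"
  by (auto simp: rooted_iso_def rooted_def split: prod.splits)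

lemma abs_gstar_eqI:
  assumes "rooted R" "rooted S" "graph_iso f (fst R) (fst S)" "f (snd R) = snd S"
  shows "abs_gstar R = abs_gstar S"
  using assms Quotient3_rel[OF Quotient3_gstar, of R S] by (auto simp: rooted_iso_iff)

lemma abs_gstar_eqD:
  assumes "rooted R" "rooted S" "abs_gstar R = abs_gstar S"
  shows "\<exists>f. graph_iso f (fst R) (fst S) \<and> f (snd R) = snd S"
  using assms Quotient3_rel[OF Quotient3_gstar, of R S]
    rooted_iso_refl_iff[of R] rooted_iso_refl_iff[of S] rooted_iso_iff[of R S] by blast

lemma rooted_rep: "rooted (rep_gstar g)"
  using Quotient3_rep_reflp[OF Quotient3_gstar] by (simp add: rooted_iso_refl_iff)

lemma abs_rep_gstar: "abs_gstar (rep_gstar g) = g"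
  by (rule Quotient3_abs_rep[OF Quotient3_gstar])

lemma rep_gstar_eq: "rep_gstar g = (g_graph g, g_root g)"
  by (simp add: g_graph_def g_root_def)

lemma g_graph_ok: "conn_lf_graph (g_graph g)" "g_root g \<in> verts (g_graph g)"
    "abs_gstar (g_graph g, g_root g) = g"
  using rooted_rep[of g] abs_rep_gstar[of g] by (auto simp: rep_gstar_eq rooted_def)

lemma sgraph_g_graph: "sgraph (g_graph g)"
  by (rule conn_lf_sgraph[OF g_graph_ok(1)])

text \<open>The representative picked by the quotient is arbitrary; this isomorphism carries
  computations on a concrete graph over to it.\<close>

lemma iso_rep_abs:
  assumes "conn_lf_graph G" "r \<in> verts G"
  shows "\<exists>f. graph_iso f G (g_graph (abs_gstar (G, r))) \<and> f r = g_root (abs_gstar (G, r))"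
  using abs_gstar_eqD[of "(G, r)" "rep_gstar (abs_gstar (G, r))"] assms
  by (auto simp: rooted_rep rooted_def[of "(G, r)"] abs_rep_gstar)
    (auto simp: rep_gstar_eq)

lemma finite_root_nbrs: "finite (root_nbrs g)"
  by (simp add: root_nbrs_def finite_nbrs[OF sgraph_g_graph])

lemma trunc_abs:
  assumes "conn_lf_graph G" "r \<in> verts G"
  shows "trunc h (abs_gstar (G, r)) = abs_gstar (induced G (graph_ball G r h), r)"
proof -
  let ?g = "abs_gstar (G, r)"
  obtain f where f: "graph_iso f G (g_graph ?g)" "f r = g_root ?g"
    using iso_rep_abs[OF assms] by auto
  have s: "sgraph G" by (rule conn_lf_sgraph[OF assms(1)])
  have "graph_iso f (induced G (graph_ball G r h))
      (induced (g_graph ?g) (graph_ball (g_graph ?g) (g_root ?g) h))"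
    using graph_iso_induced[OF f(1) graph_ball_subset] graph_iso_ball[OF f(1) s sgraph_g_graph assms(2)]
      f(2) by metis
  then show ?thesis
    unfolding trunc_def
    by (intro abs_gstar_eqI[symmetric, where f = f])
      (auto simp: f rooted_def root_in_graph_ball assms g_graph_ok
        intro!: conn_lf_ball s sgraph_g_graph)
qed

lemma trunc_trunc:
  assumes "h \<le> k"
  shows "trunc h (trunc k g) = trunc h g"
proof -
  let ?G = "g_graph g" and ?r = "g_root g"
  have "trunc h (trunc k g) = abs_gstar (induced (induced ?G (graph_ball ?G ?r k))
      (graph_ball (induced ?G (graph_ball ?G ?r k)) ?r h), ?r)"
    unfolding trunc_def[of k]
    by (rule trunc_abs) (auto intro!: conn_lf_ball simp: sgraph_g_graph g_graph_ok root_in_graph_ball)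
  also have "\<dots> = trunc h g"
    unfolding trunc_def
    by (simp add: graph_ball_induced[OF sgraph_g_graph] g_graph_ok graph_ball_mono[OF assms]
        induced_induced)
  finally show ?thesis .
qed

definition vertex_graph :: "'x \<Rightarrow> ('x, 'y) mgraph" where
  "vertex_graph x = \<lparr>verts = {0}, adj = (\<lambda>_ _. False), vmark = (\<lambda>_. x), emark = undefined\<rparr>"

lemma trunc_0: "trunc 0 g = abs_gstar (vertex_graph (root_mark g), 0)"
proof -
  let ?G = "g_graph g" and ?r = "g_root g"
  have r: "rooted (induced ?G {?r}, ?r)"
    using conn_lf_ball[OF sgraph_g_graph g_graph_ok(2), of g 0] g_graph_ok[of g]
    by (simp add: rooted_def graph_ball_0)
  have s: "rooted (vertex_graph (root_mark g), 0)"
    by (auto simp: rooted_def conn_lf_graph_def vertex_graph_def nbrs_def)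
  have "graph_iso (\<lambda>_. 0) (induced ?G {?r}) (vertex_graph (root_mark g))"
    using g_graph_ok[of g] sgraphD(3)[OF sgraph_g_graph[of g], of "g_root g" "g_root g"]
    by (auto simp: graph_iso_def vertex_graph_def root_mark_def bij_betw_def)
  then show ?thesis
    unfolding trunc_def graph_ball_0[OF g_graph_ok(2)]
    using r s by (intro abs_gstar_eqI[where f = "\<lambda>_. 0"]) simp_all
qed

text \<open>A ball of radius 0 is a single marked vertex. This finiteness gives integrability for
  free at level one and a uniform constant in the bound on the degree moment.\<close>

lemma finite_range_trunc_0: "finite (range (trunc 0 :: ('x :: finite, 'y) gstar \<Rightarrow> _))"
proof (rule finite_subset)
  show "range (trunc 0 :: ('x, 'y) gstar \<Rightarrow> _) \<subseteq> range (\<lambda>x. abs_gstar (vertex_graph x, 0))"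
    by (auto simp: trunc_0)
qed simp

text \<open>A finite ball is coded by lists of vertices, edges and marks, which form a countable
  type; hence the truncated laws are discrete.\<close>

lemma countable_range_trunc:
  "countable (range (trunc h :: ('x :: finite, 'y :: finite) gstar \<Rightarrow> _))"
proof -
  define dec :: "nat \<times> nat list \<times> (nat \<times> nat) list \<times> (nat \<times> 'x) list \<times> ((nat \<times> nat) \<times> 'y) list
      \<Rightarrow> ('x, 'y) gstar"
    where "dec = (\<lambda>(r, vs, es, xs, ys). abs_gstar (\<lparr>verts = set vs, adj = (\<lambda>u v. (u, v) \<in> set es),
      vmark = (\<lambda>u. the (map_of xs u)), emark = (\<lambda>u v. the (map_of ys (u, v)))\<rparr>, r))"
  have "trunc h g \<in> range dec" for g :: "('x, 'y) gstar"
  proof -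
    let ?G = "g_graph g" and ?r = "g_root g"
    define B where "B = graph_ball ?G ?r h"
    have B: "finite B" "?r \<in> B" "B \<subseteq> verts ?G" "conn_lf_graph (induced ?G B)"
      unfolding B_def
      by (auto simp: finite_graph_ball sgraph_g_graph g_graph_ok root_in_graph_ball
          graph_ball_subset[THEN subsetD] intro!: conn_lf_ball)
    obtain vs where vs: "set vs = B" using finite_list[OF B(1)] by auto
    define es where "es = filter (\<lambda>(u, v). adj ?G u v) (List.product vs vs)"
    define xs where "xs = map (\<lambda>u. (u, vmark ?G u)) vs"
    define ys where "ys = map (\<lambda>p. (p, emark ?G (fst p) (snd p))) (List.product vs vs)"
    let ?H = "\<lparr>verts = set vs, adj = (\<lambda>u v. (u, v) \<in> set es),
      vmark = (\<lambda>u. the (map_of xs u)), emark = (\<lambda>u v. the (map_of ys (u, v)))\<rparr>"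
    have adj: "adj ?H = adj (induced ?G B)" by (auto simp: es_def vs fun_eq_iff)
    have verts: "verts ?H = verts (induced ?G B)" using vs B by auto
    have "graph_iso id (induced ?G B) ?H"
      unfolding graph_iso_def adj verts
      using vs B by (auto simp: xs_def ys_def map_of_map_keys map_of_map_restrict)
    moreover have "conn_lf_graph ?H"
      using B(4) unfolding conn_lf_graph_def nbrs_def adj verts .
    ultimately have "trunc h g = abs_gstar (?H, ?r)"
      unfolding trunc_def B_def[symmetric]
      using B vs by (intro abs_gstar_eqI[where f = id]) (auto simp: rooted_def)
    then have "trunc h g = dec (?r, vs, es, xs, ys)" by (simp add: dec_def)
    then show ?thesis by blast
  qed
  then show ?thesis
    by (metis (mono_tags, opaque_lifting) countableI_type countable_image countable_subset image_subset_iff)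
qed

section \<open>Cutting an edge and truncating the pieces\<close>

lemma cut_branch_iso:
  assumes f: "graph_iso f G H" and G: "sgraph G" "sgraph H" and uv: "u \<in> verts G" "v \<in> verts G"
    and "adj G v u"
  shows "cut_branch H (f v) (f u) = cut_branch G v u"
proof -
  let ?D = "delete_edge G u v" and ?E = "delete_edge H (f u) (f v)"
  have s: "sgraph ?D" "sgraph ?E" using G by (auto intro: sgraph_delete_edge)
  have i: "graph_iso f ?D ?E" by (rule graph_iso_delete_edge[OF f uv])
  have c: "f ` graph_component ?D v = graph_component ?E (f v)"
    by (rule graph_iso_component[OF i s]) (simp add: uv)
  have fv: "f v \<in> verts H" by (rule graph_iso_verts[OF f uv(2)])
  have "graph_iso f (induced ?D (graph_component ?D v)) (induced ?E (graph_component ?E (f v)))"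
    using graph_iso_induced[OF i graph_component_subset, of v] unfolding c .
  then have "abs_gstar (induced ?D (graph_component ?D v), v)
      = abs_gstar (induced ?E (graph_component ?E (f v)), f v)"
    by (intro abs_gstar_eqI[where f = f])
      (simp_all add: rooted_def uv fv s conn_lf_component in_graph_component)
  moreover have "emark H (f v) (f u) = emark G v u" using f uv assms(6) by (auto simp: graph_iso_def)
  ultimately show ?thesis by (simp add: cut_branch_def)
qed

lemma trunc_branch_cut:
  assumes "sgraph G" "v \<in> verts G"
  shows "trunc_branch h (cut_branch G v u) =
    (abs_gstar (induced (delete_edge G u v) (graph_ball (delete_edge G u v) v h), v), emark G v u)"
proof -
  let ?D = "delete_edge G u v"
  have s: "sgraph ?D" by (rule sgraph_delete_edge[OF assms(1)])
  have v: "v \<in> verts ?D" using assms by simp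
  have "trunc h (abs_gstar (induced ?D (graph_component ?D v), v)) =
    abs_gstar (induced (induced ?D (graph_component ?D v)) (graph_ball (induced ?D (graph_component ?D v)) v h), v)"
    by (rule trunc_abs) (use s v in \<open>simp_all add: conn_lf_component in_graph_component\<close>)
  also have "\<dots> = abs_gstar (induced ?D (graph_ball ?D v h), v)"
    by (simp only: graph_ball_induced[OF s v graph_ball_component] induced_induced[OF graph_ball_component])
  finally show ?thesis by (simp add: trunc_branch_def cut_branch_def)
qed

lemma trunc_branch_trunc_branch:
  "h \<le> k \<Longrightarrow> trunc_branch h (trunc_branch k p) = trunc_branch h p"
  by (cases p) (simp add: trunc_branch_def trunc_trunc)

text \<open>Both ends of the edge are within distance 1 of \<open>u\<close>, so a branch of depth
  \<open>k\<close> at either end lies in the ball of radius \<open>k + 1\<close> around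
  \<open>u\<close>. Measurability of functions of the branches rests on this.\<close>

lemma trunc_branch_local:
  assumes G: "sgraph G" and a: "adj G u v"
    and B: "graph_ball G u (Suc k) \<subseteq> B" and w: "(w, w') = (u, v) \<or> (w, w') = (v, u)"
  shows "trunc_branch k (cut_branch (induced G B) w w') = trunc_branch k (cut_branch G w w')"
proof -
  let ?D = "delete_edge G w' w"
  have uv: "u \<in> verts G" "v \<in> verts G" "adj G v u" using sgraphD[OF G a] by auto
  have D: "sgraph ?D" by (rule sgraph_delete_edge[OF G])
  have w0: "\<exists>m\<le>1. (adj G ^^ m) u w" using w a
    by (elim disjE) (auto intro: exI[of _ 0], intro exI[of _ 1], auto)
  have sub: "graph_ball ?D w k \<subseteq> B"
  proof
    fix b assume b: "b \<in> graph_ball ?D w k"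
    then obtain n where n: "n \<le> k" "(adj ?D ^^ n) w b" by (auto simp: graph_ball_def)
    have "(adj G ^^ n) w b" by (rule relpowp_mono[OF _ n(2)]) auto
    with w0 obtain m where "m \<le> 1" "(adj G ^^ (m + n)) u b"
      by (metis relpowp_trans)
    then have "b \<in> graph_ball G u (Suc k)"
      using n(1) b by (auto simp: graph_ball_def intro!: exI[of _ "m + n"])
    then show "b \<in> B" using B by auto
  qed
  have ub: "u \<in> B" "v \<in> B"
    using B root_in_graph_ball[OF uv(1), of "Suc k"] graph_ball_mono[of "Suc 0" "Suc k" G u]
      graph_ball_step[OF G root_in_graph_ball[OF uv(1), of 0] a] by auto
  have wv: "w \<in> verts G" "w \<in> verts (induced G B)" using w uv ub by auto
  have wD: "w \<in> verts ?D" using wv by simp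
  show ?thesis
    unfolding trunc_branch_cut[OF G wv(1)] trunc_branch_cut[OF sgraph_induced[OF G] wv(2)]
      delete_edge_induced graph_ball_induced[OF D wD sub] induced_induced[OF sub] by simp
qed

section \<open>Gluing branches to a root\<close>

text \<open>The graph inside \<open>glue\<close>, with the root data as parameters and with concrete
  rooted graphs as branches, so that cuts and balls can be computed on actual vertices before
  passing to classes.\<close>

definition mkG :: "'x \<Rightarrow> nat set \<Rightarrow> (nat \<Rightarrow> 'y) \<Rightarrow> (nat \<Rightarrow> (('x, 'y) mgraph \<times> nat) \<times> 'y) \<Rightarrow>
    ('x, 'y) mgraph" where
  "mkG x I y s = \<lparr>verts = insert 0 {branch_vertex v w | v w. v \<in> I \<and> w \<in> verts (fst (fst (s v)))},
       adj = (\<lambda>a b.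
         (\<exists>v\<in>I. {a, b} = {0, branch_vertex v (snd (fst (s v)))}) \<or>
         (\<exists>v\<in>I. \<exists>w w'. adj (fst (fst (s v))) w w' \<and>
            a = branch_vertex v w \<and> b = branch_vertex v w')),
       vmark = (\<lambda>a. case a of
           0 \<Rightarrow> x
         | Suc m \<Rightarrow> (case prod_decode m of (v, w) \<Rightarrow> vmark (fst (fst (s v))) w)),
       emark = (\<lambda>a b. case a of
           0 \<Rightarrow> (case b of
               0 \<Rightarrow> undefined
             | Suc n \<Rightarrow> y (fst (prod_decode n)))
         | Suc m \<Rightarrow> (case prod_decode m of (v, w) \<Rightarrow> (case b of
               0 \<Rightarrow> snd (s v)
             | Suc n \<Rightarrow> emark (fst (fst (s v))) w (snd (prod_decode n)))))\<rparr>"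

definition mk :: "'x \<Rightarrow> nat set \<Rightarrow> (nat \<Rightarrow> 'y) \<Rightarrow> (nat \<Rightarrow> ('x, 'y) gstar \<times> 'y) \<Rightarrow> ('x, 'y) gstar" where
  "mk x I y s = abs_gstar (mkG x I y (map_prod rep_gstar id \<circ> s), 0)"

lemma glue_eq_mk: "glue \<tau> s = mk (root_mark \<tau>) (root_nbrs \<tau>) (emark (g_graph \<tau>) (g_root \<tau>)) s"
  unfolding glue_def mk_def mkG_def g_graph_def g_root_def comp_def fst_map_prod snd_map_prod id_apply ..

lemma branch_vertex_simps [simp]:
  "branch_vertex v w = branch_vertex v' w' \<longleftrightarrow> v = v' \<and> w = w'"
  "branch_vertex v w \<noteq> 0" "0 \<noteq> branch_vertex v w"
  by (auto simp: branch_vertex_def)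

lemma branch_vertex_cases [case_names root branch]:
  obtains "a = 0" | v w where "a = branch_vertex v w"
  by (cases a) (auto simp: branch_vertex_def, metis prod_decode_inverse surj_pair)

lemma mkG_simps [simp]:
  "0 \<in> verts (mkG x I y s)"
  "branch_vertex v w \<in> verts (mkG x I y s) \<longleftrightarrow> v \<in> I \<and> w \<in> verts (fst (fst (s v)))"
  "\<not> adj (mkG x I y s) 0 0"
  "adj (mkG x I y s) 0 (branch_vertex v w) \<longleftrightarrow> v \<in> I \<and> w = snd (fst (s v))"
  "adj (mkG x I y s) (branch_vertex v w) 0 \<longleftrightarrow> v \<in> I \<and> w = snd (fst (s v))"
  "adj (mkG x I y s) (branch_vertex v w) (branch_vertex v' w') \<longleftrightarrow>
     v = v' \<and> v \<in> I \<and> adj (fst (fst (s v))) w w'"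
  "vmark (mkG x I y s) 0 = x"
  "vmark (mkG x I y s) (branch_vertex v w) = vmark (fst (fst (s v))) w"
  "emark (mkG x I y s) 0 (branch_vertex v w) = y v"
  "emark (mkG x I y s) (branch_vertex v w) 0 = snd (s v)"
  "emark (mkG x I y s) (branch_vertex v w) (branch_vertex v' w') = emark (fst (fst (s v))) w w'"
  by (auto simp: mkG_def doubleton_eq_iff) (auto simp: branch_vertex_def)

lemma verts_mkG:
  "verts (mkG x I y s) = insert 0 {branch_vertex v w | v w. v \<in> I \<and> w \<in> verts (fst (fst (s v)))}"
  by (simp add: mkG_def)

lemma nbrs_mkG: "nbrs (mkG x I y s) 0 = (\<lambda>v. branch_vertex v (snd (fst (s v)))) ` I"
proof -
  have "b \<in> nbrs (mkG x I y s) 0 \<longleftrightarrow> b \<in> (\<lambda>v. branch_vertex v (snd (fst (s v)))) ` I" for b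
    by (cases b rule: branch_vertex_cases) (auto simp: nbrs_def)
  then show ?thesis by auto
qed

lemma sgraph_mkG:
  assumes "finite I" "\<And>v. v \<in> I \<Longrightarrow> rooted (fst (s v))"
  shows "sgraph (mkG x I y s)"
proof -
  let ?M = "mkG x I y s"
  have s: "sgraph (fst (fst (s v)))" "snd (fst (s v)) \<in> verts (fst (fst (s v)))" if "v \<in> I" for v
    using assms(2)[OF that] by (auto simp: rooted_def conn_lf_sgraph)
  have "a \<in> verts ?M \<and> b \<in> verts ?M \<and> a \<noteq> b" if "adj ?M a b" for a b
    using that s
    by (cases a rule: branch_vertex_cases; cases b rule: branch_vertex_cases)
      (auto dest: sgraphD(1-3)[OF s(1)])
  moreover have "adj ?M b a" if "adj ?M a b" for a b
    using that
    by (cases a rule: branch_vertex_cases; cases b rule: branch_vertex_cases)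
      (auto intro: sgraphD(4)[OF s(1)])
  moreover have "finite (nbrs ?M a)" for a
  proof (cases a rule: branch_vertex_cases)
    case root
    then show ?thesis using assms(1) by (simp add: nbrs_mkG)
  next
    case (branch v w)
    have "nbrs ?M a \<subseteq> insert 0 (if v \<in> I then branch_vertex v ` nbrs (fst (fst (s v))) w else {})"
    proof
      fix b assume "b \<in> nbrs ?M a"
      then show "b \<in> insert 0 (if v \<in> I then branch_vertex v ` nbrs (fst (fst (s v))) w else {})"
        by (cases b rule: branch_vertex_cases) (auto simp: nbrs_def branch)
    qed
    then show ?thesis
      by (rule finite_subset) (simp add: finite_nbrs s)
  qed
  ultimately show ?thesis by (simp add: sgraph_def)
qed

lemma mkG_branch_relpowp:
  assumes "i \<in> I" "(adj (fst (fst (s i))) ^^ n) w w'"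
  shows "(adj (mkG x I y s) ^^ n) (branch_vertex i w) (branch_vertex i w')"
  using assms(2)
proof (induction n arbitrary: w')
  case (Suc n)
  then obtain b where b: "(adj (fst (fst (s i))) ^^ n) w b" "adj (fst (fst (s i))) b w'" by auto
  then have "adj (mkG x I y s) (branch_vertex i b) (branch_vertex i w')" using assms(1) by simp
  then show ?case using Suc.IH[OF b(1)] by auto
qed simp

lemma mkG_root_relpowp:
  assumes "i \<in> I" "(adj (fst (fst (s i))) ^^ n) (snd (fst (s i))) w"
  shows "(adj (mkG x I y s) ^^ Suc n) 0 (branch_vertex i w)"
proof -
  have "adj (mkG x I y s) 0 (branch_vertex i (snd (fst (s i))))" using assms(1) by simp
  then show ?thesis using mkG_branch_relpowp[where s = s, OF assms, of x y] by (metis relpowp_Suc_I2)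
qed

lemma conn_lf_mkG:
  assumes "finite I" "\<And>v. v \<in> I \<Longrightarrow> rooted (fst (s v))"
  shows "conn_lf_graph (mkG x I y s)"
proof (rule conn_lf_graphI[where r = 0])
  show "sgraph (mkG x I y s)" by (rule sgraph_mkG[OF assms])
  fix a assume a: "a \<in> verts (mkG x I y s)"
  show "(adj (mkG x I y s))\<^sup>*\<^sup>* 0 a"
  proof (cases a rule: branch_vertex_cases)
    case (branch v w)
    with a have v: "v \<in> I" "w \<in> verts (fst (fst (s v)))" by auto
    then have "(adj (fst (fst (s v))))\<^sup>*\<^sup>* (snd (fst (s v))) w"
      using assms(2)[OF v(1)] by (auto simp: rooted_def conn_lf_graph_iff)
    then obtain n where "(adj (fst (fst (s v))) ^^ n) (snd (fst (s v))) w"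
      by (auto simp: rtranclp_power)
    from mkG_root_relpowp[where s = s, OF v(1) this, of x y] show ?thesis
      unfolding branch by (rule relpowp_imp_rtranclp)
  qed simp
qed

lemma rooted_mkG:
  assumes "finite I" "\<And>v. v \<in> I \<Longrightarrow> rooted (fst (s v))"
  shows "rooted (mkG x I y s, 0)"
  using conn_lf_mkG[OF assms] by (simp add: rooted_def)

text \<open>Index sets merely name the children: a bijection between them and one rooted isomorphism
  per branch patch together into an isomorphism that fixes the root.\<close>

lemma mkG_iso:
  assumes b: "bij_betw \<sigma> I J"
    and r: "\<And>i. i \<in> I \<Longrightarrow> rooted (fst (s i))"
    and f: "\<And>i. i \<in> I \<Longrightarrow> graph_iso (f i) (fst (fst (s i))) (fst (fst (t (\<sigma> i)))) \<and>
        f i (snd (fst (s i))) = snd (fst (t (\<sigma> i))) \<and> snd (t (\<sigma> i)) = snd (s i) \<and> z (\<sigma> i) = y i"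
  shows "\<exists>F. graph_iso F (mkG x I y s) (mkG x J z t) \<and> F 0 = 0"
proof -
  define F where "F = (\<lambda>a. case a of 0 \<Rightarrow> 0 | Suc m \<Rightarrow>
    (case prod_decode m of (i, w) \<Rightarrow> branch_vertex (\<sigma> i) (f i w)))"
  have F [simp]: "F 0 = 0" "F (branch_vertex i w) = branch_vertex (\<sigma> i) (f i w)" for i w
    by (auto simp: F_def branch_vertex_def)
  let ?M = "mkG x I y s" and ?N = "mkG x J z t"
  have \<sigma>: "\<sigma> i \<in> J" "\<sigma> i = \<sigma> j \<longleftrightarrow> i = j" if "i \<in> I" "j \<in> I" for i j
    using b that by (auto simp: bij_betw_def inj_on_def)
  have iso: "graph_iso (f i) (fst (fst (s i))) (fst (fst (t (\<sigma> i))))" if "i \<in> I" for i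
    using f that by blast
  have inj: "inj_on F (verts ?M)"
  proof (rule inj_onI)
    fix a b assume ab: "a \<in> verts ?M" "b \<in> verts ?M" "F a = F b"
    then show "a = b"
      using \<sigma> graph_iso_inj[OF iso]
      by (cases a rule: branch_vertex_cases; cases b rule: branch_vertex_cases)
        (auto simp: inj_on_def)
  qed
  have img: "F ` verts ?M = verts ?N"
  proof
    show "F ` verts ?M \<subseteq> verts ?N"
    proof
      fix b assume "b \<in> F ` verts ?M"
      then obtain a where "a \<in> verts ?M" "b = F a" by blast
      then show "b \<in> verts ?N"
        using \<sigma> graph_iso_verts[OF iso] by (cases a rule: branch_vertex_cases) auto
    qed
    show "verts ?N \<subseteq> F ` verts ?M"
    proof
      fix b assume b': "b \<in> verts ?N"
      show "b \<in> F ` verts ?M"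
      proof (cases b rule: branch_vertex_cases)
        case root
        then show ?thesis by (metis F(1) imageI mkG_simps(1))
      next
        case (branch j w)
        with b' have j: "j \<in> J" "w \<in> verts (fst (fst (t j)))" by auto
        then obtain i where i: "i \<in> I" "j = \<sigma> i" using b by (auto simp: bij_betw_def)
        then obtain w' where "w' \<in> verts (fst (fst (s i)))" "w = f i w'"
          using graph_iso_image[OF iso[OF i(1)]] j by auto
        then have "b = F (branch_vertex i w')" "branch_vertex i w' \<in> verts ?M"
          using i branch by auto
        then show ?thesis by blast
      qed
    qed
  qed
  have vm: "vmark ?N (F a) = vmark ?M a" if "a \<in> verts ?M" for a
    using that iso by (cases a rule: branch_vertex_cases) (auto simp: graph_iso_def)
  have ad: "adj ?N (F a) (F b) = adj ?M a b" if "a \<in> verts ?M" "b \<in> verts ?M" for a b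
  proof -
    have root: "f i w = snd (fst (t (\<sigma> i))) \<longleftrightarrow> w = snd (fst (s i))"
      if "i \<in> I" "w \<in> verts (fst (fst (s i)))" for i w
      using f[OF that(1)] graph_iso_inj[OF iso[OF that(1)]] r[OF that(1)] that
      by (auto simp: rooted_def inj_on_def)
    show ?thesis
      using that \<sigma> root graph_iso_adj[OF iso]
      by (cases a rule: branch_vertex_cases; cases b rule: branch_vertex_cases) auto
  qed
  have em: "emark ?N (F a) (F b) = emark ?M a b"
    if "a \<in> verts ?M" "b \<in> verts ?M" "adj ?M a b" for a b
    using that f iso
    by (cases a rule: branch_vertex_cases; cases b rule: branch_vertex_cases)
      (auto simp: graph_iso_def)
  have "graph_iso F ?M ?N"
    unfolding graph_iso_def bij_betw_def using inj img vm ad em by auto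
  then show ?thesis using F(1) by blast
qed

lemma abs_mkG_cong:
  assumes "finite I" "bij_betw \<sigma> I J"
    and "\<And>i. i \<in> I \<Longrightarrow> rooted (fst (s i))" "\<And>j. j \<in> J \<Longrightarrow> rooted (fst (t j))"
    and "\<And>i. i \<in> I \<Longrightarrow> abs_gstar (fst (s i)) = abs_gstar (fst (t (\<sigma> i))) \<and>
        snd (t (\<sigma> i)) = snd (s i) \<and> z (\<sigma> i) = y i"
  shows "abs_gstar (mkG x I y s, 0) = abs_gstar (mkG x J z t, 0)"
proof -
  have "\<exists>f. graph_iso f (fst (fst (s i))) (fst (fst (t (\<sigma> i)))) \<and>
      f (snd (fst (s i))) = snd (fst (t (\<sigma> i)))" if "i \<in> I" for i
    using assms(2-5) that by (intro abs_gstar_eqD) (auto simp: bij_betw_def)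
  then obtain f where "graph_iso (f i) (fst (fst (s i))) (fst (fst (t (\<sigma> i)))) \<and>
      f i (snd (fst (s i))) = snd (fst (t (\<sigma> i)))" if "i \<in> I" for i
    by metis
  then obtain F where "graph_iso F (mkG x I y s) (mkG x J z t)" "F 0 = 0"
    using mkG_iso[where s = s, OF assms(2,3), where f = f and t = t and z = z and y = y and x = x] assms(5)
    by blast
  moreover have "finite J" using assms(1,2) bij_betw_finite by blast
  ultimately show ?thesis
    using rooted_mkG[where s = s, OF assms(1,3)] rooted_mkG[of J t] assms(4)
    by (intro abs_gstar_eqI[where f = F]) auto
qed

lemma mk_cong:
  assumes "finite I" "bij_betw \<sigma> I J" "\<And>i. i \<in> I \<Longrightarrow> s i = t (\<sigma> i) \<and> y i = z (\<sigma> i)"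
  shows "mk x I y s = mk x J z t"
  unfolding mk_def using assms
  by (intro abs_mkG_cong[where \<sigma> = \<sigma>]) (auto simp: rooted_rep)

lemma abs_mkG_eq_mk:
  assumes "finite I" "\<And>i. i \<in> I \<Longrightarrow> rooted (fst (s i))"
  shows "abs_gstar (mkG x I y s, 0) = mk x I y (map_prod abs_gstar id \<circ> s)"
  unfolding mk_def
  by (rule abs_mkG_cong[where \<sigma> = id]) (auto simp: assms rooted_rep abs_rep_gstar)

section \<open>Cutting and truncating a glued graph\<close>

lemma rtranclp_closed:
  assumes "R\<^sup>*\<^sup>* a b" "a \<in> S" "\<And>c d. c \<in> S \<Longrightarrow> R c d \<Longrightarrow> d \<in> S"
  shows "b \<in> S"
  using assms by (induction rule: rtranclp_induct) auto

lemma cut_branch_mkG_child: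
  assumes I: "finite I" "i \<in> I" and r: "\<And>v. v \<in> I \<Longrightarrow> rooted (fst (s v))"
  shows "cut_branch (mkG x I y s) (branch_vertex i (snd (fst (s i)))) 0 = map_prod abs_gstar id (s i)"
proof -
  let ?M = "mkG x I y s" and ?r = "snd (fst (s i))" and ?G = "fst (fst (s i))"
  let ?D = "delete_edge ?M 0 (branch_vertex i ?r)" and ?v = "branch_vertex i ?r"
  have r': "conn_lf_graph ?G" "?r \<in> verts ?G" using r[OF I(2)] by (auto simp: rooted_def)
  have D: "sgraph ?D" by (intro sgraph_delete_edge sgraph_mkG I r)
  \<comment> \<open>The deleted edge was the only one leaving branch \<open>i\<close>, so its vertex
    set is closed under the remaining adjacency.\<close>
  have comp: "graph_component ?D ?v = branch_vertex i ` verts ?G"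
  proof
    have "b \<in> branch_vertex i ` verts ?G" if "(adj ?D)\<^sup>*\<^sup>* ?v b" for b
      using that
    proof (rule rtranclp_closed)
      fix c d assume "c \<in> branch_vertex i ` verts ?G" "adj ?D c d"
      then show "d \<in> branch_vertex i ` verts ?G"
        by (cases d rule: branch_vertex_cases)
          (auto simp: doubleton_eq_iff intro!: imageI sgraphD(2)[OF conn_lf_sgraph[OF r'(1)]])
    qed (use r' in auto)
    then show "graph_component ?D ?v \<subseteq> branch_vertex i ` verts ?G"
      by (auto simp: graph_component_def)
    show "branch_vertex i ` verts ?G \<subseteq> graph_component ?D ?v"
    proof
      fix b assume "b \<in> branch_vertex i ` verts ?G"
      then obtain w where w: "b = branch_vertex i w" "w \<in> verts ?G" by blast
      then have "(adj ?G)\<^sup>*\<^sup>* ?r w" using r' by (auto simp: conn_lf_graph_iff)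
      then have "(adj ?D)\<^sup>*\<^sup>* ?v (branch_vertex i w)"
      proof (induction rule: rtranclp_induct)
        case (step b c)
        then have "adj ?D (branch_vertex i b) (branch_vertex i c)" using I by (auto simp: doubleton_eq_iff)
        then show ?case using step.IH by (rule rtranclp.rtrancl_into_rtrancl[rotated])
      qed simp
      then show "b \<in> graph_component ?D ?v" using w I by (auto simp: graph_component_def)
    qed
  qed
  have "graph_iso (branch_vertex i) ?G (induced ?D (graph_component ?D ?v))"
    unfolding comp graph_iso_def using I
    by (auto simp: bij_betw_def inj_on_def doubleton_eq_iff)
  then have "abs_gstar (fst (s i)) = abs_gstar (induced ?D (graph_component ?D ?v), ?v)"
    using r[OF I(2)] D I r'
    by (intro abs_gstar_eqI[where f = "branch_vertex i"])
      (auto simp: rooted_def intro!: conn_lf_component in_graph_component)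
  then show ?thesis by (cases "s i") (simp add: cut_branch_def)
qed

lemma cut_branch_mkG_root:
  assumes I: "finite I" "i \<in> I" and r: "\<And>v. v \<in> I \<Longrightarrow> rooted (fst (s v))"
  shows "cut_branch (mkG x I y s) 0 (branch_vertex i (snd (fst (s i)))) =
    (abs_gstar (mkG x (I - {i}) y s, 0), y i)"
proof -
  let ?M = "mkG x I y s" and ?r = "snd (fst (s i))" and ?N = "mkG x (I - {i}) y s"
  let ?D = "delete_edge ?M (branch_vertex i ?r) 0" and ?v = "branch_vertex i ?r"
  have sub: "adj ?N a b \<Longrightarrow> adj ?D a b" for a b
    by (cases a rule: branch_vertex_cases; cases b rule: branch_vertex_cases)
      (auto simp: doubleton_eq_iff)
  have r': "sgraph (fst (fst (s v)))" "snd (fst (s v)) \<in> verts (fst (fst (s v)))" if "v \<in> I" for v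
    using r[OF that] by (auto simp: rooted_def conn_lf_sgraph)
  have closed: "b \<in> verts ?N \<and> adj ?N a b" if "adj ?D a b" "a \<in> verts ?N" for a b
    using that
    by (cases a rule: branch_vertex_cases; cases b rule: branch_vertex_cases)
      (auto simp: doubleton_eq_iff r'(2) intro: sgraphD(2)[OF r'(1)])
  \<comment> \<open>Without the edge to branch \<open>i\<close>, no edge joins this branch to the
    rest, so the root keeps exactly the other branches.\<close>
  have comp: "graph_component ?D 0 = verts ?N"
  proof
    have "b \<in> verts ?N" if "(adj ?D)\<^sup>*\<^sup>* 0 b" for b
      using that by (rule rtranclp_closed) (use closed in auto)
    then show "graph_component ?D 0 \<subseteq> verts ?N" by (auto simp: graph_component_def)
    have "conn_lf_graph ?N" using I r by (intro conn_lf_mkG) auto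
    then have "(adj ?N)\<^sup>*\<^sup>* 0 b" if "b \<in> verts ?N" for b
      using that by (simp add: conn_lf_graph_iff)
    then have "(adj ?D)\<^sup>*\<^sup>* 0 b" if "b \<in> verts ?N" for b
      using that rtranclp_mono[of "adj ?N" "adj ?D"] sub by blast
    moreover have "verts ?N \<subseteq> verts ?D" by (auto simp: verts_mkG)
    ultimately show "verts ?N \<subseteq> graph_component ?D 0" by (auto simp: graph_component_def)
  qed
  have N: "sgraph ?N" using I r by (intro sgraph_mkG) auto
  have "adj (induced ?D (verts ?N)) a b = adj ?N a b" for a b
    using closed[of a b] sub[of a b] sgraphD(1,2)[OF N, of a b] unfolding induced_simps by blast
  moreover have "verts (induced ?D (verts ?N)) = verts ?N" by (auto simp: verts_mkG)
  moreover have "vmark ?M = vmark ?N" "emark ?M = emark ?N" by (simp_all add: mkG_def)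
  ultimately have "induced ?D (graph_component ?D 0) = ?N"
    unfolding comp by (intro mgraph.equality ext) (simp_all del: mkG_simps)
  then show ?thesis using I by (simp add: cut_branch_def)
qed

text \<open>The children in the chosen representative cannot be named. A single bijection
  \<open>\<sigma>\<close> identifies them with \<open>I\<close> and serves both cuts and the edge
  mark simultaneously.\<close>

lemma mk_nbrs:
  assumes "finite I"
  shows "\<exists>\<sigma>. bij_betw \<sigma> I (root_nbrs (mk x I y s)) \<and> root_mark (mk x I y s) = x \<and>
    (\<forall>i\<in>I. cut_branch (g_graph (mk x I y s)) (\<sigma> i) (g_root (mk x I y s)) = s i \<and>
      cut_branch (g_graph (mk x I y s)) (g_root (mk x I y s)) (\<sigma> i) = (mk x (I - {i}) y s, y i) \<and>
      emark (g_graph (mk x I y s)) (g_root (mk x I y s)) (\<sigma> i) = y i)"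
proof -
  define t where "t = map_prod rep_gstar id \<circ> s"
  let ?M = "mkG x I y t" and ?g = "mk x I y s"
  have r: "rooted (fst (t i))" for i by (simp add: t_def rooted_rep)
  have M: "conn_lf_graph ?M" by (rule conn_lf_mkG[OF assms r])
  obtain f where f: "graph_iso f ?M (g_graph ?g)" "f 0 = g_root ?g"
    using iso_rep_abs[OF M mkG_simps(1)] unfolding mk_def t_def by blast
  define v where "v i = branch_vertex i (snd (fst (t i)))" for i
  have adj: "adj ?M 0 (v i)" "adj ?M (v i) 0" "v i \<in> verts ?M" if "i \<in> I" for i
    using that r[of i] by (auto simp: v_def rooted_def)
  have "root_nbrs ?g = f ` nbrs ?M 0"
  proof
    show "root_nbrs ?g \<subseteq> f ` nbrs ?M 0"
    proof
      fix w assume "w \<in> root_nbrs ?g"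
      then have w: "adj (g_graph ?g) (f 0) w" by (simp add: root_nbrs_def nbrs_def f(2))
      then have "w \<in> f ` verts ?M"
        using sgraphD(2)[OF sgraph_g_graph] graph_iso_image[OF f(1)] by simp
      then obtain a where a: "a \<in> verts ?M" "w = f a" by blast
      then show "w \<in> f ` nbrs ?M 0"
        using w graph_iso_adj[OF f(1) mkG_simps(1) a(1)] by (simp add: nbrs_def)
    qed
    show "f ` nbrs ?M 0 \<subseteq> root_nbrs ?g"
    proof
      fix w assume "w \<in> f ` nbrs ?M 0"
      then obtain a where a: "adj ?M 0 a" "w = f a" by (auto simp: nbrs_def)
      then have "adj (g_graph ?g) (f 0) (f a)"
        using graph_iso_adj[OF f(1) mkG_simps(1) sgraphD(2)[OF conn_lf_sgraph[OF M] a(1)]] by simp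
      then show "w \<in> root_nbrs ?g" by (simp add: root_nbrs_def nbrs_def f(2) a(2))
    qed
  qed
  moreover have "nbrs ?M 0 = v ` I" by (simp add: nbrs_mkG v_def)
  moreover have "inj_on f (v ` I)" by (rule inj_on_subset[OF graph_iso_inj[OF f(1)]]) (use adj in auto)
  moreover have "inj_on v I" by (auto simp: inj_on_def v_def)
  ultimately have "bij_betw (f \<circ> v) I (root_nbrs ?g)"
    by (simp add: bij_betw_def comp_inj_on image_comp)
  moreover have "cut_branch (g_graph ?g) ((f \<circ> v) i) (g_root ?g) = s i" if "i \<in> I" for i
  proof -
    have "cut_branch (g_graph ?g) (f (v i)) (f 0) = cut_branch ?M (v i) 0"
      by (rule cut_branch_iso[OF f(1) conn_lf_sgraph[OF M] sgraph_g_graph mkG_simps(1) adj(3,2)])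
        (use that in auto)
    also have "\<dots> = map_prod abs_gstar id (t i)"
      unfolding v_def by (rule cut_branch_mkG_child[OF assms that r])
    also have "\<dots> = s i" by (cases "s i") (simp add: t_def abs_rep_gstar)
    finally show ?thesis by (simp add: f(2))
  qed
  moreover have "cut_branch (g_graph ?g) (g_root ?g) ((f \<circ> v) i) = (mk x (I - {i}) y s, y i)"
    if "i \<in> I" for i
  proof -
    have "cut_branch (g_graph ?g) (f 0) (f (v i)) = cut_branch ?M 0 (v i)"
      by (rule cut_branch_iso[OF f(1) conn_lf_sgraph[OF M] sgraph_g_graph adj(3) mkG_simps(1) adj(1)])
        (use that in auto)
    also have "\<dots> = (abs_gstar (mkG x (I - {i}) y t, 0), y i)"
      unfolding v_def by (rule cut_branch_mkG_root[OF assms that r])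
    finally show ?thesis by (simp add: f(2) mk_def t_def)
  qed
  moreover have "emark (g_graph ?g) (g_root ?g) ((f \<circ> v) i) = y i" if "i \<in> I" for i
    using f adj[OF that] unfolding graph_iso_def by (metis comp_apply mkG_simps(1,9) v_def)
  moreover have "root_mark ?g = x"
    using f unfolding graph_iso_def root_mark_def by (metis mkG_simps(1,7))
  ultimately show ?thesis by blast
qed

text \<open>The edge from the root to a child uses up one unit of depth.\<close>

lemma trunc_Suc_mk:
  assumes "finite I"
  shows "trunc (Suc h) (mk x I y s) = mk x I y (trunc_branch h \<circ> s)"
proof -
  define t where "t = map_prod rep_gstar id \<circ> s"
  let ?M = "mkG x I y t"
  have r: "rooted (fst (t i))" for i by (simp add: t_def rooted_rep)
  define t' where "t' i = ((induced (fst (fst (t i))) (graph_ball (fst (fst (t i))) (snd (fst (t i))) h),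
    snd (fst (t i))), snd (t i))" for i
  let ?N = "mkG x I y t'"
  have M: "conn_lf_graph ?M" by (rule conn_lf_mkG[OF assms r])
  have r': "rooted (fst (t' i))" for i
    using r[of i] by (auto simp: t'_def rooted_def root_in_graph_ball conn_lf_sgraph intro!: conn_lf_ball)
  \<comment> \<open>A walk may return to the root, and each return restarts the count inside a
    branch; therefore only \<open>m < n\<close> is claimed.\<close>
  have pow: "a = 0 \<or> (\<exists>i\<in>I. \<exists>w m. a = branch_vertex i w \<and> m < n \<and>
      (adj (fst (fst (t i))) ^^ m) (snd (fst (t i))) w)" if "(adj ?M ^^ n) 0 a" for n a
    using that
  proof (induction n arbitrary: a)
    case (Suc n)
    then obtain b where b: "(adj ?M ^^ n) 0 b" "adj ?M b a" by auto
    from Suc.IH[OF b(1)] show ?case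
    proof (elim disjE bexE exE conjE)
      assume "b = 0"
      then show ?thesis using b(2)
        by (cases a rule: branch_vertex_cases) (auto intro!: exI[of _ 0])
    next
      fix i w m assume *: "i \<in> I" "b = branch_vertex i w" "m < n"
        "(adj (fst (fst (t i))) ^^ m) (snd (fst (t i))) w"
      show ?thesis
      proof (cases a rule: branch_vertex_cases)
        case (branch j w')
        then have "j = i" "adj (fst (fst (t i))) w w'" using b(2) * by auto
        then show ?thesis using * branch by (intro disjI2 bexI[of _ i] exI[of _ w'] exI[of _ "Suc m"]) auto
      qed simp
    qed
  qed simp
  have ball: "graph_ball ?M 0 (Suc h) = verts ?N"
  proof
    show "graph_ball ?M 0 (Suc h) \<subseteq> verts ?N"
    proof
      fix a assume a: "a \<in> graph_ball ?M 0 (Suc h)"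
      then obtain n where n: "n \<le> Suc h" "(adj ?M ^^ n) 0 a" "a \<in> verts ?M"
        by (auto simp: graph_ball_def)
      from pow[OF n(2)] show "a \<in> verts ?N"
      proof (elim disjE bexE exE conjE)
        fix i w m assume *: "i \<in> I" "a = branch_vertex i w" "m < n"
          "(adj (fst (fst (t i))) ^^ m) (snd (fst (t i))) w"
        then have "m \<le> h" using n by simp
        then show ?thesis using * n by (auto simp: t'_def graph_ball_def intro!: exI[of _ m])
      qed simp
    qed
    show "verts ?N \<subseteq> graph_ball ?M 0 (Suc h)"
    proof
      fix a assume a: "a \<in> verts ?N"
      show "a \<in> graph_ball ?M 0 (Suc h)"
      proof (cases a rule: branch_vertex_cases)
        case root
        then show ?thesis by (simp add: root_in_graph_ball)
      next
        case (branch i w)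
        then obtain n where "i \<in> I" "w \<in> verts (fst (fst (t i)))" "n \<le> h"
          "(adj (fst (fst (t i))) ^^ n) (snd (fst (t i))) w"
          using a by (auto simp: t'_def graph_ball_def)
        then show ?thesis
          using mkG_root_relpowp[where s = t and i = i and I = I and n = n and w = w and x = x and y = y]
            branch unfolding graph_ball_def
          by (auto intro!: exI[of _ "Suc n"])
      qed
    qed
  qed
  have adj: "adj (induced ?M (verts ?N)) a b = adj ?N a b" for a b
    using r[unfolded rooted_def]
    by (cases a rule: branch_vertex_cases; cases b rule: branch_vertex_cases)
      (auto simp: t'_def root_in_graph_ball dest: sgraphD(1,2)[OF conn_lf_sgraph])
  have vN: "verts ?M \<inter> verts ?N = verts ?N" by (auto simp: verts_mkG t'_def)
  have mN: "vmark ?M = vmark ?N" "emark ?M = emark ?N"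
    unfolding mkG_def t'_def fst_conv snd_conv induced_simps by simp_all
  from adj have eq: "induced ?M (graph_ball ?M 0 (Suc h)) = ?N"
    unfolding ball
    by (intro mgraph.equality ext) (simp_all del: mkG_simps add: vN mN)
  have "trunc (Suc h) (mk x I y s) = abs_gstar (?N, 0)"
    unfolding mk_def t_def[symmetric] trunc_abs[OF M mkG_simps(1)] eq ..
  also have "\<dots> = mk x I y (map_prod abs_gstar id \<circ> t')"
    by (rule abs_mkG_eq_mk[OF assms r'])
  also have "map_prod abs_gstar id \<circ> t' = trunc_branch h \<circ> s"
    by (auto simp: fun_eq_iff t'_def t_def trunc_branch_def trunc_def rep_gstar_eq
        map_prod_def case_prod_beta)
  finally show ?thesis .
qed

section \<open>Every rooted tree is glued from its branches\<close>

lemma rtranclp_simple_path: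
  assumes "R\<^sup>*\<^sup>* a b"
  shows "\<exists>p. p \<noteq> [] \<and> hd p = a \<and> last p = b \<and> distinct p \<and> (\<forall>i. Suc i < length p \<longrightarrow> R (p ! i) (p ! Suc i))"
  using assms
proof (induction rule: converse_rtranclp_induct)
  case base
  then show ?case by (intro exI[of _ "[b]"]) auto
next
  case (step a c)
  then obtain p where p: "p \<noteq> []" "hd p = c" "last p = b" "distinct p"
    "\<And>i. Suc i < length p \<Longrightarrow> R (p ! i) (p ! Suc i)" by blast
  show ?case
  proof (cases "a \<in> set p")
    case True
    then obtain k where k: "k < length p" "p ! k = a" by (auto simp: in_set_conv_nth)
    show ?thesis
      using k p by (intro exI[of _ "drop k p"]) (auto simp: hd_drop_conv_nth)
  next
    case False
    have "R ((a # p) ! i) ((a # p) ! Suc i)" if "Suc i < length (a # p)" for i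
      using that p step(1) by (cases i) (auto simp: hd_conv_nth)
    then show ?thesis using False p by (intro exI[of _ "a # p"]) auto
  qed
qed

text \<open>A simple path from \<open>v\<close> to \<open>r\<close> that avoids the edge closes up
  with that edge to a cycle. It has at least three vertices, since a path on two would be the
  deleted edge itself.\<close>

lemma acyclic_bridge:
  assumes "acyclic_graph G" "sgraph G" "adj G r v"
  shows "r \<notin> graph_component (delete_edge G r v) v"
proof
  let ?D = "delete_edge G r v"
  assume "r \<in> graph_component ?D v"
  then have "(adj ?D)\<^sup>*\<^sup>* v r" by (simp add: graph_component_def)
  from rtranclp_simple_path[OF this] obtain p where p: "p \<noteq> []" "hd p = v" "last p = r" "distinct p"
    "\<And>i. Suc i < length p \<Longrightarrow> adj ?D (p ! i) (p ! Suc i)" by blast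
  have len: "length p \<ge> 3"
  proof -
    have "v \<noteq> r" using sgraphD(3)[OF assms(2,3)] by simp
    then have "length p \<noteq> 1" using p by (cases p) auto
    moreover have "length p \<noteq> 2"
    proof
      assume "length p = 2"
      then have "p ! 0 = v" "p ! 1 = r" "adj ?D (p ! 0) (p ! 1)"
        using p(1-3) p(5)[of 0] by (auto simp: hd_conv_nth last_conv_nth)
      then show False by (auto simp: insert_commute)
    qed
    moreover have "length p \<noteq> 0" using p(1) by simp
    ultimately show ?thesis by linarith
  qed
  have "adj G (p ! i) (p ! (Suc i mod length p))" if "i < length p" for i
  proof (cases "Suc i = length p")
    case True
    then have "p ! i = r" using p by (metis diff_Suc_1 last_conv_nth)
    then show ?thesis using True p assms(3) by (simp add: hd_conv_nth)
  next
    case False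
    then show ?thesis using p(5)[of i] that by auto
  qed
  then have "is_cycle G p" using len p by (simp add: is_cycle_def)
  then show False using assms(1) by (auto simp: acyclic_graph_def)
qed

text \<open>Deleting the edge to a neighbour \<open>v\<close> splits off the component
  \<open>C v\<close>. Acyclicity keeps the root out of these components and makes them disjoint;
  connectedness makes them cover all other vertices.\<close>

lemma tstar_eq_mk:
  fixes g :: "('x, 'y) gstar"
  assumes "g \<in> tstar"
  shows "\<exists>x I y s. finite I \<and> g = mk x I y s"
proof -
  let ?G = "g_graph g" and ?o = "g_root g"
  define D where "D v = delete_edge ?G ?o v" for v
  define C where "C v = graph_component (D v) v" for v
  define s where "s v = ((induced (D v) (C v), v), emark ?G v ?o)" for v
  let ?N = "nbrs ?G ?o"
  let ?M = "mkG (vmark ?G ?o) ?N (emark ?G ?o) s"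
  have G: "sgraph ?G" "conn_lf_graph ?G" "?o \<in> verts ?G" by (simp_all add: sgraph_g_graph g_graph_ok)
  have D: "sgraph (D v)" for v unfolding D_def by (rule sgraph_delete_edge[OF G(1)])
  have N: "v \<in> verts ?G" "v \<noteq> ?o" "adj ?G ?o v" "adj ?G v ?o" if "v \<in> ?N" for v
    using that sgraphD[OF G(1), of ?o v] by (auto simp: nbrs_def)
  have brid: "?o \<notin> C v" if "v \<in> ?N" for v
    using acyclic_bridge[OF _ G(1) N(3)[OF that]] assms by (auto simp: C_def D_def tstar_def)
  have vC: "v \<in> C v" if "v \<in> ?N" for v
    using N[OF that] by (auto simp: C_def D_def graph_component_def)
  have CG: "C v \<subseteq> verts ?G" for v by (auto simp: C_def D_def graph_component_def)
  have stepC: "b \<in> C v" if "a \<in> C v" "adj (D v) a b" for a b v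
    using that(1) sgraphD(2)[OF D that(2)] rtranclp.rtrancl_into_rtrancl[of "adj (D v)" v a b] that(2)
    unfolding C_def graph_component_def by blast
  have stepD: "adj (D v) a b" if "v \<in> ?N" "a \<in> C v" "adj ?G a b" "b \<noteq> ?o" for v a b
    using that brid[OF that(1)] by (auto simp: D_def doubleton_eq_iff)
  have r: "rooted (fst (s v))" if "v \<in> ?N" for v
    using conn_lf_component[OF D, of v v] N[OF that] vC[OF that]
    by (auto simp: s_def rooted_def C_def D_def)
  \<comment> \<open>A walk in \<open>D v'\<close> from a common vertex to \<open>v'\<close> avoids
    the root, hence also stays in \<open>C v\<close>. The edge from \<open>v'\<close> to the root is
    still present in \<open>D v\<close> and would put the root into \<open>C v\<close>.\<close>
  have disj: "v = v'" if v: "v \<in> ?N" "v' \<in> ?N" and w: "w \<in> C v" "w \<in> C v'" for v v' w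
  proof (rule ccontr)
    assume ne: "v \<noteq> v'"
    have "(adj (D v'))\<^sup>*\<^sup>* w v'"
      using w(2) rtranclp_adj_sym[OF D] by (auto simp: C_def graph_component_def)
    then have "v' \<in> C v \<inter> C v'"
    proof (rule rtranclp_closed)
      fix c d assume cd: "c \<in> C v \<inter> C v'" "adj (D v') c d"
      then have "d \<in> C v'" using stepC by blast
      moreover have "d \<noteq> ?o" using calculation brid[OF v(2)] by auto
      moreover have "adj ?G c d" using cd(2) by (simp add: D_def)
      ultimately show "d \<in> C v \<inter> C v'" using stepC stepD[OF v(1)] cd by blast
    qed (use w in auto)
    moreover have "adj (D v) v' ?o" using N[OF v(2)] ne by (auto simp: D_def doubleton_eq_iff)
    ultimately show False using stepC[of v' v ?o] brid[OF v(1)] by blast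
  qed
  \<comment> \<open>The branches keep their original vertex names, so forgetting the branch index
    undoes the relabelling.\<close>
  define m where "m a = (case a of 0 \<Rightarrow> ?o | Suc n \<Rightarrow> snd (prod_decode n))" for a
  have m [simp]: "m 0 = ?o" "m (branch_vertex v w) = w" for v w
    by (simp_all add: m_def branch_vertex_def)
  have V: "branch_vertex v w \<in> verts ?M \<longleftrightarrow> v \<in> ?N \<and> w \<in> C v" for v w
    using CG by (auto simp: s_def D_def)
  have inj: "inj_on m (verts ?M)"
  proof (rule inj_onI)
    fix a b assume ab: "a \<in> verts ?M" "b \<in> verts ?M" "m a = m b"
    then show "a = b"
      using disj brid
      by (cases a rule: branch_vertex_cases; cases b rule: branch_vertex_cases) (auto simp del: mkG_simps(2) simp: V)
  qed
  have img: "m ` verts ?M = verts ?G"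
  proof
    show "m ` verts ?M \<subseteq> verts ?G"
    proof
      fix b assume "b \<in> m ` verts ?M"
      then obtain a where "a \<in> verts ?M" "b = m a" by blast
      then show "b \<in> verts ?G" using CG G(3) V
        by (cases a rule: branch_vertex_cases) (auto simp del: mkG_simps(2))
    qed
    show "verts ?G \<subseteq> m ` verts ?M"
    proof
      fix b assume "b \<in> verts ?G"
      then have "(adj ?G)\<^sup>*\<^sup>* ?o b" using G by (auto simp: conn_lf_graph_iff)
      then have "b = ?o \<or> (\<exists>v\<in>?N. b \<in> C v)"
      proof (induction rule: rtranclp_induct)
        case (step b c)
        show ?case
        proof (cases "c = ?o")
          case False
          from step.IH show ?thesis
          proof
            assume "b = ?o"
            then have "c \<in> ?N" using step.hyps by (simp add: nbrs_def)
            then show ?thesis using vC by blast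
          next
            assume "\<exists>v\<in>?N. b \<in> C v"
            then show ?thesis using stepC stepD step.hyps False by blast
          qed
        qed simp
      qed simp
      then show "b \<in> m ` verts ?M"
      proof
        assume "b = ?o"
        then show ?thesis by (metis imageI m(1) mkG_simps(1))
      next
        assume "\<exists>v\<in>?N. b \<in> C v"
        then obtain v where "branch_vertex v b \<in> verts ?M" using V by blast
        then show ?thesis by (metis imageI m(2))
      qed
    qed
  qed
  have vm: "vmark ?G (m a) = vmark ?M a" for a
    by (cases a rule: branch_vertex_cases) (auto simp: s_def D_def)
  have ad: "adj ?G (m a) (m b) = adj ?M a b" if "a \<in> verts ?M" "b \<in> verts ?M" for a b
  proof -
    have 1: "adj ?G ?o w \<longleftrightarrow> w = v" if "v \<in> ?N" "w \<in> C v" for v w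
    proof
      assume "adj ?G ?o w"
      then have "w \<in> ?N" by (simp add: nbrs_def)
      then show "w = v" using disj[OF that(1) _ that(2) vC] by blast
    qed (use N that in blast)
    have 2: "adj ?G w ?o \<longleftrightarrow> w = v" if "v \<in> ?N" "w \<in> C v" for v w
      using 1[OF that] sgraphD(4)[OF G(1)] by blast
    have 3: "adj ?G w w' \<longleftrightarrow> v = v' \<and> adj (D v) w w'"
      if "v \<in> ?N" "w \<in> C v" "v' \<in> ?N" "w' \<in> C v'" for v w v' w'
    proof
      assume a: "adj ?G w w'"
      have "w' \<noteq> ?o" using brid[OF that(3)] that(4) by auto
      then have "adj (D v) w w'" using stepD[OF that(1,2) a] by simp
      moreover have "v = v'" using disj[OF that(1,3) stepC[OF that(2) calculation] that(4)] .
      ultimately show "v = v' \<and> adj (D v) w w'" by simp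
    qed (simp add: D_def)
    have 0: "\<not> adj ?G ?o ?o" using sgraphD(3)[OF G(1)] by blast
    have sv: "snd (fst (s v)) = v" "adj (fst (fst (s v))) c d \<longleftrightarrow> c \<in> C v \<and> d \<in> C v \<and> adj (D v) c d" for v c d
      by (simp_all add: s_def)
    show ?thesis
    proof (cases a rule: branch_vertex_cases)
      case root
      show ?thesis
      proof (cases b rule: branch_vertex_cases)
        case (branch v w)
        then have "v \<in> ?N" "w \<in> C v" using that V by blast+
        then show ?thesis unfolding root branch m mkG_simps sv using 1 by blast
      qed (use 0 root in simp)
    next
      case (branch v w)
      then have v: "v \<in> ?N" "w \<in> C v" using that V by blast+
      show ?thesis
      proof (cases b rule: branch_vertex_cases)
        case root
        then show ?thesis unfolding root branch m mkG_simps sv using 2[OF v] v by blast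
      next
        case (branch v' w')
        then have v': "v' \<in> ?N" "w' \<in> C v'" using that V by blast+
        show ?thesis
          unfolding branch \<open>a = branch_vertex v w\<close> m mkG_simps sv using 3[OF v v'] v v' by blast
      qed
    qed
  qed
  have em: "emark ?G (m a) (m b) = emark ?M a b"
    if "a \<in> verts ?M" "b \<in> verts ?M" "adj ?M a b" for a b
    using that by (cases a rule: branch_vertex_cases; cases b rule: branch_vertex_cases)
      (auto simp: s_def D_def)
  have "graph_iso m ?M ?G"
    unfolding graph_iso_def bij_betw_def using inj img vm ad em by auto
  moreover have fin: "finite ?N" by (rule finite_nbrs[OF G(1)])
  ultimately have "abs_gstar (?M, 0) = abs_gstar (?G, ?o)"
    using rooted_mkG[where s = s, OF fin r] G by (intro abs_gstar_eqI[where f = m]) (auto simp: rooted_def)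
  then have "g = mk (vmark ?G ?o) ?N (emark ?G ?o) (map_prod abs_gstar id \<circ> s)"
    using abs_mkG_eq_mk[where s = s, OF fin r] g_graph_ok(3)[of g] by metis
  then show ?thesis using fin by blast
qed

text \<open>Stands in for being a tree from here on: it passes to truncations by
  \<open>trunc_Suc_mk\<close>, with no further argument about cycles.\<close>

definition decomposable :: "('x, 'y) gstar \<Rightarrow> bool" where
  "decomposable g \<longleftrightarrow> (\<exists>x I y s. finite I \<and> g = mk x I y s)"

lemma tstar_decomposable: "g \<in> tstar \<Longrightarrow> decomposable g"
  unfolding decomposable_def by (rule tstar_eq_mk)

lemma trunc_decomposable: "decomposable g \<Longrightarrow> decomposable (trunc (Suc n) g)"
  unfolding decomposable_def using trunc_Suc_mk by metis

section \<open>Branches at the root under truncation and gluing\<close>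

lemma finite_edge_support:
  fixes \<tau>s :: "('x :: finite, 'y :: finite) gstar set"
  shows "finite {branch_pair 0 \<tau> v | \<tau> v. \<tau> \<in> \<tau>s \<and> v \<in> root_nbrs \<tau>}" (is "finite ?S")
proof (rule finite_subset)
  let ?T = "range (trunc 0 :: ('x, 'y) gstar \<Rightarrow> _) \<times> (UNIV :: 'y set)"
  have "trunc_branch 0 p \<in> ?T" for p :: "('x, 'y) gstar \<times> 'y"
    by (cases p) (simp add: trunc_branch_def)
  then show "?S \<subseteq> ?T \<times> ?T"
    unfolding branch_pair_def child_branch_def root_branch_def by blast
  show "finite (?T \<times> ?T)" by (intro finite_cartesian_product finite_range_trunc_0) auto
qed

lemma trunc_child_branch: "k \<le> n \<Longrightarrow> trunc_branch k (child_branch n g v) = child_branch k g v"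
  by (simp add: child_branch_def trunc_branch_trunc_branch)

lemma trunc_root_branch: "k \<le> n \<Longrightarrow> trunc_branch k (root_branch n g v) = root_branch k g v"
  by (simp add: root_branch_def trunc_branch_trunc_branch)

text \<open>The depths differ by one: seen from child \<open>i\<close>, the other children sit one
  step below the root, so the root branch to depth \<open>n + 1\<close> contains their branches to
  depth \<open>n\<close>.\<close>

lemma mk_branches:
  assumes "finite I"
  shows "\<exists>\<sigma>. bij_betw \<sigma> I (root_nbrs (mk x I y s)) \<and> root_mark (mk x I y s) = x \<and>
    (\<forall>i\<in>I. \<forall>n. child_branch n (mk x I y s) (\<sigma> i) = trunc_branch n (s i) \<and>
      root_branch (Suc n) (mk x I y s) (\<sigma> i) = (mk x (I - {i}) y (trunc_branch n \<circ> s), y i) \<and>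
      emark (g_graph (mk x I y s)) (g_root (mk x I y s)) (\<sigma> i) = y i)"
proof -
  have "trunc_branch (Suc n) (mk x (I - {i}) y s, y i) = (mk x (I - {i}) y (trunc_branch n \<circ> s), y i)"
    for n i using assms by (simp add: trunc_branch_def trunc_Suc_mk)
  then show ?thesis
    using mk_nbrs[OF assms, of x y s] unfolding child_branch_def root_branch_def by metis
qed

lemma root_deg_mk: "finite I \<Longrightarrow> root_deg (mk x I y s) = card I"
  unfolding root_deg_def using mk_branches[of I x y s] bij_betw_same_card by metis

text \<open>The ball of radius \<open>n + 1\<close> knows the child branches only to depth
  \<open>n\<close>, but the root branches to depth \<open>n + 1\<close>. This asymmetry persists in
  all later formulas.\<close>

lemma trunc_root_nbrs:
  assumes "decomposable g"
  shows "\<exists>\<sigma>. bij_betw \<sigma> (root_nbrs g) (root_nbrs (trunc (Suc n) g)) \<and>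
    (\<forall>v\<in>root_nbrs g. child_branch n (trunc (Suc n) g) (\<sigma> v) = child_branch n g v \<and>
      root_branch (Suc n) (trunc (Suc n) g) (\<sigma> v) = root_branch (Suc n) g v)"
proof -
  obtain x I y s where I: "finite I" and g: "g = mk x I y s"
    using assms by (auto simp: decomposable_def)
  have t: "trunc (Suc n) g = mk x I y (trunc_branch n \<circ> s)" by (simp add: g trunc_Suc_mk I)
  obtain \<sigma>1 where 1: "bij_betw \<sigma>1 I (root_nbrs g)"
    "\<And>i n. i \<in> I \<Longrightarrow> child_branch n g (\<sigma>1 i) = trunc_branch n (s i)"
    "\<And>i n. i \<in> I \<Longrightarrow> root_branch (Suc n) g (\<sigma>1 i) = (mk x (I - {i}) y (trunc_branch n \<circ> s), y i)"
    unfolding g using mk_branches[OF I, of x y s] by blast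
  obtain \<sigma>2 where 2: "bij_betw \<sigma>2 I (root_nbrs (trunc (Suc n) g))"
    "\<And>i. i \<in> I \<Longrightarrow> child_branch n (trunc (Suc n) g) (\<sigma>2 i) = trunc_branch n (trunc_branch n (s i))"
    "\<And>i. i \<in> I \<Longrightarrow> root_branch (Suc n) (trunc (Suc n) g) (\<sigma>2 i)
      = (mk x (I - {i}) y (trunc_branch n \<circ> (trunc_branch n \<circ> s)), y i)"
    unfolding t using mk_branches[OF I, of x y "trunc_branch n \<circ> s"] unfolding comp_apply by blast
  have inv: "bij_betw (inv_into I \<sigma>1) (root_nbrs g) I" by (rule bij_betw_inv_into[OF 1(1)])
  have v: "inv_into I \<sigma>1 v \<in> I" "\<sigma>1 (inv_into I \<sigma>1 v) = v" if "v \<in> root_nbrs g" for v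
    using that 1(1) by (auto simp: bij_betw_def inv_into_into f_inv_into_f)
  have tt: "trunc_branch n \<circ> (trunc_branch n \<circ> s) = trunc_branch n \<circ> s"
    by (simp add: fun_eq_iff trunc_branch_trunc_branch)
  show ?thesis
  proof (intro exI[of _ "\<sigma>2 \<circ> inv_into I \<sigma>1"] conjI ballI)
    show "bij_betw (\<sigma>2 \<circ> inv_into I \<sigma>1) (root_nbrs g) (root_nbrs (trunc (Suc n) g))"
      by (rule bij_betw_trans[OF inv 2(1)])
    fix w assume w: "w \<in> root_nbrs g"
    show "child_branch n (trunc (Suc n) g) ((\<sigma>2 \<circ> inv_into I \<sigma>1) w) = child_branch n g w"
      using 1(2)[OF v(1)[OF w], of n] 2(2)[OF v(1)[OF w]] v(2)[OF w]
      by (simp add: trunc_branch_trunc_branch)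
    show "root_branch (Suc n) (trunc (Suc n) g) ((\<sigma>2 \<circ> inv_into I \<sigma>1) w) = root_branch (Suc n) g w"
      using 1(3)[OF v(1)[OF w], of n] 2(3)[OF v(1)[OF w]] v(2)[OF w] by (simp add: tt)
  qed
qed

lemma root_deg_trunc:
  assumes "decomposable g"
  shows "root_deg (trunc (Suc n) g) = root_deg g"
  using trunc_root_nbrs[OF assms, of n] unfolding root_deg_def by (metis bij_betw_same_card)

text \<open>Cutting removes exactly one edge at the root, and any positive depth still shows the
  remaining ones.\<close>

lemma root_deg_root_branch:
  assumes "decomposable g" "v \<in> root_nbrs g"
  shows "Suc (root_deg (fst (root_branch (Suc n) g v))) = root_deg g"
proof -
  obtain x I y s where I: "finite I" and g: "g = mk x I y s"
    using assms by (auto simp: decomposable_def)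
  obtain \<sigma> where 1: "bij_betw \<sigma> I (root_nbrs g)"
    "\<And>i. i \<in> I \<Longrightarrow> root_branch (Suc n) g (\<sigma> i) = (mk x (I - {i}) y (trunc_branch n \<circ> s), y i)"
    unfolding g using mk_branches[OF I, of x y s] by blast
  obtain i where i: "i \<in> I" "v = \<sigma> i" using 1(1) assms(2) by (auto simp: bij_betw_def)
  then show ?thesis
    unfolding i(2) 1(2)[OF i(1)] using card_Suc_Diff1[OF I i(1)] by (simp add: root_deg_mk I g del: card_Diff_insert)
qed

text \<open>The new branches agree with the old ones to depth \<open>n\<close>, and this is all that
  a root branch of depth \<open>n + 1\<close> sees of them. Hence each child sees the rest of the
  tree unchanged, whatever is glued at the others.\<close>

lemma glue_root_nbrs:
  assumes "decomposable g" "\<tau> = trunc (Suc n) g"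
    and s: "\<And>v. v \<in> root_nbrs \<tau> \<Longrightarrow> trunc_branch n (s v) = child_branch n \<tau> v"
      "\<And>v. v \<in> root_nbrs \<tau> \<Longrightarrow> trunc_branch (Suc n) (s v) = s v"
  shows "\<exists>\<sigma>. bij_betw \<sigma> (root_nbrs \<tau>) (root_nbrs (glue \<tau> s)) \<and>
    (\<forall>v\<in>root_nbrs \<tau>. child_branch (Suc n) (glue \<tau> s) (\<sigma> v) = s v \<and>
      root_branch (Suc n) (glue \<tau> s) (\<sigma> v) = root_branch (Suc n) \<tau> v)"
proof -
  have "decomposable \<tau>" using assms(1,2) by (simp add: trunc_decomposable)
  then obtain x I y b where I: "finite I" and \<tau>: "\<tau> = mk x I y b"
    by (auto simp: decomposable_def)
  obtain \<sigma>1 where 1: "bij_betw \<sigma>1 I (root_nbrs \<tau>)"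
    "\<And>i n. i \<in> I \<Longrightarrow> child_branch n \<tau> (\<sigma>1 i) = trunc_branch n (b i)"
    "\<And>i n. i \<in> I \<Longrightarrow> root_branch (Suc n) \<tau> (\<sigma>1 i) = (mk x (I - {i}) y (trunc_branch n \<circ> b), y i)"
    "\<And>i. i \<in> I \<Longrightarrow> emark (g_graph \<tau>) (g_root \<tau>) (\<sigma>1 i) = y i" "root_mark \<tau> = x"
    unfolding \<tau> using mk_branches[OF I, of x y b] by blast
  let ?y = "emark (g_graph \<tau>) (g_root \<tau>)" and ?N = "root_nbrs \<tau>"
  have gl: "glue \<tau> s = mk x ?N ?y s" by (simp add: glue_eq_mk 1(5))
  obtain \<sigma>2 where 2: "bij_betw \<sigma>2 ?N (root_nbrs (glue \<tau> s))"
    "\<And>i. i \<in> ?N \<Longrightarrow> child_branch (Suc n) (glue \<tau> s) (\<sigma>2 i) = trunc_branch (Suc n) (s i)"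
    "\<And>i. i \<in> ?N \<Longrightarrow> root_branch (Suc n) (glue \<tau> s) (\<sigma>2 i)
      = (mk x (?N - {i}) ?y (trunc_branch n \<circ> s), ?y i)"
    unfolding gl using mk_branches[OF finite_root_nbrs[of \<tau>], of x ?y s] by blast
  have root: "root_branch (Suc n) (glue \<tau> s) (\<sigma>2 v) = root_branch (Suc n) \<tau> v" if v: "v \<in> ?N" for v
  proof -
    obtain i where i: "i \<in> I" "v = \<sigma>1 i" using 1(1) v by (auto simp: bij_betw_def)
    have "bij_betw \<sigma>1 (I - {i}) (?N - {v})"
      using 1(1) i by (auto simp: bij_betw_def inj_on_def)
    then have "mk x (I - {i}) y (trunc_branch n \<circ> b) = mk x (?N - {v}) ?y (trunc_branch n \<circ> s)"
      using I 1(2)[of _ n] 1(4) s(1) bij_betwE[OF 1(1)] by (intro mk_cong) auto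
    then show ?thesis using 1(3)[OF i(1), of n] 2(3)[OF v] 1(4)[OF i(1)] i(2) by simp
  qed
  show ?thesis
    by (intro exI[of _ \<sigma>2]) (use 2 s root in auto)
qed

section \<open>Mass transport\<close>

lemma birooted_iso_refl_iff:
  "birooted_iso (G, u, v) (G, u, v) \<longleftrightarrow> conn_lf_graph G \<and> u \<in> verts G \<and> v \<in> verts G"
  by (auto simp: birooted_iso_def intro!: exI[of _ id] graph_iso_id)

lemma abs_gstar2_eqD:
  assumes "conn_lf_graph G" "u \<in> verts G" "v \<in> verts G"
    and "conn_lf_graph H" "u' \<in> verts H" "v' \<in> verts H"
    and "abs_gstar2 (G, u, v) = abs_gstar2 (H, u', v')"
  shows "\<exists>f. graph_iso f G H \<and> f u = u' \<and> f v = v'"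
proof -
  have "birooted_iso (G, u, v) (H, u', v')"
    using Quotient3_rel[OF Quotient3_gstar2, of "(G, u, v)" "(H, u', v')"] assms birooted_iso_refl_iff
    by blast
  then show ?thesis by (simp add: birooted_iso_def)
qed

lemma rep_gstar2_ok:
  assumes "rep_gstar2 g = (G, u, v)"
  shows "conn_lf_graph G" "u \<in> verts G" "v \<in> verts G" "abs_gstar2 (G, u, v) = g"
  using Quotient3_rep_reflp[OF Quotient3_gstar2, of g] Quotient3_abs_rep[OF Quotient3_gstar2, of g]
  by (auto simp: assms birooted_iso_refl_iff)

lemma iso_rep_abs2:
  assumes "conn_lf_graph G" "u \<in> verts G" "v \<in> verts G"
    and "rep_gstar2 (abs_gstar2 (G, u, v)) = (H, u', v')"
  shows "\<exists>f. graph_iso f G H \<and> f u = u' \<and> f v = v'"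
  using abs_gstar2_eqD[OF assms(1-3) rep_gstar2_ok(1-3)[OF assms(4)]] rep_gstar2_ok(4)[OF assms(4)]
  by simp

definition edge_fun :: "nat \<Rightarrow> (('x, 'y) gstar \<times> 'y \<Rightarrow> ('x, 'y) gstar \<times> 'y \<Rightarrow> ennreal) \<Rightarrow>
    ('x, 'y) gstar2 \<Rightarrow> ennreal" where
  "edge_fun k F g = (case rep_gstar2 g of (G, u, v) \<Rightarrow>
     if adj G u v then F (trunc_branch k (cut_branch G v u)) (trunc_branch k (cut_branch G u v)) else 0)"

lemma edge_fun_iso:
  assumes "graph_iso f G H" "conn_lf_graph G" "conn_lf_graph H" "u \<in> verts G" "v \<in> verts G"
  shows "adj H (f u) (f v) = adj G u v"
    and "adj G u v \<Longrightarrow> cut_branch H (f v) (f u) = cut_branch G v u"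
    and "adj G u v \<Longrightarrow> cut_branch H (f u) (f v) = cut_branch G u v"
proof -
  note s = conn_lf_sgraph[OF assms(2)] conn_lf_sgraph[OF assms(3)]
  show "adj H (f u) (f v) = adj G u v" by (rule graph_iso_adj[OF assms(1,4,5)])
  show "cut_branch H (f v) (f u) = cut_branch G v u" if "adj G u v"
    by (rule cut_branch_iso[OF assms(1) s assms(4,5) sgraphD(4)[OF s(1) that]])
  show "cut_branch H (f u) (f v) = cut_branch G u v" if "adj G u v"
    by (rule cut_branch_iso[OF assms(1) s assms(5,4) that])
qed

lemma edge_fun_abs:
  assumes "conn_lf_graph G" "u \<in> verts G" "v \<in> verts G"
  shows "edge_fun k F (abs_gstar2 (G, u, v)) =
    (if adj G u v then F (trunc_branch k (cut_branch G v u)) (trunc_branch k (cut_branch G u v)) else 0)"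
proof -
  obtain H u' v' where H: "rep_gstar2 (abs_gstar2 (G, u, v)) = (H, u', v')" by (metis prod_cases3)
  obtain f where f: "graph_iso f G H" "f u = u'" "f v = v'" using iso_rep_abs2[OF assms H] by blast
  show ?thesis
    using edge_fun_iso[OF f(1) assms(1) rep_gstar2_ok(1)[OF H] assms(2,3)] f(2,3)
    by (auto simp: edge_fun_def H)
qed

text \<open>The function is determined by the ball of radius \<open>k + 1\<close> around the first root, so it is
  locally constant on the open set of pairs of adjacent roots.\<close>

lemma borel_measurable_edge_fun [measurable]: "edge_fun k F \<in> borel_measurable borel"
proof -
  define adjset :: "('a, 'b) gstar2 set" where
    "adjset = {g. case rep_gstar2 g of (G, u, v) \<Rightarrow> adj G u v}"
  have near: "near_root2 (Suc k) g" if "g \<in> adjset" for g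
  proof -
    obtain G u v where G: "rep_gstar2 g = (G, u, v)" by (metis prod_cases3)
    note G' = rep_gstar2_ok[OF G]
    have "adj G u v" using that G by (simp add: adjset_def)
    then have "v \<in> graph_ball G u (Suc 0)"
      using graph_ball_step[OF conn_lf_sgraph[OF G'(1)] root_in_graph_ball[OF G'(2), of 0]] by simp
    then have "v \<in> graph_ball G u (Suc k)" using graph_ball_mono[of "Suc 0" "Suc k" G u] by auto
    then show ?thesis by (simp add: near_root2_def G)
  qed
  have local: "g' \<in> adjset" "edge_fun k F g' = edge_fun k F g"
    if g: "g \<in> adjset" and near': "near_root2 (Suc k) g'"
      and eq: "trunc2 (Suc k) g' = trunc2 (Suc k) g" for g g'
  proof -
    obtain G u v where G: "rep_gstar2 g = (G, u, v)" by (metis prod_cases3)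
    obtain H u' v' where H: "rep_gstar2 g' = (H, u', v')" by (metis prod_cases3)
    note G' = rep_gstar2_ok[OF G] and H' = rep_gstar2_ok[OF H]
    note sG = conn_lf_sgraph[OF G'(1)] and sH = conn_lf_sgraph[OF H'(1)]
    let ?A = "graph_ball G u (Suc k)" and ?B = "graph_ball H u' (Suc k)"
    have a: "adj G u v" using g G by (simp add: adjset_def)
    have A: "v \<in> ?A" "u \<in> ?A"
      using near[OF g] root_in_graph_ball[OF G'(2)] by (simp_all add: near_root2_def G)
    have B: "v' \<in> ?B" "u' \<in> ?B"
      using near' root_in_graph_ball[OF H'(2)] by (simp_all add: near_root2_def H)
    have uv: "u \<in> verts (induced G ?A)" "v \<in> verts (induced G ?A)" using G' A by simp_all
    have uv': "u' \<in> verts (induced H ?B)" "v' \<in> verts (induced H ?B)" using H' B by simp_all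
    have "abs_gstar2 (induced G ?A, u, v) = abs_gstar2 (induced H ?B, u', v')"
      using eq by (simp add: trunc2_def G H)
    then obtain f where f: "graph_iso f (induced G ?A) (induced H ?B)" "f u = u'" "f v = v'"
      using abs_gstar2_eqD[OF conn_lf_ball[OF sG G'(2)] uv conn_lf_ball[OF sH H'(2)] uv'] by blast
    note iso = edge_fun_iso[OF f(1) conn_lf_ball[OF sG G'(2)] conn_lf_ball[OF sH H'(2)] uv, unfolded f(2,3)]
    have ai: "adj (induced G ?A) u v" using a A by simp
    have a': "adj H u' v'" using iso(1) ai by simp
    show "g' \<in> adjset" using a' by (simp add: adjset_def H)
    have "trunc_branch k (cut_branch H v' u') = trunc_branch k (cut_branch G v u)"
      unfolding trunc_branch_local[OF sG a order_refl, of v u k, simplified, symmetric]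
        trunc_branch_local[OF sH a' order_refl, of v' u' k, simplified, symmetric] iso(2)[OF ai] ..
    moreover have "trunc_branch k (cut_branch H u' v') = trunc_branch k (cut_branch G u v)"
      unfolding trunc_branch_local[OF sG a order_refl, of u v k, simplified, symmetric]
        trunc_branch_local[OF sH a' order_refl, of u' v' k, simplified, symmetric] iso(3)[OF ai] ..
    ultimately show "edge_fun k F g' = edge_fun k F g" using a a' by (simp add: edge_fun_def G H)
  qed
  have op: "open {g \<in> adjset. edge_fun k F g \<in> X}" for X
  proof (subst open_subopen, intro ballI)
    fix g assume g: "g \<in> {g \<in> adjset. edge_fun k F g \<in> X}"
    then have ga: "g \<in> adjset" "edge_fun k F g \<in> X" by simp_all
    let ?C = "{g'. near_root2 (Suc k) g' \<and> trunc2 (Suc k) g' = trunc2 (Suc k) g}"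
    have nr: "near_root2 (Suc k) g" by (rule near[OF ga(1)])
    then have "open ?C" unfolding open_gstar2_def by (intro generate_topology.Basis) auto
    moreover have "g \<in> ?C" using nr by simp
    moreover have "?C \<subseteq> {g \<in> adjset. edge_fun k F g \<in> X}"
    proof
      fix g' assume "g' \<in> ?C"
      then have "g' \<in> adjset" "edge_fun k F g' = edge_fun k F g"
        using local[OF ga(1), of g'] by simp_all
      then show "g' \<in> {g \<in> adjset. edge_fun k F g \<in> X}" using ga(2) by simp
    qed
    ultimately show "\<exists>T. open T \<and> g \<in> T \<and> T \<subseteq> {g \<in> adjset. edge_fun k F g \<in> X}" by blast
  qed
  have zero: "edge_fun k F g = 0" if "g \<notin> adjset" for g
    using that by (auto simp: edge_fun_def adjset_def split: prod.splits)
  have "open adjset" using op[of UNIV] by simp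
  show ?thesis
  proof (rule measurableI)
    fix X :: "ennreal set" assume "X \<in> sets borel"
    \<comment> \<open>Off the open set of adjacent roots the function is 0, so a preimage is an open
      set, possibly together with one closed set.\<close>
    have "edge_fun k F -` X \<inter> space borel = {g \<in> adjset. edge_fun k F g \<in> X} \<union> (if 0 \<in> X then - adjset else {})"
      using zero by auto metis
    also have "\<dots> \<in> sets borel"
      using op[of X] \<open>open adjset\<close> by (auto intro!: sets.Un borel_open borel_closed closed_Compl)
    finally show "edge_fun k F -` X \<inter> space borel \<in> sets borel" .
  qed simp
qed

lemma nn_integral_nbrs:
  assumes "sgraph G" "\<And>v. v \<notin> nbrs G u \<Longrightarrow> f v = 0"
  shows "(\<integral>\<^sup>+v. f v \<partial>count_space (verts G)) = (\<Sum>v\<in>nbrs G u. f v)"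
proof -
  have "nbrs G u \<subseteq> verts G" using sgraphD(2)[OF assms(1)] by (auto simp: nbrs_def)
  then have "(\<integral>\<^sup>+v. f v \<partial>count_space (verts G)) = (\<integral>\<^sup>+v. f v \<partial>count_space (nbrs G u))"
    by (intro nn_integral_count_space_eq) (auto simp: assms)
  then show ?thesis by (simp add: nn_integral_count_space_finite finite_nbrs[OF assms(1)])
qed

text \<open>Unimodularity applied to \<open>edge_fun\<close>: it vanishes unless the roots are
  adjacent, and exchanging the roots exchanges the arguments of \<open>F\<close>.\<close>

lemma mass_transport:
  assumes "unimodular \<rho>"
  shows "(\<integral>\<^sup>+g. (\<Sum>v\<in>root_nbrs g. F (child_branch k g v) (root_branch k g v)) \<partial>\<rho>) =
    (\<integral>\<^sup>+g. (\<Sum>v\<in>root_nbrs g. F (root_branch k g v) (child_branch k g v)) \<partial>\<rho>)"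
proof -
  have "(\<integral>\<^sup>+v. edge_fun k F (abs_gstar2 (g_graph g, g_root g, v)) \<partial>count_space (verts (g_graph g)))
      = (\<Sum>v\<in>root_nbrs g. F (child_branch k g v) (root_branch k g v))" for g
  proof -
    have "(\<integral>\<^sup>+v. edge_fun k F (abs_gstar2 (g_graph g, g_root g, v)) \<partial>count_space (verts (g_graph g)))
      = (\<integral>\<^sup>+v. (if adj (g_graph g) (g_root g) v then F (child_branch k g v) (root_branch k g v) else 0)
          \<partial>count_space (verts (g_graph g)))"
      by (intro nn_integral_cong) (simp add: edge_fun_abs g_graph_ok child_branch_def root_branch_def)
    also have "\<dots> = (\<Sum>v\<in>root_nbrs g. F (child_branch k g v) (root_branch k g v))"
      unfolding root_nbrs_def
      by (subst nn_integral_nbrs[OF sgraph_g_graph, where u = "g_root g"]) (auto simp: nbrs_def)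
    finally show ?thesis .
  qed
  moreover have "(\<integral>\<^sup>+v. edge_fun k F (abs_gstar2 (g_graph g, v, g_root g)) \<partial>count_space (verts (g_graph g)))
      = (\<Sum>v\<in>root_nbrs g. F (root_branch k g v) (child_branch k g v))" for g
  proof -
    have adj: "adj (g_graph g) v (g_root g) = adj (g_graph g) (g_root g) v" for v
      using sgraphD(4)[OF sgraph_g_graph] by blast
    have "(\<integral>\<^sup>+v. edge_fun k F (abs_gstar2 (g_graph g, v, g_root g)) \<partial>count_space (verts (g_graph g)))
      = (\<integral>\<^sup>+v. (if adj (g_graph g) (g_root g) v then F (root_branch k g v) (child_branch k g v) else 0)
          \<partial>count_space (verts (g_graph g)))"
      by (intro nn_integral_cong) (simp add: edge_fun_abs g_graph_ok child_branch_def root_branch_def adj)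
    also have "\<dots> = (\<Sum>v\<in>root_nbrs g. F (root_branch k g v) (child_branch k g v))"
      unfolding root_nbrs_def
      by (subst nn_integral_nbrs[OF sgraph_g_graph, where u = "g_root g"]) (auto simp: nbrs_def)
    finally show ?thesis .
  qed
  ultimately show ?thesis
    using assms[unfolded unimodular_def, rule_format, OF borel_measurable_edge_fun, of k F] by simp
qed

section \<open>Truncation, edge and kernel laws\<close>

lemma measurable_trunc: "trunc h \<in> measurable borel (count_space UNIV)"
proof (rule measurableI)
  fix X :: "('a, 'b) gstar set"
  have "{g. trunc h g \<in> X} = (\<Union>g\<in>{g. trunc h g \<in> X}. {g'. trunc h g' = trunc h g})" by auto
  also have "open \<dots>"
    unfolding open_gstar_def by (intro generate_topology.UN ballI) (auto intro!: generate_topology.Basis)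
  finally show "trunc h -` X \<inter> space borel \<in> sets borel" by (simp add: vimage_def borel_open)
qed simp

text \<open>The definition by \<open>embed_pmf\<close> is meaningful only if the point masses add up
  to 1; countability of the range of \<open>trunc h\<close> ensures this.\<close>

lemma trunc_law_eq_distr:
  fixes \<rho> :: "('x :: finite, 'y :: finite) gstar measure"
  assumes "\<rho> \<in> prob_gstar"
  shows "measure_pmf (trunc_law h \<rho>) = distr \<rho> (count_space UNIV) (trunc h)"
proof -
  have \<rho>: "prob_space \<rho>" and sets: "sets \<rho> = sets borel" using assms by (auto simp: prob_gstar_def)
  have meas: "trunc h \<in> measurable \<rho> (count_space UNIV)"
    using measurable_trunc[of h] measurable_cong_sets[OF sets refl] by blast
  define M where "M = distr \<rho> (count_space UNIV) (trunc h)"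
  interpret M: prob_space M unfolding M_def by (rule prob_space.prob_space_distr[OF \<rho> meas])
  have sM: "sets M = UNIV" by (simp add: M_def)
  \<comment> \<open>There are countably many such points of mass 0, so together they are null and
    almost every point is an atom, as \<open>Abs_pmf_inverse\<close> requires.\<close>
  define N where "N = {t. measure M {t} = 0} \<inter> range (trunc h)"
  have "countable N" unfolding N_def using countable_range_trunc by (rule countable_subset[rotated]) auto
  then have "(\<Union>t\<in>N. {t}) \<in> null_sets M"
    by (rule null_sets_UN') (auto simp: N_def sM null_sets_def M.emeasure_eq_measure)
  moreover have "AE t in M. t \<in> range (trunc h)"
    unfolding M_def by (subst AE_distr_iff[OF meas]) auto
  ultimately have "AE t in M. measure M {t} \<noteq> 0"
    using AE_not_in[of "\<Union>t\<in>N. {t}" M] by (auto simp: N_def)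
  then have M: "measure_pmf (Abs_pmf M) = M"
    using sM M.prob_space_axioms by (intro Abs_pmf_inverse) auto
  have "pmf (Abs_pmf M) t = measure \<rho> {g. trunc h g = t}" for t
  proof -
    have "pmf (Abs_pmf M) t = measure M {t}" by (simp add: pmf.rep_eq M)
    also have "\<dots> = measure \<rho> (trunc h -` {t} \<inter> space \<rho>)"
      unfolding M_def by (rule measure_distr[OF meas]) simp
    also have "space \<rho> = UNIV" using sets_eq_imp_space_eq[OF sets] by simp
    finally show ?thesis by (simp add: vimage_def)
  qed
  then have "pmf (Abs_pmf M) = (\<lambda>t. measure \<rho> {g. trunc h g = t})" by (rule ext)
  then have "trunc_law h \<rho> = embed_pmf (pmf (Abs_pmf M))" by (simp add: trunc_law_def)
  also have "\<dots> = Abs_pmf M" by (rule type_definition.Rep_inverse[OF td_pmf_embed_pmf])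
  finally show ?thesis using M by (simp add: M_def)
qed

lemma nn_integral_trunc_law:
  fixes \<rho> :: "('x :: finite, 'y :: finite) gstar measure"
  assumes "\<rho> \<in> prob_gstar"
  shows "(\<integral>\<^sup>+t. f t \<partial>trunc_law h \<rho>) = (\<integral>\<^sup>+g. f (trunc h g) \<partial>\<rho>)"
proof -
  have "trunc h \<in> measurable \<rho> (count_space UNIV)"
    using measurable_trunc[of h] assms measurable_cong_sets[of \<rho> borel] by (auto simp: prob_gstar_def)
  then show ?thesis unfolding trunc_law_eq_distr[OF assms] by (simp add: nn_integral_distr)
qed

lemma set_trunc_law:
  fixes \<rho> :: "('x :: finite, 'y :: finite) gstar measure"
  assumes "\<rho> \<in> prob_gstar" "AE g in \<rho>. g \<in> tstar" "\<tau> \<in> set_pmf (trunc_law h \<rho>)"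
  shows "\<exists>g. decomposable g \<and> \<tau> = trunc h g"
proof -
  have "trunc h \<in> measurable \<rho> (count_space UNIV)"
    using measurable_trunc[of h] assms(1) measurable_cong_sets[of \<rho> borel] by (auto simp: prob_gstar_def)
  then have "AE t in measure_pmf (trunc_law h \<rho>). \<exists>g. decomposable g \<and> t = trunc h g"
    unfolding trunc_law_eq_distr[OF assms(1)]
    by (subst AE_distr_iff) (use assms(2) tstar_decomposable in \<open>auto elim!: eventually_mono\<close>)
  then show ?thesis using assms(3) by (simp add: AE_measure_pmf_iff)
qed

text \<open>Since such edge sums do not change under truncation, laws of different depths can be
  compared by going through \<open>\<rho>\<close>.\<close>

lemma nn_integral_trunc_law_sum:
  fixes \<rho> :: "('x :: finite, 'y :: finite) gstar measure"
  assumes "\<rho> \<in> prob_gstar" "AE g in \<rho>. g \<in> tstar"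
  shows "(\<integral>\<^sup>+t. (\<Sum>v\<in>root_nbrs t. F (child_branch n t v) (root_branch (Suc n) t v)) \<partial>trunc_law (Suc n) \<rho>) =
    (\<integral>\<^sup>+g. (\<Sum>v\<in>root_nbrs g. F (child_branch n g v) (root_branch (Suc n) g v)) \<partial>\<rho>)"
proof -
  have eq: "(\<Sum>v\<in>root_nbrs (trunc (Suc n) g). F (child_branch n (trunc (Suc n) g) v)
        (root_branch (Suc n) (trunc (Suc n) g) v))
      = (\<Sum>v\<in>root_nbrs g. F (child_branch n g v) (root_branch (Suc n) g v))" if g: "g \<in> tstar" for g
  proof -
    obtain \<sigma> where \<sigma>: "bij_betw \<sigma> (root_nbrs g) (root_nbrs (trunc (Suc n) g))"
      "\<forall>v\<in>root_nbrs g. child_branch n (trunc (Suc n) g) (\<sigma> v) = child_branch n g v \<and>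
        root_branch (Suc n) (trunc (Suc n) g) (\<sigma> v) = root_branch (Suc n) g v"
      using trunc_root_nbrs[OF tstar_decomposable[OF g], of n] by blast
    show ?thesis by (subst sum.reindex_bij_betw[OF \<sigma>(1), symmetric]) (use \<sigma>(2) in simp)
  qed
  show ?thesis
    unfolding nn_integral_trunc_law[OF assms(1)]
    by (intro nn_integral_cong_AE) (use assms(2) eq in \<open>auto elim!: eventually_mono\<close>)
qed

lemma nn_integral_trunc_law_deg:
  fixes \<rho> :: "('x :: finite, 'y :: finite) gstar measure"
  assumes "\<rho> \<in> unimod_trees \<beta>"
  shows "(\<integral>\<^sup>+t. of_nat (root_deg t) \<partial>trunc_law (Suc n) \<rho>) = ennreal \<beta>"
proof -
  have \<rho>: "\<rho> \<in> prob_gstar" "AE g in \<rho>. g \<in> tstar" using assms by (auto simp: unimod_trees_def)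
  have "(\<integral>\<^sup>+t. of_nat (root_deg t) \<partial>trunc_law (Suc n) \<rho>) = (\<integral>\<^sup>+g. of_nat (root_deg g) \<partial>\<rho>)"
    unfolding nn_integral_trunc_law[OF \<rho>(1)]
    by (intro nn_integral_cong_AE)
      (use \<rho>(2) root_deg_trunc tstar_decomposable in \<open>auto elim!: eventually_mono\<close>)
  then show ?thesis using assms by (simp add: unimod_trees_def mean_deg_def)
qed

section \<open>Size-biasing and the edge law\<close>

locale finite_mean_deg =
  fixes \<mu> :: "('x, 'y) gstar pmf" and \<beta> :: real
  assumes \<beta>: "\<beta> > 0" and deg: "(\<integral>\<^sup>+t. of_nat (root_deg t) \<partial>\<mu>) = ennreal \<beta>"
begin

lemma expectation_deg: "measure_pmf.expectation \<mu> (\<lambda>\<tau>. real (root_deg \<tau>)) = \<beta>"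
  using deg \<beta> by (subst integral_eq_nn_integral) (auto simp: ennreal_of_nat_eq_real_of_nat)

lemma size_biased_total:
  "(\<integral>\<^sup>+\<tau>. ennreal (real (root_deg \<tau>) / \<beta> * pmf \<mu> \<tau>) \<partial>count_space UNIV) = 1"
proof -
  have "(\<integral>\<^sup>+\<tau>. ennreal (real (root_deg \<tau>) / \<beta> * pmf \<mu> \<tau>) \<partial>count_space UNIV)
      = (\<integral>\<^sup>+\<tau>. ennreal (1 / \<beta>) * of_nat (root_deg \<tau>) \<partial>\<mu>)"
    unfolding nn_integral_measure_pmf using \<beta>
    by (intro nn_integral_cong)
      (simp add: ennreal_of_nat_eq_real_of_nat ennreal_mult[symmetric] field_simps)
  also have "\<dots> = ennreal (1 / \<beta>) * ennreal \<beta>"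
    by (subst nn_integral_cmult) (simp_all add: deg)
  also have "\<dots> = 1" using \<beta> by (simp add: ennreal_mult[symmetric])
  finally show ?thesis .
qed

lemma pmf_size_biased: "pmf (size_biased \<mu>) \<tau> = real (root_deg \<tau>) / \<beta> * pmf \<mu> \<tau>"
  unfolding size_biased_def expectation_deg
  by (rule pmf_embed_pmf) (use size_biased_total \<beta> in auto)

lemma set_size_biased: "set_pmf (size_biased \<mu>) = {\<tau> \<in> set_pmf \<mu>. root_nbrs \<tau> \<noteq> {}}"
  using \<beta> by (auto simp: set_pmf_iff pmf_size_biased root_deg_def finite_root_nbrs card_gt_0_iff)

lemma set_edge_law:
  "set_pmf (edge_law (Suc n) \<mu>) = {branch_pair n \<tau> v | \<tau> v. \<tau> \<in> set_pmf \<mu> \<and> v \<in> root_nbrs \<tau>}"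
  unfolding edge_law_def by (auto simp: set_size_biased finite_root_nbrs)

text \<open>Size-biasing multiplies by the degree, and the uniform choice of a child divides by it;
  only the normalisation \<open>\<beta>\<close> remains.\<close>

lemma nn_integral_edge_law:
  "ennreal \<beta> * (\<integral>\<^sup>+p. f p \<partial>edge_law (Suc n) \<mu>) = (\<integral>\<^sup>+\<tau>. (\<Sum>v\<in>root_nbrs \<tau>. f (branch_pair n \<tau> v)) \<partial>\<mu>)"
proof -
  define g where "g \<tau> = (\<integral>\<^sup>+v. f (branch_pair n \<tau> v) \<partial>measure_pmf (pmf_of_set (root_nbrs \<tau>)))" for \<tau>
  have "ennreal \<beta> * (\<integral>\<^sup>+p. f p \<partial>edge_law (Suc n) \<mu>) = ennreal \<beta> * (\<integral>\<^sup>+\<tau>. g \<tau> \<partial>size_biased \<mu>)"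
    by (simp add: edge_law_def g_def nn_integral_bind_pmf)
  also have "\<dots> = (\<integral>\<^sup>+\<tau>. ennreal (pmf \<mu> \<tau>) * (ennreal (real (root_deg \<tau>)) * g \<tau>) \<partial>count_space UNIV)"
  proof -
    have "ennreal \<beta> * ennreal (pmf (size_biased \<mu>) \<tau>) = ennreal (pmf \<mu> \<tau>) * ennreal (real (root_deg \<tau>))" for \<tau>
      using \<beta> by (simp add: pmf_size_biased ennreal_mult[symmetric] mult.commute)
    then have "ennreal \<beta> * (ennreal (pmf (size_biased \<mu>) \<tau>) * g \<tau>)
        = ennreal (pmf \<mu> \<tau>) * (ennreal (real (root_deg \<tau>)) * g \<tau>)" for \<tau>
      by (metis mult.assoc)
    then show ?thesis
      unfolding nn_integral_measure_pmf by (subst nn_integral_cmult[symmetric]) simp_all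
  qed
  also have "\<dots> = (\<integral>\<^sup>+\<tau>. (\<Sum>v\<in>root_nbrs \<tau>. f (branch_pair n \<tau> v)) \<partial>\<mu>)"
    unfolding nn_integral_measure_pmf[of \<mu>]
  proof (intro nn_integral_cong arg_cong2[where f = times] refl)
    fix \<tau>
    show "ennreal (real (root_deg \<tau>)) * g \<tau> = (\<Sum>v\<in>root_nbrs \<tau>. f (branch_pair n \<tau> v))"
    proof (cases "root_nbrs \<tau> = {}")
      case False
      then have "g \<tau> = (\<Sum>v\<in>root_nbrs \<tau>. f (branch_pair n \<tau> v)) / of_nat (root_deg \<tau>)"
        unfolding g_def root_deg_def
        by (subst nn_integral_pmf_of_set) (auto simp: finite_root_nbrs)
      moreover have "of_nat (root_deg \<tau>) \<noteq> (0 :: ennreal)"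
        using False by (simp add: root_deg_def finite_root_nbrs)
      ultimately show ?thesis
        by (simp add: ennreal_of_nat_eq_real_of_nat[symmetric] ennreal_times_divide)
          (metis mult.commute mult_divide_eq_ennreal of_nat_eq_0_iff ennreal_of_nat_neq_top not_gr_zero)
    qed (simp add: root_deg_def)
  qed
  finally show ?thesis .
qed

end

section \<open>The conditional law behind the one-step extension\<close>

lemma nn_integral_cond_pmf_le:
  assumes "set_pmf p \<inter> s \<noteq> {}"
  shows "(\<integral>\<^sup>+x. f x \<partial>cond_pmf p s) \<le> (\<integral>\<^sup>+x. f x \<partial>p) / emeasure (measure_pmf p) s"
proof -
  have "(\<integral>\<^sup>+x. f x \<partial>cond_pmf p s) = (\<integral>\<^sup>+x. f x * indicator s x \<partial>p) / emeasure (measure_pmf p) s"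
    unfolding cond_pmf.rep_eq[OF assms] by (rule nn_integral_uniform_measure) auto
  also have "\<dots> \<le> (\<integral>\<^sup>+x. f x \<partial>p) / emeasure (measure_pmf p) s"
    by (intro divide_right_mono_ennreal nn_integral_mono) (auto simp: indicator_def)
  finally show ?thesis .
qed

lemma emeasure_pmf_pos: "set_pmf p \<inter> s \<noteq> {} \<Longrightarrow> emeasure (measure_pmf p) s \<noteq> 0"
  by (auto simp: measure_pmf.emeasure_eq_measure measure_pmf_zero_iff)

text \<open>The pair must be realised by some edge, as otherwise the conditioning event is null. It
  appears as \<open>(t', t)\<close> because \<open>branch_pair\<close> lists the child branch first,
  while the kernel extends the root branch \<open>t\<close>.\<close>

context
  fixes \<mu> :: "('x, 'y) gstar pmf" and n :: nat and t t' :: "('x, 'y) gstar \<times> 'y" and \<tau>0 v0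
  assumes ex: "\<tau>0 \<in> set_pmf \<mu>" "v0 \<in> root_nbrs \<tau>0" "branch_pair n \<tau>0 v0 = (t', t)"
begin

lemma set_step_kernel:
  "set_pmf (step_kernel (Suc n) \<mu> t t') =
    {root_branch (Suc n) \<tau> v | \<tau> v. \<tau> \<in> set_pmf \<mu> \<and> v \<in> root_nbrs \<tau> \<and> branch_pair n \<tau> v = (t', t)}"
proof -
  have ne: "set_pmf \<mu> \<inter> {\<tau>. root_nbrs \<tau> \<noteq> {}} \<noteq> {}" using ex by auto
  let ?Q = "bind_pmf (cond_pmf \<mu> {\<tau>. root_nbrs \<tau> \<noteq> {}})
         (\<lambda>\<tau>. map_pmf (\<lambda>v. (root_branch (Suc n) \<tau> v, branch_pair n \<tau> v))
                (pmf_of_set (root_nbrs \<tau>)))"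
  have Q: "set_pmf ?Q = {(root_branch (Suc n) \<tau> v, branch_pair n \<tau> v) | \<tau> v. \<tau> \<in> set_pmf \<mu> \<and> v \<in> root_nbrs \<tau>}"
    by (auto simp: set_cond_pmf[OF ne] finite_root_nbrs)
  have ne': "set_pmf ?Q \<inter> {(_, s', s). s = t \<and> s' = t'} \<noteq> {}"
    unfolding Q using ex by (auto simp: branch_pair_def)
  show ?thesis
    unfolding step_kernel_def diff_Suc_1 set_map_pmf set_cond_pmf[OF ne'] Q
    by (force simp: branch_pair_def)
qed

text \<open>The kernel samples the root without size bias, so the first moment of the degree is
  enough; each conditioning costs the inverse of a positive probability.\<close>

lemma nn_integral_step_kernel_finite:
  assumes fin: "(\<integral>\<^sup>+\<tau>. of_nat (root_deg \<tau>) \<partial>\<mu>) < \<infinity>"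
    and f: "\<And>\<tau> v. \<tau> \<in> set_pmf \<mu> \<Longrightarrow> v \<in> root_nbrs \<tau> \<Longrightarrow> f (root_branch (Suc n) \<tau> v) \<le> of_nat (root_deg \<tau>)"
  shows "(\<integral>\<^sup>+c. f c \<partial>step_kernel (Suc n) \<mu> t t') < \<infinity>"
proof -
  have ne: "set_pmf \<mu> \<inter> {\<tau>. root_nbrs \<tau> \<noteq> {}} \<noteq> {}" using ex by auto
  let ?C = "cond_pmf \<mu> {\<tau>. root_nbrs \<tau> \<noteq> {}}"
  let ?Q = "bind_pmf ?C
         (\<lambda>\<tau>. map_pmf (\<lambda>v. (root_branch (Suc n) \<tau> v, branch_pair n \<tau> v))
                (pmf_of_set (root_nbrs \<tau>)))"
  have Q: "set_pmf ?Q = {(root_branch (Suc n) \<tau> v, branch_pair n \<tau> v) | \<tau> v. \<tau> \<in> set_pmf \<mu> \<and> v \<in> root_nbrs \<tau>}"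
    by (auto simp: set_cond_pmf[OF ne] finite_root_nbrs)
  have ne': "set_pmf ?Q \<inter> {(_, s', s). s = t \<and> s' = t'} \<noteq> {}"
    unfolding Q using ex by (auto simp: branch_pair_def)
  have "(\<integral>\<^sup>+c. f c \<partial>step_kernel (Suc n) \<mu> t t') =
      (\<integral>\<^sup>+p. f (fst p) \<partial>cond_pmf ?Q {(_, s', s). s = t \<and> s' = t'})"
    by (simp add: step_kernel_def)
  also have "\<dots> \<le> (\<integral>\<^sup>+p. f (fst p) \<partial>?Q) / emeasure (measure_pmf ?Q) {(_, s', s). s = t \<and> s' = t'}"
    by (rule nn_integral_cond_pmf_le[OF ne'])
  also have "\<dots> < \<infinity>"
  proof -
    have "(\<integral>\<^sup>+p. f (fst p) \<partial>?Q) = (\<integral>\<^sup>+\<tau>. (\<integral>\<^sup>+v. f (root_branch (Suc n) \<tau> v) \<partial>pmf_of_set (root_nbrs \<tau>)) \<partial>?C)"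
      by (simp add: nn_integral_bind_pmf)
    also have "\<dots> \<le> (\<integral>\<^sup>+\<tau>. of_nat (root_deg \<tau>) \<partial>?C)"
    proof (intro nn_integral_mono_AE, unfold AE_measure_pmf_iff, intro ballI)
      fix \<tau> assume "\<tau> \<in> set_pmf ?C"
      then have \<tau>: "\<tau> \<in> set_pmf \<mu>" "root_nbrs \<tau> \<noteq> {}" by (auto simp: set_cond_pmf[OF ne])
      have "(\<integral>\<^sup>+v. f (root_branch (Suc n) \<tau> v) \<partial>pmf_of_set (root_nbrs \<tau>))
          \<le> (\<integral>\<^sup>+v. of_nat (root_deg \<tau>) \<partial>pmf_of_set (root_nbrs \<tau>))"
        by (intro nn_integral_mono_AE) (use \<tau> f in \<open>auto simp: AE_measure_pmf_iff finite_root_nbrs\<close>)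
      then show "(\<integral>\<^sup>+v. f (root_branch (Suc n) \<tau> v) \<partial>pmf_of_set (root_nbrs \<tau>)) \<le> of_nat (root_deg \<tau>)"
        by (simp add: measure_pmf.emeasure_space_1)
    qed
    also have "\<dots> \<le> (\<integral>\<^sup>+\<tau>. of_nat (root_deg \<tau>) \<partial>\<mu>) / emeasure (measure_pmf \<mu>) {\<tau>. root_nbrs \<tau> \<noteq> {}}"
      by (rule nn_integral_cond_pmf_le[OF ne])
    also have "\<dots> < \<infinity>"
      using fin emeasure_pmf_pos[OF ne] by (simp add: ennreal_divide_eq_top_iff less_top[symmetric])
    finally show ?thesis
      using emeasure_pmf_pos[OF ne'] by (simp add: ennreal_divide_eq_top_iff less_top[symmetric])
  qed
  finally show ?thesis .
qed

end

section \<open>Relative entropy of a discrete law\<close>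

text \<open>The quotient of point masses is a density, so \<open>RN_deriv\<close> is one as well,
  and comparing singletons determines it. The product form stays valid off the support of
  \<open>p\<close>, where both sides are 0.\<close>

lemma RN_deriv_pmf:
  fixes p :: "'a pmf" and q :: "'a measure"
  assumes q: "sets q = UNIV" "\<And>x. x \<in> set_pmf p \<Longrightarrow> emeasure q {x} \<noteq> 0 \<and> emeasure q {x} \<noteq> \<infinity>"
  shows "RN_deriv q (measure_pmf p) x * emeasure q {x} = ennreal (pmf p x)"
proof -
  define f where "f x = (if x \<in> set_pmf p then ennreal (pmf p x) / emeasure q {x} else 0)" for x
  have meas: "g \<in> borel_measurable q" for g :: "'a \<Rightarrow> ennreal"
  proof -
    have "sets q = sets (count_space UNIV)" using q(1) by simp
    from measurable_cong_sets[OF this refl, of "borel :: ennreal measure"] show ?thesis by simp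
  qed
  have single: "emeasure (density q g) {x} = g x * emeasure q {x}" for g x
    by (subst emeasure_density[OF meas]) (simp_all add: q nn_integral_indicator_singleton)
  have "density q f = measure_pmf p"
  proof (rule measure_eqI_countable_AE[where \<Omega> = "set_pmf p"])
    show "AE x in density q f. x \<in> set_pmf p"
      by (subst AE_density[OF meas]) (auto simp: f_def)
    show "emeasure (density q f) {x} = emeasure (measure_pmf p) {x}" if "x \<in> set_pmf p" for x
      using q(2)[OF that] that
      by (simp add: single f_def emeasure_pmf_single ennreal_divide_times)
        (simp add: divide_ennreal_def mult.assoc ennreal_inverse_mult mult.commute[of "inverse _"]
          less_top flip: mult.assoc divide_ennreal_def)
  qed (auto simp: q AE_measure_pmf)
  then have "density q (RN_deriv q (measure_pmf p)) = measure_pmf p" by (intro RN_derivI[OF meas])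
  then show ?thesis using single[of "RN_deriv q (measure_pmf p)" x] by (simp add: emeasure_pmf_single)
qed

lemma absolutely_continuous_pmf_iff:
  fixes p :: "'a pmf" and q :: "'a measure"
  assumes "sets q = UNIV"
  shows "absolutely_continuous q (measure_pmf p) \<longleftrightarrow> (\<forall>x\<in>set_pmf p. emeasure q {x} \<noteq> 0)"
proof
  assume ac: "absolutely_continuous q (measure_pmf p)"
  show "\<forall>x\<in>set_pmf p. emeasure q {x} \<noteq> 0"
  proof
    fix x assume x: "x \<in> set_pmf p"
    show "emeasure q {x} \<noteq> 0"
    proof
      assume "emeasure q {x} = 0"
      then have "{x} \<in> null_sets (measure_pmf p)"
        using ac assms by (auto simp: absolutely_continuous_def null_sets_def)
      then show False using x by (auto simp: null_sets_def emeasure_pmf_single set_pmf_iff)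
    qed
  qed
next
  assume pos: "\<forall>x\<in>set_pmf p. emeasure q {x} \<noteq> 0"
  show "absolutely_continuous q (measure_pmf p)"
    unfolding absolutely_continuous_def
  proof
    fix A assume A: "A \<in> null_sets q"
    have "set_pmf p \<inter> A = {}"
    proof (rule ccontr)
      assume "set_pmf p \<inter> A \<noteq> {}"
      then obtain x where "x \<in> set_pmf p" "x \<in> A" by blast
      moreover have "emeasure q {x} \<le> emeasure q A"
        using \<open>x \<in> A\<close> assms by (intro emeasure_mono) auto
      ultimately show False using pos A by (auto simp: null_sets_def)
    qed
    then show "A \<in> null_sets (measure_pmf p)"
      by (simp add: null_sets_def measure_pmf.emeasure_eq_measure measure_pmf_zero_iff)
  qed
qed

definition log_ratio :: "'a pmf \<Rightarrow> 'a measure \<Rightarrow> 'a \<Rightarrow> real" where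
  "log_ratio p q x = ln (pmf p x / measure q {x})"

lemma rel_entropy_eq_infty:
  fixes p :: "'a pmf"
  assumes "sets q = UNIV" "x \<in> set_pmf p" "emeasure q {x} = 0"
  shows "rel_entropy (measure_pmf p) q = \<infinity>"
  using absolutely_continuous_pmf_iff[OF assms(1), of p] assms(2,3) by (auto simp: rel_entropy_def)

text \<open>Here \<open>q\<close> is a general measure, because the tilted laws are only shown to
  have mass at most 1.\<close>

locale dominated =
  fixes p :: "'a pmf" and q :: "'a measure"
  assumes sets_q: "sets q = UNIV"
    and pos: "\<And>x. x \<in> set_pmf p \<Longrightarrow> emeasure q {x} \<noteq> 0 \<and> emeasure q {x} \<noteq> \<infinity>"
begin

lemma measure_pos: "x \<in> set_pmf p \<Longrightarrow> measure q {x} > 0"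
  using pos[of x] by (simp add: measure_def enn2real_positive_iff less_top zero_less_iff_neq_zero)

lemma emeasure_q: "x \<in> set_pmf p \<Longrightarrow> emeasure q {x} = ennreal (measure q {x})"
  using pos[of x] by (simp add: emeasure_eq_ennreal_measure)

lemma RN_deriv_eq:
  assumes "x \<in> set_pmf p"
  shows "RN_deriv q (measure_pmf p) x = ennreal (pmf p x / measure q {x})"
proof -
  have "RN_deriv q (measure_pmf p) x = RN_deriv q (measure_pmf p) x * emeasure q {x} / emeasure q {x}"
    using pos[OF assms] by (simp add: mult_divide_eq_ennreal)
  also have "RN_deriv q (measure_pmf p) x * emeasure q {x} = ennreal (pmf p x)"
    by (rule RN_deriv_pmf[OF sets_q]) (rule pos)
  also have "ennreal (pmf p x) / emeasure q {x} = ennreal (pmf p x) / ennreal (measure q {x})"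
    by (simp add: emeasure_q[OF assms])
  also have "\<dots> = ennreal (pmf p x / measure q {x})"
    using measure_pos[OF assms] by (simp add: divide_ennreal)
  finally show ?thesis .
qed

lemma rel_entropy_eq:
  "rel_entropy (measure_pmf p) q =
    (if integrable (measure_pmf p) (log_ratio p q) then ereal (\<integral>x. log_ratio p q x \<partial>measure_pmf p) else \<infinity>)"
proof -
  have ac: "absolutely_continuous q (measure_pmf p)"
    using pos by (simp add: absolutely_continuous_pmf_iff[OF sets_q])
  have eq: "entropy_density (exp 1) q (measure_pmf p) x = log_ratio p q x" if "x \<in> set_pmf p" for x
    using measure_pos[OF that] RN_deriv_eq[OF that]
    by (simp add: entropy_density_def log_ratio_def log_def)
  have int: "integrable (measure_pmf p) (entropy_density (exp 1) q (measure_pmf p)) \<longleftrightarrow>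
      integrable (measure_pmf p) (log_ratio p q)"
    by (intro integrable_cong_AE) (auto simp: AE_measure_pmf_iff eq)
  have "(\<integral>x. entropy_density (exp 1) q (measure_pmf p) x \<partial>measure_pmf p) = (\<integral>x. log_ratio p q x \<partial>measure_pmf p)"
    by (intro integral_cong_AE) (auto simp: AE_measure_pmf_iff eq)
  then show ?thesis using ac by (simp add: rel_entropy_def int KL_divergence_def)
qed

lemma nn_integral_ratio_le:
  "(\<integral>\<^sup>+x. ennreal (measure q {x} / pmf p x) \<partial>measure_pmf p) \<le> emeasure q UNIV"
proof -
  have "(\<integral>\<^sup>+x. ennreal (measure q {x} / pmf p x) \<partial>measure_pmf p)
      = (\<integral>\<^sup>+x. emeasure q {x} * indicator (set_pmf p) x \<partial>count_space UNIV)"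
    unfolding nn_integral_measure_pmf
    by (intro nn_integral_cong)
      (auto simp: indicator_def set_pmf_iff emeasure_q ennreal_mult[symmetric])
  also have "\<dots> = (\<integral>\<^sup>+x. emeasure q {x} \<partial>count_space (set_pmf p))"
    by (simp add: nn_integral_count_space_indicator)
  also have "\<dots> = emeasure q (set_pmf p)"
    by (rule emeasure_countable_singleton[symmetric]) (auto simp: sets_q)
  also have "\<dots> \<le> emeasure q UNIV" by (rule emeasure_mono) (auto simp: sets_q)
  finally show ?thesis .
qed

lemma minus_log_ratio_le: "x \<in> set_pmf p \<Longrightarrow> - log_ratio p q x \<le> measure q {x} / pmf p x - 1"
  using measure_pos[of x] ln_le_minus_one[of "measure q {x} / pmf p x"] pmf_positive[of x p]
  by (simp add: log_ratio_def ln_div)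

text \<open>By \<open>ln x \<le> x - 1\<close> the negative part is at most the inverse ratio, whose
  \<open>p\<close>-integral is the \<open>q\<close>-mass of the support of \<open>p\<close>.\<close>

lemma nn_integral_minus_log_ratio_le:
  "(\<integral>\<^sup>+x. ennreal (- log_ratio p q x) \<partial>measure_pmf p) \<le> emeasure q UNIV"
proof -
  have "ennreal (- log_ratio p q x) \<le> ennreal (measure q {x} / pmf p x)" if "x \<in> set_pmf p" for x
    using minus_log_ratio_le[OF that] by (intro ennreal_leI) simp
  then have "(\<integral>\<^sup>+x. ennreal (- log_ratio p q x) \<partial>measure_pmf p)
      \<le> (\<integral>\<^sup>+x. ennreal (measure q {x} / pmf p x) \<partial>measure_pmf p)"
    by (intro nn_integral_mono_AE) (simp add: AE_measure_pmf_iff)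
  then show ?thesis using nn_integral_ratio_le by simp
qed

end

lemma rel_entropy_not_MInfty: "rel_entropy \<mu> \<mu>' \<noteq> - \<infinity>"
  by (simp add: rel_entropy_def)

text \<open>Gibbs' inequality, again from \<open>ln x \<le> x - 1\<close>; the inverse ratio
  integrates to at most the mass of \<open>q\<close>.\<close>

lemma rel_entropy_nonneg:
  fixes p :: "'a pmf"
  assumes "sets q = UNIV" "emeasure q UNIV \<le> 1"
  shows "0 \<le> rel_entropy (measure_pmf p) q"
proof (cases "\<forall>x\<in>set_pmf p. emeasure q {x} \<noteq> 0")
  case False
  then show ?thesis using rel_entropy_eq_infty[OF assms(1), of _ p] by fastforce
next
  case True
  have "emeasure q {x} \<noteq> \<infinity>" for x
    using emeasure_mono[of "{x}" UNIV q] assms by (auto simp: top_unique)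
  then interpret dominated p q using True assms(1) by unfold_locales auto
  show ?thesis
  proof (cases "integrable (measure_pmf p) (log_ratio p q)")
    case int: True
    have le: "(\<integral>\<^sup>+x. ennreal (measure q {x} / pmf p x) \<partial>measure_pmf p) \<le> 1"
      using nn_integral_ratio_le assms(2) by (rule order_trans)
    have intr: "integrable (measure_pmf p) (\<lambda>x. measure q {x} / pmf p x)"
      using le by (intro integrableI_bounded) (auto simp: less_top[symmetric] top_unique)
    have "(\<integral>x. measure q {x} / pmf p x \<partial>measure_pmf p) \<le> 1"
      using le intr by (subst (asm) nn_integral_eq_integral) auto
    then have "0 \<le> (\<integral>x. 1 - measure q {x} / pmf p x \<partial>measure_pmf p)"
      using intr by simp
    also have "\<dots> \<le> (\<integral>x. log_ratio p q x \<partial>measure_pmf p)"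
      using int intr minus_log_ratio_le
      by (intro integral_mono_AE) (auto simp: AE_measure_pmf_iff algebra_simps)
    finally show ?thesis using int by (simp add: rel_entropy_eq)
  qed (simp add: rel_entropy_eq)
qed

lemma dominated_pmf: "set_pmf p \<subseteq> set_pmf m \<Longrightarrow> dominated p (measure_pmf m)"
  by unfold_locales (auto simp: emeasure_pmf_single set_pmf_iff)

lemma log_ratio_pmf: "log_ratio p (measure_pmf m) x = ln (pmf p x / pmf m x)"
  by (simp add: log_ratio_def measure_pmf_single)

lemma emeasure_density_pmf: "emeasure (density (measure_pmf m) D) {x} = D x * ennreal (pmf m x)"
  by (simp add: emeasure_density nn_integral_indicator_singleton emeasure_pmf_single)

locale tilted =
  fixes p m :: "'a pmf" and D :: "'a \<Rightarrow> ennreal" and d :: "'a \<Rightarrow> real"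
  assumes sub: "set_pmf p \<subseteq> set_pmf m"
    and d: "\<And>x. x \<in> set_pmf p \<Longrightarrow> D x = ennreal (d x) \<and> d x > 0"
begin

sublocale dominated p "density (measure_pmf m) D"
proof
  fix x assume x: "x \<in> set_pmf p"
  then have "pmf m x > 0" using sub by (auto simp: pmf_positive)
  then show "emeasure (density (measure_pmf m) D) {x} \<noteq> 0 \<and> emeasure (density (measure_pmf m) D) {x} \<noteq> \<infinity>"
    using d[OF x] by (simp add: emeasure_density_pmf ennreal_mult[symmetric])
qed simp

lemma log_ratio_density:
  assumes "x \<in> set_pmf p"
  shows "log_ratio p (density (measure_pmf m) D) x = log_ratio p (measure_pmf m) x - ln (d x)"
proof -
  have m: "pmf m x > 0" "pmf p x > 0" using sub assms by (auto simp: pmf_positive)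
  have "measure (density (measure_pmf m) D) {x} = d x * pmf m x"
    using d[OF assms] m by (simp add: measure_def emeasure_density_pmf ennreal_mult[symmetric])
  then show ?thesis using d[OF assms] m by (simp add: log_ratio_def measure_pmf_single ln_div ln_mult)
qed

text \<open>With \<open>ln d\<close> integrable, the two log ratios are integrable together or not
  at all, so the identity also covers infinite entropies.\<close>

lemma rel_entropy_density:
  assumes "integrable (measure_pmf p) (\<lambda>x. ln (d x))"
  shows "rel_entropy (measure_pmf p) (density (measure_pmf m) D) =
    rel_entropy (measure_pmf p) (measure_pmf m) - ereal (\<integral>x. ln (d x) \<partial>measure_pmf p)"
proof -
  interpret pm: dominated p "measure_pmf m" by (rule dominated_pmf[OF sub])
  let ?L = "log_ratio p (measure_pmf m)" and ?Q = "log_ratio p (density (measure_pmf m) D)"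
  have int: "integrable (measure_pmf p) ?Q \<longleftrightarrow> integrable (measure_pmf p) (\<lambda>x. ?L x - ln (d x))"
    by (intro integrable_cong_AE) (auto simp: AE_measure_pmf_iff log_ratio_density)
  have eq: "(\<integral>x. ?Q x \<partial>measure_pmf p) = (\<integral>x. ?L x - ln (d x) \<partial>measure_pmf p)"
    by (intro integral_cong_AE) (auto simp: AE_measure_pmf_iff log_ratio_density)
  have "integrable (measure_pmf p) (\<lambda>x. ?L x - ln (d x)) \<longleftrightarrow> integrable (measure_pmf p) ?L"
    using Bochner_Integration.integrable_add[of "measure_pmf p" "\<lambda>x. ?L x - ln (d x)" "\<lambda>x. ln (d x)"] assms
    by auto
  then show ?thesis
    unfolding rel_entropy_eq pm.rel_entropy_eq int eq using assms by simp
qed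

text \<open>Integrability half of the Donsker--Varadhan inequality.\<close>

lemma nn_integral_ln_density_finite:
  assumes "integrable (measure_pmf p) (log_ratio p (measure_pmf m))"
    and "(\<integral>\<^sup>+x. D x \<partial>measure_pmf m) < \<infinity>"
  shows "(\<integral>\<^sup>+x. ennreal (ln (d x)) \<partial>measure_pmf p) < \<infinity>"
proof -
  let ?L = "log_ratio p (measure_pmf m)" and ?Q = "log_ratio p (density (measure_pmf m) D)"
  \<comment> \<open>Since \<open>ln d = ?L - ?Q\<close>, only the negative part of \<open>?Q\<close>
    matters, and the mass of the tilted measure bounds its integral.\<close>
  have "ennreal (ln (d x)) \<le> ennreal \<bar>?L x\<bar> + ennreal (- ?Q x)" if "x \<in> set_pmf p" for x
  proof -
    have "ln (d x) \<le> \<bar>?L x\<bar> + max 0 (- ?Q x)" using log_ratio_density[OF that] by simp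
    then have "ennreal (ln (d x)) \<le> ennreal (\<bar>?L x\<bar> + max 0 (- ?Q x))" by (rule ennreal_leI)
    also have "\<dots> = ennreal \<bar>?L x\<bar> + ennreal (- ?Q x)"
      by (subst ennreal_plus) (auto simp: max_def ennreal_neg)
    finally show ?thesis .
  qed
  then have "(\<integral>\<^sup>+x. ennreal (ln (d x)) \<partial>measure_pmf p) \<le>
      (\<integral>\<^sup>+x. ennreal \<bar>?L x\<bar> + ennreal (- ?Q x) \<partial>measure_pmf p)"
    by (intro nn_integral_mono_AE) (simp add: AE_measure_pmf_iff)
  also have "\<dots> = (\<integral>\<^sup>+x. ennreal \<bar>?L x\<bar> \<partial>measure_pmf p) + (\<integral>\<^sup>+x. ennreal (- ?Q x) \<partial>measure_pmf p)"
    by (rule nn_integral_add) auto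
  also have "\<dots> < \<infinity>"
  proof -
    have "(\<integral>\<^sup>+x. ennreal \<bar>?L x\<bar> \<partial>measure_pmf p) < \<infinity>"
      using assms(1) by (simp add: integrable_iff_bounded)
    moreover have "emeasure (density (measure_pmf m) D) UNIV = (\<integral>\<^sup>+x. D x \<partial>measure_pmf m)"
      by (simp add: emeasure_density)
    then have "(\<integral>\<^sup>+x. ennreal (- ?Q x) \<partial>measure_pmf p) < \<infinity>"
      using nn_integral_minus_log_ratio_le assms(2) by (metis order_le_less_trans)
    ultimately show ?thesis by simp
  qed
  finally show ?thesis .
qed

end

section \<open>Sums over the edges at the root\<close>

context finite_mean_deg
begin

lemma nn_integral_sum_edges:
  "(\<integral>\<^sup>+\<tau>. ennreal (\<Sum>v\<in>root_nbrs \<tau>. \<bar>g (branch_pair n \<tau> v)\<bar>) \<partial>\<mu>) =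
    ennreal \<beta> * (\<integral>\<^sup>+p. ennreal \<bar>g p\<bar> \<partial>edge_law (Suc n) \<mu>)"
  unfolding nn_integral_edge_law by (intro nn_integral_cong) simp

lemma integrable_edge_sum:
  fixes g :: "_ \<Rightarrow> real"
  assumes g: "integrable (measure_pmf (edge_law (Suc n) \<mu>)) g"
  shows "integrable (measure_pmf \<mu>) (\<lambda>\<tau>. \<Sum>v\<in>root_nbrs \<tau>. g (branch_pair n \<tau> v))" (is "integrable _ ?S")
    and "(\<integral>\<tau>. (\<Sum>v\<in>root_nbrs \<tau>. g (branch_pair n \<tau> v)) \<partial>measure_pmf \<mu>) =
      \<beta> * (\<integral>p. g p \<partial>measure_pmf (edge_law (Suc n) \<mu>))"
proof -
  let ?E = "measure_pmf (edge_law (Suc n) \<mu>)"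
  have nonneg: "integrable (measure_pmf \<mu>) (\<lambda>\<tau>. \<Sum>v\<in>root_nbrs \<tau>. f (branch_pair n \<tau> v)) \<and>
      (\<integral>\<tau>. (\<Sum>v\<in>root_nbrs \<tau>. f (branch_pair n \<tau> v)) \<partial>measure_pmf \<mu>) = \<beta> * (\<integral>p. f p \<partial>?E)"
    if f: "integrable ?E f" "\<And>x. f x \<ge> 0" for f :: "_ \<Rightarrow> real"
  proof -
    have eq: "(\<integral>\<^sup>+\<tau>. ennreal (\<Sum>v\<in>root_nbrs \<tau>. f (branch_pair n \<tau> v)) \<partial>\<mu>) = ennreal (\<beta> * (\<integral>p. f p \<partial>?E))"
      using nn_integral_sum_edges[of f n] f \<beta>
      by (simp add: nn_integral_eq_integral ennreal_mult integral_nonneg)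
    have int: "integrable (measure_pmf \<mu>) (\<lambda>\<tau>. \<Sum>v\<in>root_nbrs \<tau>. f (branch_pair n \<tau> v))"
      using eq by (intro integrableI_nonneg) (auto simp: sum_nonneg f)
    show ?thesis
      using int eq \<beta> f by (simp add: nn_integral_eq_integral sum_nonneg integral_nonneg)
  qed
  define g1 where "g1 = (\<lambda>x. max (g x) 0)"
  define g2 where "g2 = (\<lambda>x. max (- g x) 0)"
  have "g x = g1 x - g2 x" for x by (simp add: g1_def g2_def max_def)
  then have gS: "?S \<tau> = (\<Sum>v\<in>root_nbrs \<tau>. g1 (branch_pair n \<tau> v)) - (\<Sum>v\<in>root_nbrs \<tau>. g2 (branch_pair n \<tau> v))"
    and g12: "g x = g1 x - g2 x" for \<tau> x by (simp_all add: sum_subtractf)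
  have i: "integrable ?E g1" "integrable ?E g2" using g by (auto simp: g1_def g2_def)
  have 1: "integrable (measure_pmf \<mu>) (\<lambda>\<tau>. \<Sum>v\<in>root_nbrs \<tau>. g1 (branch_pair n \<tau> v)) \<and>
      (\<integral>\<tau>. (\<Sum>v\<in>root_nbrs \<tau>. g1 (branch_pair n \<tau> v)) \<partial>measure_pmf \<mu>) = \<beta> * (\<integral>p. g1 p \<partial>?E)"
    by (rule nonneg[OF i(1)]) (simp add: g1_def)
  have 2: "integrable (measure_pmf \<mu>) (\<lambda>\<tau>. \<Sum>v\<in>root_nbrs \<tau>. g2 (branch_pair n \<tau> v)) \<and>
      (\<integral>\<tau>. (\<Sum>v\<in>root_nbrs \<tau>. g2 (branch_pair n \<tau> v)) \<partial>measure_pmf \<mu>) = \<beta> * (\<integral>p. g2 p \<partial>?E)"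
    by (rule nonneg[OF i(2)]) (simp add: g2_def)
  show "integrable (measure_pmf \<mu>) ?S" unfolding gS using 1 2 by simp
  show "(\<integral>\<tau>. ?S \<tau> \<partial>measure_pmf \<mu>) = \<beta> * (\<integral>p. g p \<partial>?E)"
  proof -
    have "(\<integral>\<tau>. ?S \<tau> \<partial>measure_pmf \<mu>) = \<beta> * (\<integral>p. g1 p \<partial>?E) - \<beta> * (\<integral>p. g2 p \<partial>?E)"
      unfolding gS using 1 2 by simp
    moreover have "(\<integral>p. g p \<partial>?E) = (\<integral>p. g1 p \<partial>?E) - (\<integral>p. g2 p \<partial>?E)"
      unfolding g12 using i by simp
    ultimately show ?thesis by (simp add: right_diff_distrib)
  qed
qed

text \<open>Large positive and negative terms could cancel in the sum over children. The first
  assumption bounds the negative parts separately and so allows passing from the sum back to single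
  edges.\<close>

lemma integrable_edge_of_sum:
  fixes g :: "_ \<Rightarrow> real"
  assumes "(\<integral>\<^sup>+p. ennreal (- g p) \<partial>edge_law (Suc n) \<mu>) < \<infinity>"
    and "(\<integral>\<^sup>+\<tau>. ennreal (\<Sum>v\<in>root_nbrs \<tau>. g (branch_pair n \<tau> v)) \<partial>\<mu>) < \<infinity>"
  shows "integrable (measure_pmf (edge_law (Suc n) \<mu>)) g"
proof -
  let ?E = "measure_pmf (edge_law (Suc n) \<mu>)"
  let ?S = "\<lambda>f \<tau>. \<Sum>v\<in>root_nbrs \<tau>. f (branch_pair n \<tau> v)"
  have fin: "(\<integral>\<^sup>+\<tau>. ?S (\<lambda>p. ennreal (- g p)) \<tau> \<partial>\<mu>) < \<infinity>"
    unfolding nn_integral_edge_law[where f = "\<lambda>p. ennreal (- g p)" and n = n, symmetric]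
    using assms(1) by (simp add: ennreal_mult_less_top)
  have mx: "ennreal (max 0 a) = ennreal a" for a by (simp add: max_def ennreal_neg)
  \<comment> \<open>The sum of the positive parts is the sum itself plus the sum of the negative
    parts.\<close>
  have "?S (\<lambda>p. ennreal (g p)) \<tau> \<le> ennreal (?S g \<tau>) + ?S (\<lambda>p. ennreal (- g p)) \<tau>" for \<tau>
  proof -
    have "?S (\<lambda>p. ennreal (g p)) \<tau> = ennreal (?S (\<lambda>p. max 0 (g p)) \<tau>)"
      by (subst sum_ennreal[symmetric]) (simp_all add: mx)
    also have "?S (\<lambda>p. max 0 (g p)) \<tau> = ?S g \<tau> + ?S (\<lambda>p. max 0 (- g p)) \<tau>"
      unfolding sum.distrib[symmetric] by (intro sum.cong) auto
    also have "ennreal \<dots> \<le> ennreal (?S g \<tau>) + ennreal (?S (\<lambda>p. max 0 (- g p)) \<tau>)"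
    proof -
      have "ennreal (a + b) \<le> ennreal a + ennreal b" if "b \<ge> 0" for a b :: real
        using that by (cases "a \<ge> 0") (auto simp: ennreal_neg intro!: ennreal_leI)
      then show ?thesis by (simp add: sum_nonneg)
    qed
    also have "ennreal (?S (\<lambda>p. max 0 (- g p)) \<tau>) = ?S (\<lambda>p. ennreal (- g p)) \<tau>"
      by (subst sum_ennreal[symmetric]) (simp_all add: mx)
    finally show ?thesis .
  qed
  then have "(\<integral>\<^sup>+\<tau>. ?S (\<lambda>p. ennreal (g p)) \<tau> \<partial>\<mu>) \<le> (\<integral>\<^sup>+\<tau>. ennreal (?S g \<tau>) + ?S (\<lambda>p. ennreal (- g p)) \<tau> \<partial>\<mu>)"
    by (rule nn_integral_mono)
  also have "\<dots> = (\<integral>\<^sup>+\<tau>. ennreal (?S g \<tau>) \<partial>\<mu>) + (\<integral>\<^sup>+\<tau>. ?S (\<lambda>p. ennreal (- g p)) \<tau> \<partial>\<mu>)"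
    by (rule nn_integral_add) auto
  also have "\<dots> < \<infinity>" using fin assms(2) by simp
  finally have "(\<integral>\<^sup>+p. ennreal (g p) \<partial>?E) < \<infinity>"
    unfolding nn_integral_edge_law[where f = "\<lambda>p. ennreal (g p)" and n = n, symmetric]
    using \<beta> by (auto simp: ennreal_mult_eq_top_iff less_top[symmetric])
  then show ?thesis using assms(1) by (simp add: real_integrable_def less_top[symmetric])
qed

end

section \<open>The one-step extension\<close>

lemma nn_integral_single_pmf: "(\<integral>\<^sup>+y. indicator {x} y \<partial>measure_pmf p) = ennreal (pmf p x)"
  by (simp add: emeasure_pmf_single)

locale unimodular_tree =
  fixes \<rho> :: "('x :: finite, 'y :: finite) gstar measure" and \<beta> :: real
  assumes \<rho>: "\<rho> \<in> unimod_trees \<beta>" and \<beta>_pos: "\<beta> > 0"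
begin

lemma prob: "\<rho> \<in> prob_gstar" and trees: "AE g in \<rho>. g \<in> tstar" and unimod: "unimodular \<rho>"
  using \<rho> by (auto simp: unimod_trees_def)

sublocale tr: finite_mean_deg "trunc_law (Suc n) \<rho>" \<beta> for n
  by unfold_locales (use \<beta>_pos nn_integral_trunc_law_deg[OF \<rho>] in auto)

lemma edge_law_symmetric:
  "map_pmf prod.swap (edge_law (Suc n) (trunc_law (Suc n) \<rho>)) = edge_law (Suc n) (trunc_law (Suc n) \<rho>)"
proof (rule pmf_eqI)
  fix z :: "(('x, 'y) gstar \<times> 'y) \<times> (('x, 'y) gstar \<times> 'y)"
  let ?E = "edge_law (Suc n) (trunc_law (Suc n) \<rho>)"
  define F where "F a b = (indicator {z} (a, b) :: ennreal)" for a b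
  \<comment> \<open>The edge law uses both branches to depth \<open>n\<close>, while
    \<open>nn_integral_trunc_law_sum\<close> delivers root branches of depth \<open>n + 1\<close>;
    the test function truncates them once more.\<close>
  have "ennreal \<beta> * (\<integral>\<^sup>+p. F (snd p) (fst p) \<partial>?E) =
      (\<integral>\<^sup>+g. (\<Sum>v\<in>root_nbrs g. F (root_branch n g v) (child_branch n g v)) \<partial>\<rho>)"
    unfolding tr.nn_integral_edge_law
    using nn_integral_trunc_law_sum[OF prob trees, where F = "\<lambda>a b. F (trunc_branch n b) a" and n = n]
    by (simp add: branch_pair_def trunc_root_branch)
  also have "\<dots> = (\<integral>\<^sup>+g. (\<Sum>v\<in>root_nbrs g. F (child_branch n g v) (root_branch n g v)) \<partial>\<rho>)"
    by (rule mass_transport[OF unimod, symmetric])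
  also have "\<dots> = ennreal \<beta> * (\<integral>\<^sup>+p. F (fst p) (snd p) \<partial>?E)"
    unfolding tr.nn_integral_edge_law
    using nn_integral_trunc_law_sum[OF prob trees, where F = "\<lambda>a b. F a (trunc_branch n b)" and n = n]
    by (simp add: branch_pair_def trunc_root_branch)
  finally have "(\<integral>\<^sup>+p. F (snd p) (fst p) \<partial>?E) = (\<integral>\<^sup>+p. F (fst p) (snd p) \<partial>?E)"
    using \<beta>_pos by (simp add: ennreal_mult_cancel_left)
  then have "(\<integral>\<^sup>+p. indicator {z} p \<partial>map_pmf prod.swap ?E) = (\<integral>\<^sup>+p. indicator {z} p \<partial>?E)"
    by (simp add: F_def prod.swap_def del: nn_integral_indicator nn_integral_indicator_singleton)
  then show "pmf (map_pmf prod.swap ?E) z = pmf ?E z"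
    unfolding nn_integral_single_pmf by simp
qed

lemma edge_law_marginals:
  "map_pmf snd (edge_law (Suc n) (trunc_law (Suc n) \<rho>)) = map_pmf fst (edge_law (Suc n) (trunc_law (Suc n) \<rho>))"
  by (subst edge_law_symmetric[symmetric]) (simp add: pmf.map_comp comp_def)

abbreviation "\<mu> n \<equiv> trunc_law (Suc n) \<rho>"

definition ext_kernel where
  "ext_kernel n \<tau> v = step_kernel (Suc n) (\<mu> n) (child_branch n \<tau> v) (root_branch n \<tau> v)"

lemma star_law_eq:
  "star_law (Suc (Suc n)) \<rho> =
    bind_pmf (\<mu> n) (\<lambda>\<tau>. map_pmf (glue \<tau>) (Pi_pmf (root_nbrs \<tau>) undefined (ext_kernel n \<tau>)))"
proof -
  have "Suc (Suc n) - 2 = n" by simp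
  then show ?thesis unfolding star_law_def ext_kernel_def diff_Suc_1 by simp
qed

text \<open>\<open>step_kernel\<close> extends the branch of a root, whereas \<open>star_law\<close>
  extends the branches of children. By symmetry of the edge law the reversed pair also occurs, so
  the kernel is conditioned on an event of positive probability.\<close>

lemma reversed_edge:
  assumes "\<tau> \<in> set_pmf (\<mu> n)" "v \<in> root_nbrs \<tau>"
  shows "\<exists>\<tau>0\<in>set_pmf (\<mu> n). \<exists>v0\<in>root_nbrs \<tau>0.
    branch_pair n \<tau>0 v0 = (root_branch n \<tau> v, child_branch n \<tau> v)"
proof -
  have "branch_pair n \<tau> v \<in> set_pmf (map_pmf prod.swap (edge_law (Suc n) (\<mu> n)))"
    unfolding edge_law_symmetric tr.set_edge_law using assms by blast
  then obtain \<tau>0 v0 where "\<tau>0 \<in> set_pmf (\<mu> n)" "v0 \<in> root_nbrs \<tau>0"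
    "branch_pair n \<tau> v = prod.swap (branch_pair n \<tau>0 v0)"
    unfolding set_map_pmf tr.set_edge_law by blast
  then show ?thesis by (force simp: branch_pair_def)
qed

lemma set_kernel:
  assumes "\<tau> \<in> set_pmf (\<mu> n)" "v \<in> root_nbrs \<tau>" "c \<in> set_pmf (ext_kernel n \<tau> v)"
  shows "trunc_branch n c = child_branch n \<tau> v" "trunc_branch (Suc n) c = c"
proof -
  obtain \<tau>0 v0 where 0: "\<tau>0 \<in> set_pmf (\<mu> n)" "v0 \<in> root_nbrs \<tau>0"
    "branch_pair n \<tau>0 v0 = (root_branch n \<tau> v, child_branch n \<tau> v)"
    using reversed_edge[OF assms(1,2)] by blast
  obtain \<tau>' v' where "c = root_branch (Suc n) \<tau>' v'" "root_branch n \<tau>' v' = child_branch n \<tau> v"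
    using assms(3) unfolding ext_kernel_def set_step_kernel[OF 0] by (auto simp: branch_pair_def)
  then show "trunc_branch n c = child_branch n \<tau> v" "trunc_branch (Suc n) c = c"
    by (simp_all add: trunc_root_branch)
qed

lemma glue_bij:
  assumes \<tau>: "\<tau> \<in> set_pmf (\<mu> n)"
    and s: "s \<in> set_pmf (Pi_pmf (root_nbrs \<tau>) undefined (ext_kernel n \<tau>))"
  shows "\<exists>\<sigma>. bij_betw \<sigma> (root_nbrs \<tau>) (root_nbrs (glue \<tau> s)) \<and>
    (\<forall>v\<in>root_nbrs \<tau>. branch_pair (Suc n) (glue \<tau> s) (\<sigma> v) = (s v, root_branch (Suc n) \<tau> v))"
proof -
  obtain g where "decomposable g" "\<tau> = trunc (Suc n) g" using set_trunc_law[OF prob trees \<tau>] by blast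
  moreover have "s v \<in> set_pmf (ext_kernel n \<tau> v)" if "v \<in> root_nbrs \<tau>" for v
    using s that by (auto simp: set_Pi_pmf finite_root_nbrs PiE_dflt_def)
  ultimately show ?thesis
    using glue_root_nbrs[of g \<tau> n s] set_kernel[OF \<tau>] unfolding branch_pair_def by metis
qed

text \<open>Gluing fixes the root branches to depth \<open>n + 1\<close>, so each factor depends on
  one coordinate of the product law and the integral factorises.\<close>

lemma nn_integral_star_prod:
  "(\<integral>\<^sup>+t. (\<Prod>w\<in>root_nbrs t. R (branch_pair (Suc n) t w)) \<partial>star_law (Suc (Suc n)) \<rho>) =
    (\<integral>\<^sup>+\<tau>. (\<Prod>v\<in>root_nbrs \<tau>. \<integral>\<^sup>+c. R (c, root_branch (Suc n) \<tau> v) \<partial>ext_kernel n \<tau> v) \<partial>\<mu> n)"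
proof -
  have "(\<Prod>w\<in>root_nbrs (glue \<tau> s). R (branch_pair (Suc n) (glue \<tau> s) w)) =
      (\<Prod>v\<in>root_nbrs \<tau>. R (s v, root_branch (Suc n) \<tau> v))"
    if \<tau>s: "\<tau> \<in> set_pmf (\<mu> n)" "s \<in> set_pmf (Pi_pmf (root_nbrs \<tau>) undefined (ext_kernel n \<tau>))" for \<tau> s
  proof -
    obtain \<sigma> where \<sigma>: "bij_betw \<sigma> (root_nbrs \<tau>) (root_nbrs (glue \<tau> s))"
      "\<forall>v\<in>root_nbrs \<tau>. branch_pair (Suc n) (glue \<tau> s) (\<sigma> v) = (s v, root_branch (Suc n) \<tau> v)"
      using glue_bij[OF \<tau>s] by blast
    show ?thesis by (subst prod.reindex_bij_betw[OF \<sigma>(1), symmetric]) (use \<sigma>(2) in simp)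
  qed
  then have "(\<integral>\<^sup>+t. (\<Prod>w\<in>root_nbrs t. R (branch_pair (Suc n) t w)) \<partial>star_law (Suc (Suc n)) \<rho>) =
      (\<integral>\<^sup>+\<tau>. \<integral>\<^sup>+s. (\<Prod>v\<in>root_nbrs \<tau>. R (s v, root_branch (Suc n) \<tau> v))
         \<partial>Pi_pmf (root_nbrs \<tau>) undefined (ext_kernel n \<tau>) \<partial>\<mu> n)"
    unfolding star_law_eq nn_integral_bind_pmf nn_integral_map_pmf
    by (intro nn_integral_cong_AE) (auto simp: AE_measure_pmf_iff intro!: nn_integral_cong_AE)
  also have "\<dots> = (\<integral>\<^sup>+\<tau>. (\<Prod>v\<in>root_nbrs \<tau>. \<integral>\<^sup>+c. R (c, root_branch (Suc n) \<tau> v) \<partial>ext_kernel n \<tau> v) \<partial>\<mu> n)"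
    by (intro nn_integral_cong nn_integral_prod_Pi_pmf[where f = "\<lambda>v c. R (c, root_branch (Suc n) _ v)"]
        finite_root_nbrs)
  finally show ?thesis .
qed

lemma nn_integral_star_sum:
  "(\<integral>\<^sup>+t. (\<Sum>w\<in>root_nbrs t. R (branch_pair (Suc n) t w)) \<partial>star_law (Suc (Suc n)) \<rho>) =
    (\<integral>\<^sup>+\<tau>. (\<Sum>v\<in>root_nbrs \<tau>. \<integral>\<^sup>+c. R (c, root_branch (Suc n) \<tau> v) \<partial>ext_kernel n \<tau> v) \<partial>\<mu> n)"
proof -
  have "(\<Sum>w\<in>root_nbrs (glue \<tau> s). R (branch_pair (Suc n) (glue \<tau> s) w)) =
      (\<Sum>v\<in>root_nbrs \<tau>. R (s v, root_branch (Suc n) \<tau> v))"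
    if \<tau>s: "\<tau> \<in> set_pmf (\<mu> n)" "s \<in> set_pmf (Pi_pmf (root_nbrs \<tau>) undefined (ext_kernel n \<tau>))" for \<tau> s
  proof -
    obtain \<sigma> where \<sigma>: "bij_betw \<sigma> (root_nbrs \<tau>) (root_nbrs (glue \<tau> s))"
      "\<forall>v\<in>root_nbrs \<tau>. branch_pair (Suc n) (glue \<tau> s) (\<sigma> v) = (s v, root_branch (Suc n) \<tau> v)"
      using glue_bij[OF \<tau>s] by blast
    show ?thesis by (subst sum.reindex_bij_betw[OF \<sigma>(1), symmetric]) (use \<sigma>(2) in simp)
  qed
  then have "(\<integral>\<^sup>+t. (\<Sum>w\<in>root_nbrs t. R (branch_pair (Suc n) t w)) \<partial>star_law (Suc (Suc n)) \<rho>) =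
      (\<integral>\<^sup>+\<tau>. \<integral>\<^sup>+s. (\<Sum>v\<in>root_nbrs \<tau>. R (s v, root_branch (Suc n) \<tau> v))
         \<partial>Pi_pmf (root_nbrs \<tau>) undefined (ext_kernel n \<tau>) \<partial>\<mu> n)"
    unfolding star_law_eq nn_integral_bind_pmf nn_integral_map_pmf
    by (intro nn_integral_cong_AE) (auto simp: AE_measure_pmf_iff intro!: nn_integral_cong_AE)
  also have "\<dots> = (\<integral>\<^sup>+\<tau>. (\<Sum>v\<in>root_nbrs \<tau>. \<integral>\<^sup>+c. R (c, root_branch (Suc n) \<tau> v) \<partial>ext_kernel n \<tau> v) \<partial>\<mu> n)"
  proof (intro nn_integral_cong)
    fix \<tau>
    have "(\<integral>\<^sup>+s. R (s v, root_branch (Suc n) \<tau> v) \<partial>Pi_pmf (root_nbrs \<tau>) undefined (ext_kernel n \<tau>)) =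
        (\<integral>\<^sup>+c. R (c, root_branch (Suc n) \<tau> v) \<partial>ext_kernel n \<tau> v)" if "v \<in> root_nbrs \<tau>" for v
    proof -
      have "(\<integral>\<^sup>+s. R (s v, root_branch (Suc n) \<tau> v) \<partial>Pi_pmf (root_nbrs \<tau>) undefined (ext_kernel n \<tau>)) =
          (\<integral>\<^sup>+c. R (c, root_branch (Suc n) \<tau> v) \<partial>map_pmf (\<lambda>f. f v) (Pi_pmf (root_nbrs \<tau>) undefined (ext_kernel n \<tau>)))"
        by simp
      then show ?thesis unfolding Pi_pmf_component[OF finite_root_nbrs] using that by simp
    qed
    then show "(\<integral>\<^sup>+s. (\<Sum>v\<in>root_nbrs \<tau>. R (s v, root_branch (Suc n) \<tau> v))
          \<partial>Pi_pmf (root_nbrs \<tau>) undefined (ext_kernel n \<tau>)) =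
        (\<Sum>v\<in>root_nbrs \<tau>. \<integral>\<^sup>+c. R (c, root_branch (Suc n) \<tau> v) \<partial>ext_kernel n \<tau> v)"
      by (subst nn_integral_sum) auto
  qed
  finally show ?thesis .
qed

text \<open>Gluing keeps the root degree: the sum formula with \<open>R = 1\<close>. The edge laws
  of \<open>\<rho>\<close> and of its extension therefore share the normalisation
  \<open>\<beta>\<close>.\<close>

sublocale st: finite_mean_deg "star_law (Suc (Suc n)) \<rho>" \<beta> for n
proof
  have card: "(\<Sum>v\<in>root_nbrs t. 1) = (of_nat (root_deg t) :: ennreal)" for t :: "('x, 'y) gstar"
    by (simp add: root_deg_def)
  show "(\<integral>\<^sup>+t. of_nat (root_deg t) \<partial>star_law (Suc (Suc n)) \<rho>) = ennreal \<beta>"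
    using nn_integral_star_sum[where R = "\<lambda>_. 1" and n = n] tr.deg[of n]
    unfolding card by (simp add: measure_pmf.emeasure_space_1 root_deg_def)
qed (rule \<beta>_pos)

text \<open>Given the depth \<open>n + 1\<close> ball, the density in the definition of the law \<open>hat_law\<close> factorises
  over the children, and the ext_kernel cancels in each factor.\<close>

lemma kernel_RN_deriv_le_1:
  fixes n
  defines "e \<equiv> edge_law (Suc (Suc n)) (trunc_law (Suc (Suc n)) \<rho>)"
    and "es \<equiv> edge_law (Suc (Suc n)) (star_law (Suc (Suc n)) \<rho>)"
  assumes sub: "set_pmf e \<subseteq> set_pmf es" and \<tau>: "\<tau> \<in> set_pmf (\<mu> n)" and v: "v \<in> root_nbrs \<tau>"
  shows "(\<integral>\<^sup>+c. RN_deriv es e (c, root_branch (Suc n) \<tau> v) \<partial>ext_kernel n \<tau> v) \<le> 1"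
proof -
  let ?K = "ext_kernel n \<tau> v" and ?a = "child_branch n \<tau> v" and ?d = "root_branch (Suc n) \<tau> v"
  let ?R = "RN_deriv (measure_pmf es) (measure_pmf e)"
  define F where "F x y = (indicator {(?a, ?d)} (x, y) :: ennreal)" for x y
  define W where "W = (\<integral>\<^sup>+\<tau>'. (\<Sum>w\<in>root_nbrs \<tau>'. F (child_branch n \<tau>' w) (root_branch (Suc n) \<tau>' w)) \<partial>\<mu> n)"
  \<comment> \<open>A draw \<open>c\<close> determines its truncation \<open>?a\<close>, so only
    edges with the pair \<open>(?a, ?d)\<close> can produce \<open>(c, ?d)\<close>, and all of these
    use the kernel \<open>?K\<close>.\<close>
  have es: "ennreal \<beta> * ennreal (pmf es (c, ?d)) = ennreal (pmf ?K c) * W" if c: "c \<in> set_pmf ?K" for c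
  proof -
    have tm: "(\<integral>\<^sup>+c'. indicator {(c, ?d)} (c', root_branch (Suc n) \<tau>' w) \<partial>ext_kernel n \<tau>' w) =
        ennreal (pmf ?K c) * F (child_branch n \<tau>' w) (root_branch (Suc n) \<tau>' w)"
      if \<tau>': "\<tau>' \<in> set_pmf (\<mu> n)" and w: "w \<in> root_nbrs \<tau>'" for \<tau>' w
    proof (cases "root_branch (Suc n) \<tau>' w = ?d")
      case d: True
      have "(\<integral>\<^sup>+c'. indicator {(c, ?d)} (c', root_branch (Suc n) \<tau>' w) \<partial>ext_kernel n \<tau>' w)
          = (\<integral>\<^sup>+c'. indicator {c} c' \<partial>ext_kernel n \<tau>' w)"
        by (intro nn_integral_cong) (auto simp: d indicator_def)
      also have "\<dots> = ennreal (pmf (ext_kernel n \<tau>' w) c)" by (rule nn_integral_single_pmf)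
      also have "\<dots> = ennreal (pmf ?K c) * F (child_branch n \<tau>' w) ?d"
      proof (cases "child_branch n \<tau>' w = ?a")
        case True
        have "root_branch n \<tau>' w = root_branch n \<tau> v"
          using arg_cong[OF d, of "trunc_branch n"] by (simp add: trunc_root_branch)
        then have "ext_kernel n \<tau>' w = ?K" using True by (simp add: ext_kernel_def)
        then show ?thesis using True by (simp add: F_def)
      next
        case False
        then have "c \<notin> set_pmf (ext_kernel n \<tau>' w)"
          using set_kernel(1)[OF \<tau>' w] set_kernel(1)[OF \<tau> v c] by metis
        then show ?thesis using False by (simp add: F_def set_pmf_iff)
      qed
      finally show ?thesis using d by simp
    qed (simp add: F_def)
    have "ennreal \<beta> * ennreal (pmf es (c, ?d)) = ennreal \<beta> * (\<integral>\<^sup>+p. indicator {(c, ?d)} p \<partial>es)"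
      by (simp only: nn_integral_single_pmf)
    also have "\<dots> = (\<integral>\<^sup>+t. (\<Sum>w\<in>root_nbrs t. indicator {(c, ?d)} (branch_pair (Suc n) t w)) \<partial>star_law (Suc (Suc n)) \<rho>)"
      unfolding es_def by (rule st.nn_integral_edge_law)
    also have "\<dots> = (\<integral>\<^sup>+\<tau>'. (\<Sum>w\<in>root_nbrs \<tau>'. ennreal (pmf ?K c) * F (child_branch n \<tau>' w) (root_branch (Suc n) \<tau>' w)) \<partial>\<mu> n)"
      unfolding nn_integral_star_sum
      by (intro nn_integral_cong_AE) (auto simp: AE_measure_pmf_iff tm intro!: sum.cong)
    also have "\<dots> = ennreal (pmf ?K c) * W"
      unfolding W_def sum_distrib_left[symmetric] by (rule nn_integral_cmult) simp
    finally show ?thesis .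
  qed
  have W_pos: "W \<noteq> 0"
  proof
    assume "W = 0"
    then have "(\<Sum>w\<in>root_nbrs \<tau>. F (child_branch n \<tau> w) (root_branch (Suc n) \<tau> w)) = 0"
      using \<tau> by (simp add: W_def nn_integral_0_iff_AE AE_measure_pmf_iff)
    then show False using v finite_root_nbrs[of \<tau>] by (auto simp: F_def)
  qed
  \<comment> \<open>\<open>W\<close> is defined one depth lower, but through \<open>\<rho>\<close>
    the same weight is read off from \<open>e\<close> by truncating the child branch.\<close>
  have We: "W = ennreal \<beta> * (\<integral>\<^sup>+p. F (trunc_branch n (fst p)) (snd p) \<partial>e)"
  proof -
    have "W = (\<integral>\<^sup>+g. (\<Sum>w\<in>root_nbrs g. F (child_branch n g w) (root_branch (Suc n) g w)) \<partial>\<rho>)"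
      unfolding W_def by (rule nn_integral_trunc_law_sum[OF prob trees])
    also have "\<dots> = ennreal \<beta> * (\<integral>\<^sup>+p. F (trunc_branch n (fst p)) (snd p) \<partial>e)"
      unfolding e_def tr.nn_integral_edge_law
      using nn_integral_trunc_law_sum[OF prob trees, where F = "\<lambda>a b. F (trunc_branch n a) (trunc_branch (Suc n) b)" and n = "Suc n"]
      by (simp add: branch_pair_def trunc_root_branch trunc_child_branch)
    finally show ?thesis .
  qed
  have W_fin: "W \<noteq> \<infinity>"
  proof -
    have "(\<integral>\<^sup>+p. F (trunc_branch n (fst p)) (snd p) \<partial>e) \<le> (\<integral>\<^sup>+p. 1 \<partial>e)"
      by (intro nn_integral_mono) (simp add: F_def indicator_def)
    then have "(\<integral>\<^sup>+p. F (trunc_branch n (fst p)) (snd p) \<partial>e) \<noteq> \<infinity>"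
      by (auto simp: measure_pmf.emeasure_space_1 top_unique)
    then show ?thesis unfolding We by (simp add: ennreal_mult_eq_top_iff)
  qed
  have R: "?R p * ennreal (pmf es p) = ennreal (pmf e p)" for p
    unfolding emeasure_pmf_single[of es, symmetric]
    by (rule RN_deriv_pmf) (simp, rule dominated.pos[OF dominated_pmf[OF sub]])
  \<comment> \<open>Kernel times \<open>W\<close> turns into the star edge law, which
    \<open>?R\<close> converts to \<open>e\<close>; what remains is at most the weight
    \<open>W\<close> of the pair under \<open>e\<close>. \<open>W\<close> cancels at the end, being
    neither 0 nor infinite.\<close>
  have "W * (\<integral>\<^sup>+c. ?R (c, ?d) \<partial>?K) = (\<integral>\<^sup>+c. W * (ennreal (pmf ?K c) * ?R (c, ?d)) \<partial>count_space UNIV)"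
    unfolding nn_integral_measure_pmf by (rule nn_integral_cmult[symmetric]) simp
  also have "\<dots> \<le> (\<integral>\<^sup>+c. ennreal \<beta> * (ennreal (pmf e (c, ?d)) * F (trunc_branch n c) ?d) \<partial>count_space UNIV)"
  proof (intro nn_integral_mono)
    fix c
    show "W * (ennreal (pmf ?K c) * ?R (c, ?d)) \<le> ennreal \<beta> * (ennreal (pmf e (c, ?d)) * F (trunc_branch n c) ?d)"
    proof (cases "c \<in> set_pmf ?K")
      case True
      have "W * (ennreal (pmf ?K c) * ?R (c, ?d)) = ennreal \<beta> * (?R (c, ?d) * ennreal (pmf es (c, ?d)))"
      proof -
        have "W * (ennreal (pmf ?K c) * ?R (c, ?d)) = (ennreal (pmf ?K c) * W) * ?R (c, ?d)"
          by (simp only: mult_ac)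
        also have "\<dots> = ennreal \<beta> * (?R (c, ?d) * ennreal (pmf es (c, ?d)))"
          unfolding es[OF True, symmetric] by (simp only: mult_ac)
        finally show ?thesis .
      qed
      also have "\<dots> = ennreal \<beta> * (ennreal (pmf e (c, ?d)) * F (trunc_branch n c) ?d)"
        using set_kernel(1)[OF \<tau> v True] by (simp add: R F_def)
      finally show ?thesis by simp
    qed (simp add: set_pmf_iff)
  qed
  also have "\<dots> = ennreal \<beta> * (\<integral>\<^sup>+c. ennreal (pmf e (c, ?d)) * F (trunc_branch n c) ?d \<partial>count_space UNIV)"
    by (rule nn_integral_cmult) simp
  also have "\<dots> \<le> W"
  proof -
    have "(\<integral>\<^sup>+c. ennreal (pmf e (c, ?d)) * F (trunc_branch n c) ?d \<partial>count_space UNIV) =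
        (\<integral>\<^sup>+p. ennreal (pmf e p) * F (trunc_branch n (fst p)) (snd p) \<partial>count_space (range (\<lambda>c. (c, ?d))))"
      by (subst nn_integral_bij_count_space[symmetric, where g = "\<lambda>c. (c, ?d)" and A = UNIV])
        (auto simp: bij_betw_def inj_on_def)
    also have "\<dots> \<le> (\<integral>\<^sup>+p. ennreal (pmf e p) * F (trunc_branch n (fst p)) (snd p) \<partial>count_space UNIV)"
      by (subst nn_integral_count_space_indicator)
        (auto intro!: nn_integral_mono simp: indicator_def)
    finally show ?thesis
      unfolding We nn_integral_measure_pmf by (rule mult_left_mono) simp
  qed
  finally have "W * (\<integral>\<^sup>+c. ?R (c, ?d) \<partial>?K) \<le> W * 1" by simp
  then show ?thesis
    using W_pos W_fin ennreal_mult_le_mult_iff[of W _ 1] by (simp only: infinity_ennreal_def) blast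
qed

text \<open>Stated for general \<open>R\<close>, since it is applied to the Radon-Nikodym derivative
  of the edge laws and again to a rescaled degree.\<close>

lemma star_prod_le_1:
  assumes "\<And>\<tau> v. \<tau> \<in> set_pmf (\<mu> n) \<Longrightarrow> v \<in> root_nbrs \<tau> \<Longrightarrow>
    (\<integral>\<^sup>+c. R (c, root_branch (Suc n) \<tau> v) \<partial>ext_kernel n \<tau> v) \<le> 1"
  shows "(\<integral>\<^sup>+t. (\<Prod>w\<in>root_nbrs t. R (branch_pair (Suc n) t w)) \<partial>star_law (Suc (Suc n)) \<rho>) \<le> 1"
proof -
  have "(\<integral>\<^sup>+\<tau>. (\<Prod>v\<in>root_nbrs \<tau>. \<integral>\<^sup>+c. R (c, root_branch (Suc n) \<tau> v) \<partial>ext_kernel n \<tau> v) \<partial>\<mu> n)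
      \<le> (\<integral>\<^sup>+\<tau>. 1 \<partial>\<mu> n)"
    by (intro nn_integral_mono_AE) (auto simp: AE_measure_pmf_iff intro!: prod_le_1 assms)
  then show ?thesis by (simp add: nn_integral_star_prod measure_pmf.emeasure_space_1)
qed

end

section \<open>The entropy identity at one level\<close>

lemma prod_RN_deriv_pmf:
  assumes "set_pmf e \<subseteq> set_pmf es" "\<And>i. i \<in> I \<Longrightarrow> f i \<in> set_pmf e"
  shows "(\<Prod>i\<in>I. RN_deriv (measure_pmf es) (measure_pmf e) (f i)) = ennreal (\<Prod>i\<in>I. pmf e (f i) / pmf es (f i))"
    and "(\<Prod>i\<in>I. pmf e (f i) / pmf es (f i)) > 0"
    and "ln (\<Prod>i\<in>I. pmf e (f i) / pmf es (f i)) = (\<Sum>i\<in>I. log_ratio e (measure_pmf es) (f i))"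
proof -
  interpret dominated e "measure_pmf es" by (rule dominated_pmf[OF assms(1)])
  have pos: "pmf e (f i) / pmf es (f i) > 0" if "i \<in> I" for i
    using assms that by (auto intro!: divide_pos_pos pmf_positive)
  then show "(\<Prod>i\<in>I. pmf e (f i) / pmf es (f i)) > 0" by (intro prod_pos) auto
  have "(\<Prod>i\<in>I. RN_deriv (measure_pmf es) (measure_pmf e) (f i)) = (\<Prod>i\<in>I. ennreal (pmf e (f i) / pmf es (f i)))"
    using RN_deriv_eq[OF assms(2)] by (intro prod.cong) (simp_all add: measure_pmf_single)
  then show "(\<Prod>i\<in>I. RN_deriv (measure_pmf es) (measure_pmf e) (f i)) = ennreal (\<Prod>i\<in>I. pmf e (f i) / pmf es (f i))"
    using pos by (simp add: prod_ennreal less_imp_le)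
  show "ln (\<Prod>i\<in>I. pmf e (f i) / pmf es (f i)) = (\<Sum>i\<in>I. log_ratio e (measure_pmf es) (f i))"
  proof (cases "finite I")
    case True
    have "pmf e (f i) / pmf es (f i) \<noteq> 0" if "i \<in> I" for i
      using pos[OF that] by (rule less_imp_neq[symmetric])
    then show ?thesis using True by (subst ln_prod) (auto simp: log_ratio_pmf pos)
  qed simp
qed

context unimodular_tree
begin

abbreviation "\<mu>s n \<equiv> star_law (Suc (Suc n)) \<rho>"
abbreviation "edge n \<equiv> edge_law (Suc (Suc n)) (\<mu> (Suc n))"
abbreviation "edge_s n \<equiv> edge_law (Suc (Suc n)) (\<mu>s n)"

definition hat_density where
  "hat_density n t = (\<Prod>w\<in>root_nbrs t. RN_deriv (measure_pmf (edge_s n)) (measure_pmf (edge n)) (branch_pair (Suc n) t w))"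

lemma edge_support: "set_pmf (\<mu> (Suc n)) \<subseteq> set_pmf (\<mu>s n) \<Longrightarrow> set_pmf (edge n) \<subseteq> set_pmf (edge_s n)"
  unfolding tr.set_edge_law st.set_edge_law by blast

lemma hat_mass:
  assumes "set_pmf (\<mu> (Suc n)) \<subseteq> set_pmf (\<mu>s n)"
  shows "(\<integral>\<^sup>+t. hat_density n t \<partial>\<mu>s n) \<le> 1"
  unfolding hat_density_def
  by (intro star_prod_le_1 kernel_RN_deriv_le_1 edge_support assms)

lemma rel_entropy_hat_nonneg:
  "0 \<le> rel_entropy (measure_pmf (\<mu> (Suc n))) (density (measure_pmf (\<mu>s n)) (hat_density n))"
proof (cases "set_pmf (\<mu> (Suc n)) \<subseteq> set_pmf (\<mu>s n)")
  case True
  then show ?thesis using hat_mass by (intro rel_entropy_nonneg) (auto simp: emeasure_density)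
next
  case False
  then obtain x where "x \<in> set_pmf (\<mu> (Suc n))" "x \<notin> set_pmf (\<mu>s n)" by blast
  then show ?thesis
    using rel_entropy_eq_infty[of "density (measure_pmf (\<mu>s n)) (hat_density n)" x "\<mu> (Suc n)"]
    by (simp add: emeasure_density_pmf set_pmf_iff)
qed

lemma rel_entropy_star_eq_infty:
  assumes "\<not> (set_pmf (\<mu> (Suc n)) \<subseteq> set_pmf (\<mu>s n) \<and>
    integrable (measure_pmf (\<mu> (Suc n))) (log_ratio (\<mu> (Suc n)) (measure_pmf (\<mu>s n))))"
  shows "rel_entropy (measure_pmf (\<mu> (Suc n))) (measure_pmf (\<mu>s n)) = \<infinity>"
proof (cases "set_pmf (\<mu> (Suc n)) \<subseteq> set_pmf (\<mu>s n)")
  case True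
  then show ?thesis using assms by (simp add: dominated.rel_entropy_eq[OF dominated_pmf])
next
  case False
  then obtain x where "x \<in> set_pmf (\<mu> (Suc n))" "x \<notin> set_pmf (\<mu>s n)" by blast
  then show ?thesis
    using rel_entropy_eq_infty[of "measure_pmf (\<mu>s n)" x "\<mu> (Suc n)"]
    by (simp add: emeasure_pmf_single set_pmf_iff)
qed

text \<open>For finite values this is \<open>H + (H - \<beta> E) = 2 (H - \<beta>/2 E)\<close>; the
  work lies in showing that finite \<open>H\<close> forces finite \<open>E\<close>.\<close>

lemma level_identity:
  "rel_entropy (measure_pmf (\<mu> (Suc n))) (measure_pmf (\<mu>s n)) +
     rel_entropy (measure_pmf (\<mu> (Suc n))) (density (measure_pmf (\<mu>s n)) (hat_density n)) =
   2 * (rel_entropy (measure_pmf (\<mu> (Suc n))) (measure_pmf (\<mu>s n))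
     - ereal (\<beta> / 2) * rel_entropy (measure_pmf (edge n)) (measure_pmf (edge_s n)))"
  (is "?H + ?Q = 2 * (?H - _ * ?E)")
proof (cases "set_pmf (\<mu> (Suc n)) \<subseteq> set_pmf (\<mu>s n) \<and>
    integrable (measure_pmf (\<mu> (Suc n))) (log_ratio (\<mu> (Suc n)) (measure_pmf (\<mu>s n)))")
  case False
  \<comment> \<open>Both sides are then infinite, even if \<open>?E\<close> is infinite too, as
    \<open>\<infinity> - \<infinity> = \<infinity>\<close> here.\<close>
  then have "?H = \<infinity>" by (rule rel_entropy_star_eq_infty)
  then show ?thesis using rel_entropy_not_MInfty by simp
next
  case True
  then have sub: "set_pmf (\<mu> (Suc n)) \<subseteq> set_pmf (\<mu>s n)"
    and int: "integrable (measure_pmf (\<mu> (Suc n))) (log_ratio (\<mu> (Suc n)) (measure_pmf (\<mu>s n)))" by auto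
  have esub: "set_pmf (edge n) \<subseteq> set_pmf (edge_s n)" by (rule edge_support[OF sub])
  interpret E: dominated "edge n" "measure_pmf (edge_s n)" by (rule dominated_pmf[OF esub])
  interpret M: dominated "\<mu> (Suc n)" "measure_pmf (\<mu>s n)" by (rule dominated_pmf[OF sub])
  let ?b = "branch_pair (Suc n)"
  define d where "d t = (\<Prod>w\<in>root_nbrs t. pmf (edge n) (?b t w) / pmf (edge_s n) (?b t w))" for t
  have be: "?b t w \<in> set_pmf (edge n)" if "t \<in> set_pmf (\<mu> (Suc n))" "w \<in> root_nbrs t" for t w
    unfolding tr.set_edge_law using that by blast
  interpret T: tilted "\<mu> (Suc n)" "\<mu>s n" "hat_density n" d
    by unfold_locales
      (use sub prod_RN_deriv_pmf(1,2)[OF esub be] in \<open>auto simp: hat_density_def d_def\<close>)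
  let ?g = "log_ratio (edge n) (measure_pmf (edge_s n))"
  have lnd: "ln (d t) = (\<Sum>w\<in>root_nbrs t. ?g (?b t w))" if "t \<in> set_pmf (\<mu> (Suc n))" for t
    unfolding d_def by (rule prod_RN_deriv_pmf(3)[OF esub be[OF that]])
  have fin: "(\<integral>\<^sup>+t. ennreal (ln (d t)) \<partial>\<mu> (Suc n)) < \<infinity>"
    by (rule T.nn_integral_ln_density_finite[OF int])
      (use hat_mass[OF sub] in \<open>auto intro: order_le_less_trans\<close>)
  \<comment> \<open>Finiteness of the edge entropy: the negative part is bounded by the mass of
    \<open>edge_s n\<close>, the positive part by \<open>fin\<close>.\<close>
  have gint: "integrable (measure_pmf (edge n)) ?g"
  proof (rule tr.integrable_edge_of_sum)
    show "(\<integral>\<^sup>+p. ennreal (- ?g p) \<partial>edge n) < \<infinity>"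
      using E.nn_integral_minus_log_ratio_le
      by (rule order_le_less_trans) (simp add: measure_pmf.emeasure_space_1)
    have "(\<integral>\<^sup>+t. ennreal (\<Sum>w\<in>root_nbrs t. ?g (?b t w)) \<partial>\<mu> (Suc n)) = (\<integral>\<^sup>+t. ennreal (ln (d t)) \<partial>\<mu> (Suc n))"
      by (intro nn_integral_cong_AE) (simp add: AE_measure_pmf_iff lnd)
    then show "(\<integral>\<^sup>+t. ennreal (\<Sum>w\<in>root_nbrs t. ?g (?b t w)) \<partial>\<mu> (Suc n)) < \<infinity>" using fin by simp
  qed
  have lint: "integrable (measure_pmf (\<mu> (Suc n))) (\<lambda>t. ln (d t))"
    and leq: "(\<integral>t. ln (d t) \<partial>measure_pmf (\<mu> (Suc n))) = \<beta> * (\<integral>p. ?g p \<partial>measure_pmf (edge n))"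
  proof -
    have ae: "AE t in measure_pmf (\<mu> (Suc n)). ln (d t) = (\<Sum>w\<in>root_nbrs t. ?g (?b t w))"
      by (simp add: AE_measure_pmf_iff lnd)
    show "integrable (measure_pmf (\<mu> (Suc n))) (\<lambda>t. ln (d t))"
      using tr.integrable_edge_sum(1)[OF gint] by (subst integrable_cong_AE[OF _ _ ae]) auto
    show "(\<integral>t. ln (d t) \<partial>measure_pmf (\<mu> (Suc n))) = \<beta> * (\<integral>p. ?g p \<partial>measure_pmf (edge n))"
      unfolding tr.integrable_edge_sum(2)[OF gint, symmetric] by (intro integral_cong_AE[OF _ _ ae]) auto
  qed
  show ?thesis
    unfolding T.rel_entropy_density[OF lint] leq M.rel_entropy_eq E.rel_entropy_eq using int gint
    by (simp add: field_simps numeral_eq_ereal)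
qed

section \<open>Finiteness of the degree moment\<close>

text \<open>At depth 0 the kernel has only finitely many relevant arguments, each with a finite mean
  degree, so a maximum provides the uniform constant.\<close>

lemma kernel_deg_bound:
  "\<exists>C::real. C \<ge> 1 \<and> (\<forall>\<tau>\<in>set_pmf (\<mu> 0). \<forall>v\<in>root_nbrs \<tau>.
     (\<integral>\<^sup>+c. of_nat (Suc (root_deg (fst c))) \<partial>ext_kernel 0 \<tau> v) \<le> ennreal C)"
proof -
  define K where "K p = (\<integral>\<^sup>+c. of_nat (Suc (root_deg (fst c))) \<partial>step_kernel (Suc 0) (\<mu> 0) (fst p) (snd p))"
    for p :: "(('x, 'y) gstar \<times> 'y) \<times> (('x, 'y) gstar \<times> 'y)"
  define S where "S = {branch_pair 0 \<tau> v | \<tau> v. \<tau> \<in> set_pmf (\<mu> 0) \<and> v \<in> root_nbrs \<tau>}"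
  have fin: "finite S" unfolding S_def by (rule finite_edge_support)
  have Kfin: "K p < \<infinity>" if pS: "p \<in> S" for p
  proof -
    obtain \<tau> v where \<tau>: "\<tau> \<in> set_pmf (\<mu> 0)" "v \<in> root_nbrs \<tau>" "p = branch_pair 0 \<tau> v"
      using pS unfolding S_def by blast
    obtain \<tau>0 v0 where 0: "\<tau>0 \<in> set_pmf (\<mu> 0)" "v0 \<in> root_nbrs \<tau>0"
      "branch_pair 0 \<tau>0 v0 = (root_branch 0 \<tau> v, child_branch 0 \<tau> v)"
      using reversed_edge[OF \<tau>(1,2)] by blast
    have "decomposable \<tau>'" if "\<tau>' \<in> set_pmf (\<mu> 0)" for \<tau>'
      using set_trunc_law[OF prob trees that] trunc_decomposable by blast
    then show ?thesis
      unfolding K_def \<tau>(3) branch_pair_def fst_conv snd_conv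
      by (intro nn_integral_step_kernel_finite[OF 0]) (auto simp: tr.deg root_deg_root_branch simp del: of_nat_Suc)
  qed
  define C where "C = max 1 (enn2real (Max (insert 0 (K ` S))))"
  have "Max (insert 0 (K ` S)) < \<infinity>" using fin Kfin by (subst Max_less_iff) auto
  then have "Max (insert 0 (K ` S)) \<le> ennreal C"
    by (simp add: C_def) (metis ennreal_enn2real ennreal_leI max.cobounded2)
  then have "K p \<le> ennreal C" if "p \<in> S" for p
    using Max_ge[of "insert 0 (K ` S)" "K p"] fin that by (auto intro: order_trans)
  then have "(\<integral>\<^sup>+c. of_nat (Suc (root_deg (fst c))) \<partial>ext_kernel 0 \<tau> v) \<le> ennreal C"
    if "\<tau> \<in> set_pmf (\<mu> 0)" "v \<in> root_nbrs \<tau>" for \<tau> v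
    using that unfolding K_def S_def ext_kernel_def branch_pair_def by fastforce
  then show ?thesis by (intro exI[of _ C]) (auto simp: C_def)
qed

text \<open>The extension kernel is not size-biased, so that the law of the degree of a child under
  \<open>\<rho>\<close> has density of order \<open>deg\<close> with respect to its law under \<open>star_law 2 \<rho>\<close>; a finite
  relative entropy therefore forces a finite \<open>deg * ln deg\<close> moment.\<close>

lemma deg_log_deg_finite:
  assumes "rel_entropy (measure_pmf (\<mu> (Suc 0))) (measure_pmf (\<mu>s 0)) \<noteq> \<infinity>"
  shows "deg_log_deg \<rho> < \<infinity>"
proof -
  let ?p = "\<mu> (Suc 0)" and ?m = "\<mu>s 0" and ?b = "branch_pair (Suc 0)"
  have sub: "set_pmf ?p \<subseteq> set_pmf ?m"
    and int: "integrable (measure_pmf ?p) (log_ratio ?p (measure_pmf ?m))"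
    using assms rel_entropy_star_eq_infty[of 0] by auto
  obtain C :: real where C: "C \<ge> 1" "\<And>\<tau> v. \<tau> \<in> set_pmf (\<mu> 0) \<Longrightarrow> v \<in> root_nbrs \<tau> \<Longrightarrow>
     (\<integral>\<^sup>+c. of_nat (Suc (root_deg (fst c))) \<partial>ext_kernel 0 \<tau> v) \<le> ennreal C"
    using kernel_deg_bound by blast
  \<comment> \<open>\<open>Suc\<close> restores the edge to the root, giving the full degree of the
    child. Dividing by \<open>C\<close> makes every kernel average at most 1, so the product over
    the children has mass at most 1 under the star law.\<close>
  define r where "r z = real (Suc (root_deg (fst (fst z)))) / C"
    for z :: "(('x, 'y) gstar \<times> 'y) \<times> (('x, 'y) gstar \<times> 'y)"
  define l where "l c = ln (real (Suc (root_deg (fst c))))" for c :: "('x, 'y) gstar \<times> 'y"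
  define d where "d t = (\<Prod>w\<in>root_nbrs t. r (?b t w))" for t
  have r: "r z > 0" "ln (r z) = l (fst z) - ln C" for z
    using C(1) by (simp_all add: r_def l_def ln_div)
  have l: "l c \<ge> 0" for c by (simp add: l_def)
  interpret T: tilted ?p ?m "\<lambda>t. \<Prod>w\<in>root_nbrs t. ennreal (r (?b t w))" d
    by unfold_locales (use sub in \<open>simp_all add: d_def prod_ennreal less_imp_le[OF r(1)] prod_pos[OF r(1)] subset_iff\<close>)
  have "(\<integral>\<^sup>+t. (\<Prod>w\<in>root_nbrs t. ennreal (r (?b t w))) \<partial>?m) \<le> 1"
  proof (rule star_prod_le_1[where R = "\<lambda>z. ennreal (r z)"])
    fix \<tau> v assume \<tau>: "\<tau> \<in> set_pmf (\<mu> 0)" "v \<in> root_nbrs \<tau>"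
    have "(\<integral>\<^sup>+c. ennreal (r (c, root_branch (Suc 0) \<tau> v)) \<partial>ext_kernel 0 \<tau> v)
        = (\<integral>\<^sup>+c. ennreal (1 / C) * of_nat (Suc (root_deg (fst c))) \<partial>ext_kernel 0 \<tau> v)"
      using C(1) by (intro nn_integral_cong)
        (simp add: r_def ennreal_of_nat_eq_real_of_nat ennreal_mult[symmetric] del: of_nat_Suc)
    also have "\<dots> = ennreal (1 / C) * (\<integral>\<^sup>+c. of_nat (Suc (root_deg (fst c))) \<partial>ext_kernel 0 \<tau> v)"
      by (rule nn_integral_cmult) simp
    also have "\<dots> \<le> ennreal (1 / C) * ennreal C" by (intro mult_left_mono C(2)[OF \<tau>]) simp
    also have "\<dots> = 1" using C(1) by (simp add: ennreal_mult[symmetric])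
    finally show "(\<integral>\<^sup>+c. ennreal (r (c, root_branch (Suc 0) \<tau> v)) \<partial>ext_kernel 0 \<tau> v) \<le> 1" .
  qed
  then have "(\<integral>\<^sup>+t. ennreal (ln (d t)) \<partial>?p) < \<infinity>"
    by (intro T.nn_integral_ln_density_finite[OF int]) (auto intro: order_le_less_trans)
  moreover have "ln (d t) = (\<Sum>w\<in>root_nbrs t. ln (r (?b t w)))" for t
    unfolding d_def by (intro ln_prod finite_root_nbrs less_imp_neq[OF r(1), symmetric])
  \<comment> \<open>Each term is bounded below by \<open>- ln C\<close>, which rules out
    cancellation in the sum.\<close>
  ultimately have "integrable (measure_pmf (edge 0)) (\<lambda>z. ln (r z))"
  proof (intro tr.integrable_edge_of_sum[where g = "\<lambda>z. ln (r z)"])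
    have "(\<integral>\<^sup>+z. ennreal (- ln (r z)) \<partial>edge 0) \<le> (\<integral>\<^sup>+z. ennreal (ln C) \<partial>edge 0)"
      by (intro nn_integral_mono ennreal_leI) (simp add: r l)
    also have "\<dots> < \<infinity>" by (simp add: measure_pmf.emeasure_space_1)
    finally show "(\<integral>\<^sup>+z. ennreal (- ln (r z)) \<partial>edge 0) < \<infinity>" .
  qed simp
  then have "integrable (measure_pmf (edge 0)) (\<lambda>z. ln (r z) + ln C)" by simp
  then have "integrable (measure_pmf (edge 0)) (\<lambda>z. l (fst z))" by (simp add: r)
  then have "(\<integral>\<^sup>+z. ennreal (l (fst z)) \<partial>edge 0) < \<infinity>"
    by (simp add: integrable_iff_bounded l)
  then have "ennreal \<beta> * (\<integral>\<^sup>+z. ennreal (l (fst z)) \<partial>edge 0) < \<infinity>" by (simp add: ennreal_mult_less_top)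
  also have "ennreal \<beta> * (\<integral>\<^sup>+z. ennreal (l (fst z)) \<partial>edge 0) =
      (\<integral>\<^sup>+t. (\<Sum>w\<in>root_nbrs t. ennreal (l (child_branch (Suc 0) t w))) \<partial>?p)"
    unfolding tr.nn_integral_edge_law[where f = "\<lambda>z. ennreal (l (fst z))"]
    by (simp only: branch_pair_def fst_conv)
  also have "\<dots> = (\<integral>\<^sup>+g. (\<Sum>w\<in>root_nbrs g. ennreal (l (child_branch (Suc 0) g w))) \<partial>\<rho>)"
    by (rule nn_integral_trunc_law_sum[OF prob trees, where F = "\<lambda>a b. ennreal (l a)"])
  \<comment> \<open>Mass transport trades the child's degree for the root's; the sum then has
    \<open>deg\<close> equal terms \<open>ln deg\<close>.\<close>
  also have "\<dots> = (\<integral>\<^sup>+g. (\<Sum>w\<in>root_nbrs g. ennreal (l (root_branch (Suc 0) g w))) \<partial>\<rho>)"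
    by (rule mass_transport[OF unimod, where F = "\<lambda>a b. ennreal (l a)"])
  also have "\<dots> = deg_log_deg \<rho>"
    unfolding deg_log_deg_def
  proof (rule nn_integral_cong_AE, rule AE_mp[OF trees], rule AE_I2, rule impI)
    fix g :: "('x, 'y) gstar" assume g: "g \<in> tstar"
    have "l (root_branch (Suc 0) g w) = ln (real (root_deg g))" if "w \<in> root_nbrs g" for w
      unfolding l_def root_deg_root_branch[OF tstar_decomposable[OF g] that] ..
    then have "(\<Sum>w\<in>root_nbrs g. ennreal (l (root_branch (Suc 0) g w))) =
        of_nat (root_deg g) * ennreal (ln (real (root_deg g)))"
      by (simp add: root_deg_def)
    then show "(\<Sum>w\<in>root_nbrs g. ennreal (l (root_branch (Suc 0) g w))) =
        ennreal (real (root_deg g) * ln (real (root_deg g)))"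
      by (cases "root_deg g = 0") (simp_all add: ennreal_mult ennreal_of_nat_eq_real_of_nat)
  qed
  finally show ?thesis .
qed

end

section \<open>Level one\<close>

text \<open>A density that is a product over the root's edges changes the entropy by
  \<open>\<beta>\<close> times an edge mean. At level one both \<open>check_law\<close> and
  \<open>hat_law\<close> have this form.\<close>

lemma (in finite_mean_deg) rel_entropy_edge_tilt:
  fixes g :: "_ \<Rightarrow> real"
  assumes sub: "set_pmf \<mu> \<subseteq> set_pmf m"
    and D: "\<And>t v. t \<in> set_pmf \<mu> \<Longrightarrow> v \<in> root_nbrs t \<Longrightarrow> D t v = ennreal (exp (g (branch_pair n t v)))"
    and g: "integrable (measure_pmf (edge_law (Suc n) \<mu>)) g"
  shows "rel_entropy (measure_pmf \<mu>) (density (measure_pmf m) (\<lambda>t. \<Prod>v\<in>root_nbrs t. D t v)) =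
    rel_entropy (measure_pmf \<mu>) (measure_pmf m) - ereal (\<beta> * (\<integral>z. g z \<partial>measure_pmf (edge_law (Suc n) \<mu>)))"
proof -
  define d where "d t = exp (\<Sum>v\<in>root_nbrs t. g (branch_pair n t v))" for t
  have "(\<Prod>v\<in>root_nbrs t. D t v) = ennreal (d t)" if "t \<in> set_pmf \<mu>" for t
  proof -
    have "(\<Prod>v\<in>root_nbrs t. D t v) = (\<Prod>v\<in>root_nbrs t. ennreal (exp (g (branch_pair n t v))))"
      by (intro prod.cong refl D that)
    then show ?thesis by (simp add: prod_ennreal d_def exp_sum finite_root_nbrs)
  qed
  then interpret tilted \<mu> m "\<lambda>t. \<Prod>v\<in>root_nbrs t. D t v" d
    using sub by unfold_locales (auto simp: d_def)
  have "integrable (measure_pmf \<mu>) (\<lambda>t. ln (d t))"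
    unfolding d_def using integrable_edge_sum(1)[OF g] by simp
  moreover have "(\<integral>t. ln (d t) \<partial>measure_pmf \<mu>) = \<beta> * (\<integral>z. g z \<partial>measure_pmf (edge_law (Suc n) \<mu>))"
    unfolding d_def using integrable_edge_sum(2)[OF g] by simp
  ultimately show ?thesis using rel_entropy_density by simp
qed

lemma pmf_cond_fst:
  assumes "(a, b) \<in> set_pmf J"
  shows "pmf (cond_fst d J b) a = pmf J (a, b) / pmf (map_pmf snd J) b"
    and "set_pmf (cond_fst d J b) = {a. (a, b) \<in> set_pmf J}"
proof -
  let ?B = "{p. snd p = b}"
  have ne: "set_pmf J \<inter> ?B \<noteq> {}" and b: "b \<in> snd ` set_pmf J" using assms by force+
  have c: "cond_fst d J b = map_pmf fst (cond_pmf J ?B)" using b by (simp add: cond_fst_def)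
  show "set_pmf (cond_fst d J b) = {a. (a, b) \<in> set_pmf J}"
    unfolding c by (force simp: set_cond_pmf[OF ne])
  have "pmf (cond_fst d J b) a = measure (measure_pmf (cond_pmf J ?B)) (fst -` {a})"
    by (simp add: c pmf_map)
  also have "\<dots> = measure (measure_pmf (cond_pmf J ?B)) {(a, b)}"
    by (intro measure_pmf.finite_measure_eq_AE)
      (auto simp: AE_measure_pmf_iff set_cond_pmf[OF ne])
  also have "\<dots> = pmf J (a, b) / measure (measure_pmf J) ?B"
    by (simp add: measure_pmf_single pmf_cond[OF ne])
  also have "measure (measure_pmf J) ?B = pmf (map_pmf snd J) b"
    by (simp add: pmf_map vimage_def)
  finally show "pmf (cond_fst d J b) a = pmf J (a, b) / pmf (map_pmf snd J) b" .
qed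

lemma dominated_RN_deriv_exp:
  assumes "set_pmf p \<subseteq> set_pmf m" "x \<in> set_pmf p"
  shows "RN_deriv (measure_pmf m) (measure_pmf p) x = ennreal (exp (log_ratio p (measure_pmf m) x))"
proof -
  interpret dominated p "measure_pmf m" by (rule dominated_pmf[OF assms(1)])
  have "pmf p x / pmf m x > 0" using assms by (auto intro!: divide_pos_pos pmf_positive)
  then show ?thesis by (simp add: RN_deriv_eq[OF assms(2)] log_ratio_def measure_pmf_single)
qed

lemma level_one_identity:
  fixes \<rho> \<eta> :: "('x :: finite, 'y :: finite) gstar measure"
  assumes "unimodular_tree \<rho> \<beta>" "unimodular_tree \<eta> \<beta>"
    and sub: "set_pmf (trunc_law 1 \<rho>) \<subseteq> set_pmf (trunc_law 1 \<eta>)"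
  shows "rel_entropy (measure_pmf (trunc_law 1 \<rho>)) (check_law \<eta> \<rho> 1) +
      rel_entropy (measure_pmf (trunc_law 1 \<rho>)) (hat_law \<eta> \<rho> 1) =
    2 * (rel_entropy (measure_pmf (trunc_law 1 \<rho>)) (measure_pmf (trunc_law 1 \<eta>))
      - ereal (\<beta> / 2) * rel_entropy (measure_pmf (edge_law 1 (trunc_law 1 \<rho>)))
                                      (measure_pmf (edge_law 1 (trunc_law 1 \<eta>))))"
proof -
  interpret R: unimodular_tree \<rho> \<beta> by fact
  interpret E: unimodular_tree \<eta> \<beta> by fact
  let ?p = "trunc_law (Suc 0) \<rho>" and ?m = "trunc_law (Suc 0) \<eta>"
  let ?e = "edge_law (Suc 0) ?p" and ?f = "edge_law (Suc 0) ?m"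
  let ?H = "rel_entropy (measure_pmf ?p) (measure_pmf ?m)"
  have sub': "set_pmf ?p \<subseteq> set_pmf ?m" using sub by simp
  then have ef: "set_pmf ?e \<subseteq> set_pmf ?f" unfolding R.tr.set_edge_law E.tr.set_edge_law by blast
  have int: "integrable (measure_pmf ?e) h" for h :: "_ \<Rightarrow> real"
    by (rule integrable_measure_pmf_finite) (simp only: R.tr.set_edge_law finite_edge_support)
  have pe: "branch_pair 0 t v \<in> set_pmf ?e" if "t \<in> set_pmf ?p" "v \<in> root_nbrs t" for t v
    unfolding R.tr.set_edge_law using that by blast
  let ?L = "log_ratio (map_pmf fst ?e) (measure_pmf (map_pmf fst ?f))"
  let ?l = "log_ratio ?e (measure_pmf ?f)"
  have "rel_entropy (measure_pmf ?p) (check_law \<eta> \<rho> 1) = ?H - ereal (\<beta> * (\<integral>z. ?L (fst z) \<partial>measure_pmf ?e))"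
    unfolding check_law_def One_nat_def
  proof (simp only: if_True simp_thms, rule R.tr.rel_entropy_edge_tilt[OF sub' _ int])
    fix t v assume t: "t \<in> set_pmf ?p" "v \<in> root_nbrs t"
    have "child_branch 0 t v \<in> set_pmf (map_pmf fst ?e)"
      using pe[OF t] by (force simp: branch_pair_def)
    moreover have "set_pmf (map_pmf fst ?e) \<subseteq> set_pmf (map_pmf fst ?f)" using ef by auto
    ultimately show "RN_deriv (measure_pmf (map_pmf fst ?f)) (measure_pmf (map_pmf fst ?e)) (child_branch 0 t v)
        = ennreal (exp (?L (fst (branch_pair 0 t v))))"
      by (simp add: dominated_RN_deriv_exp branch_pair_def)
  qed
  moreover have "rel_entropy (measure_pmf ?p) (hat_law \<eta> \<rho> 1) =
      ?H - ereal (\<beta> * (\<integral>z. ?l z - ?L (snd z) \<partial>measure_pmf ?e))"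
    unfolding hat_law_def One_nat_def
  proof (simp only: if_True simp_thms, rule R.tr.rel_entropy_edge_tilt[OF sub' _ int])
    fix t v assume t: "t \<in> set_pmf ?p" "v \<in> root_nbrs t"
    obtain a b where ab: "branch_pair 0 t v = (a, b)" by (cases "branch_pair 0 t v")
    then have child: "child_branch 0 t v = a" and root: "root_branch 0 t v = b"
      by (simp_all add: branch_pair_def)
    have e: "(a, b) \<in> set_pmf ?e" using pe[OF t] ab by simp
    then have f: "(a, b) \<in> set_pmf ?f" using ef by blast
    let ?r = "cond_law_rho \<eta> \<rho> b" and ?s = "cond_law_eta \<eta> b"
    note r = pmf_cond_fst[OF e, of "cond_law_eta \<eta>"]
    note s = pmf_cond_fst[OF f, of "\<lambda>_. map_pmf fst ?f"]
    have defs: "?r = cond_fst (cond_law_eta \<eta>) ?e b" "?s = cond_fst (\<lambda>_. map_pmf fst ?f) ?f b"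
      by (simp_all add: cond_law_rho_def cond_law_eta_def)
    have rs: "set_pmf ?r \<subseteq> set_pmf ?s" "a \<in> set_pmf ?r"
      using ef e unfolding defs r(2) s(2) by auto
    have be: "b \<in> set_pmf (map_pmf snd ?e)" using e by force
    have bf: "b \<in> set_pmf (map_pmf snd ?f)" using f by force
    \<comment> \<open>Chain rule: the conditional log ratio is the joint one minus that of the
      second marginal. As the two marginals agree, the subtracted function is the \<open>?L\<close>
      from \<open>check_law\<close>.\<close>
    have "log_ratio ?r (measure_pmf ?s) a = ?l (a, b) - ?L b"
      unfolding log_ratio_pmf defs r(1) s(1)
      unfolding R.edge_law_marginals[of 0, symmetric] E.edge_law_marginals[of 0, symmetric]
      using pmf_positive[OF e] pmf_positive[OF f] pmf_positive[OF be] pmf_positive[OF bf]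
      by (simp add: ln_div ln_mult)
    then show "RN_deriv (measure_pmf (cond_law_eta \<eta> (root_branch 0 t v)))
        (measure_pmf (cond_law_rho \<eta> \<rho> (root_branch 0 t v))) (child_branch 0 t v)
        = ennreal (exp (?l (branch_pair 0 t v) - ?L (snd (branch_pair 0 t v))))"
      unfolding root child ab snd_conv dominated_RN_deriv_exp[OF rs] by simp
  qed
  \<comment> \<open>With equal means of \<open>?L\<close>, its two contributions cancel on adding
    the entropies, leaving the joint log ratio.\<close>
  moreover have "(\<integral>z. ?L (snd z) \<partial>measure_pmf ?e) = (\<integral>z. ?L (fst z) \<partial>measure_pmf ?e)"
  proof -
    have "(\<integral>z. ?L (snd z) \<partial>measure_pmf ?e) = (\<integral>y. ?L y \<partial>measure_pmf (map_pmf snd ?e))"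
      by (rule integral_map_pmf[symmetric])
    also have "\<dots> = (\<integral>z. ?L (fst z) \<partial>measure_pmf ?e)"
      unfolding R.edge_law_marginals[of 0] by (rule integral_map_pmf)
    finally show ?thesis .
  qed
  then have "(\<integral>z. ?l z - ?L (snd z) \<partial>measure_pmf ?e) =
      (\<integral>z. ?l z \<partial>measure_pmf ?e) - (\<integral>z. ?L (fst z) \<partial>measure_pmf ?e)"
    by (simp add: int)
  moreover have "rel_entropy (measure_pmf ?e) (measure_pmf ?f) = ereal (\<integral>z. ?l z \<partial>measure_pmf ?e)"
    by (simp add: dominated.rel_entropy_eq[OF dominated_pmf[OF ef]] int)
  ultimately show ?thesis
    unfolding One_nat_def
    using rel_entropy_not_MInfty[of "measure_pmf ?p" "measure_pmf ?m"]
    by (cases ?H) (simp_all add: field_simps numeral_eq_ereal)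
qed

section \<open>Summing the levels\<close>

text \<open>The head may be negative: nonnegativity is established only for the terms of depth at
  least 2.\<close>

lemma suminf_ereal_split_head:
  fixes f :: "nat \<Rightarrow> ereal"
  assumes "\<And>n. 0 \<le> f (Suc n)" "f 0 \<noteq> - \<infinity>"
  shows "suminf f = f 0 + (\<Sum>n. f (Suc n))"
proof -
  let ?S = "\<Sum>n. f (Suc n)"
  have "(\<lambda>n. \<Sum>i<n. f (Suc i)) \<longlonglongrightarrow> ?S"
    using summable_LIMSEQ[OF summable_ereal_pos[OF assms(1)]] .
  moreover have "?S \<noteq> - \<infinity>" using suminf_0_le[OF assms(1)] by auto
  ultimately have "(\<lambda>n. f 0 + (\<Sum>i<n. f (Suc i))) \<longlonglongrightarrow> f 0 + ?S"
    using assms(2) by (intro tendsto_add_ereal_general) auto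
  then have "(\<lambda>n. sum f {..<Suc n}) \<longlonglongrightarrow> f 0 + ?S"
    by (simp only: sum.lessThan_Suc_shift)
  then have "f sums (f 0 + ?S)" unfolding sums_def by (rule LIMSEQ_imp_Suc)
  then show ?thesis by (rule sums_unique[symmetric])
qed

theorem theorem4p16:
  fixes \<nu> :: "('x :: finite) pmf"
    and \<xi> :: "(('y :: finite) \<times> 'y) pmf"
    and \<eta> :: "('x, 'y) gstar measure"
    and \<beta> :: real
  assumes "\<beta> \<ge> 0"
    and "\<eta> \<in> unimod_trees \<beta>"
    and "true_law \<nu> \<xi> \<eta>"
  shows "\<forall>\<rho>\<in>prob_gstar. rate_I \<nu> \<beta> \<eta> \<rho> = rate_I_tilde \<nu> \<beta> \<eta> \<rho>"
proof
  fix \<rho> :: "('x, 'y) gstar measure" assume "\<rho> \<in> prob_gstar"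
  show "rate_I \<nu> \<beta> \<eta> \<rho> = rate_I_tilde \<nu> \<beta> \<eta> \<rho>"
  proof (cases "\<beta> > 0 \<and> \<rho> \<in> unimod_trees \<beta> \<and>
      absolutely_continuous (measure_pmf (trunc_law 1 \<eta>)) (measure_pmf (trunc_law 1 \<rho>))")
    case False
    \<comment> \<open>Outside the main case the two definitions take the same branch: the entropy of
      the root mark, or \<open>\<infinity>\<close>.\<close>
    then show ?thesis by (auto simp: rate_I_def rate_I_tilde_def)
  next
    case True
    interpret R: unimodular_tree \<rho> \<beta> using True by unfold_locales auto
    interpret E: unimodular_tree \<eta> \<beta> using True assms by unfold_locales auto
    have sub: "set_pmf (trunc_law 1 \<rho>) \<subseteq> set_pmf (trunc_law 1 \<eta>)"
      using True absolutely_continuous_pmf_iff[of "measure_pmf (trunc_law 1 \<eta>)" "trunc_law 1 \<rho>"]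
      by (auto simp: emeasure_pmf_single set_pmf_iff)
    define t where "t h = rel_entropy (measure_pmf (trunc_law (h + 1) \<rho>)) (check_law \<eta> \<rho> (h + 1)) +
        rel_entropy (measure_pmf (trunc_law (h + 1) \<rho>)) (hat_law \<eta> \<rho> (h + 1))" for h
    define u0 where "u0 = rel_entropy (measure_pmf (trunc_law 1 \<rho>)) (measure_pmf (trunc_law 1 \<eta>))
        - ereal (\<beta> / 2) * rel_entropy (measure_pmf (edge_law 1 (trunc_law 1 \<rho>)))
                                       (measure_pmf (edge_law 1 (trunc_law 1 \<eta>)))"
    define u where "u h = rel_entropy (measure_pmf (trunc_law (h + 2) \<rho>)) (measure_pmf (star_law (h + 2) \<rho>))
        - ereal (\<beta> / 2) * rel_entropy (measure_pmf (edge_law (h + 2) (trunc_law (h + 2) \<rho>)))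
                                       (measure_pmf (edge_law (h + 2) (star_law (h + 2) \<rho>)))" for h
    have t0: "t 0 = 2 * u0"
      using level_one_identity[OF R.unimodular_tree_axioms E.unimodular_tree_axioms sub]
      by (simp add: t_def u0_def)
    have t0': "t 0 \<noteq> - \<infinity>" unfolding t_def by (simp add: rel_entropy_not_MInfty)
    have tS: "t (Suc h) = rel_entropy (measure_pmf (R.\<mu> (Suc h))) (measure_pmf (R.\<mu>s h)) +
        rel_entropy (measure_pmf (R.\<mu> (Suc h))) (density (measure_pmf (R.\<mu>s h)) (R.hat_density h))" for h
      by (simp add: t_def check_law_def hat_law_def R.hat_density_def[abs_def])
    have star0: "0 \<le> rel_entropy (measure_pmf (R.\<mu> (Suc h))) (measure_pmf (R.\<mu>s h))" for h
      by (rule rel_entropy_nonneg) (simp_all add: measure_pmf.emeasure_space_1)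
    have tpos: "0 \<le> t (Suc h)" for h
      unfolding tS by (intro add_nonneg_nonneg star0 R.rel_entropy_hat_nonneg)
    have tu: "t (Suc h) = 2 * u h" for h
      unfolding tS R.level_identity by (simp add: u_def)
    have split: "suminf t = t 0 + (\<Sum>h. t (Suc h))" by (rule suminf_ereal_split_head[OF tpos t0'])
    have I: "rate_I \<nu> \<beta> \<eta> \<rho> = 1 / 2 * suminf t"
      using True unfolding rate_I_def t_def[abs_def] by simp
    show ?thesis
    proof (cases "deg_log_deg \<rho> < \<infinity>")
      case fin: True
      \<comment> \<open>Signs are inherited from \<open>t\<close>, where they are those of relative
        entropies; they allow the factor 2 to leave the series.\<close>
      have upos: "0 \<le> u h" for h using tpos[of h] unfolding tu by (simp add: ereal_zero_le_0_iff)
      have "(\<Sum>h. t (Suc h)) = 2 * suminf u"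
        unfolding tu by (rule suminf_cmult_ereal) (simp_all add: upos)
      then have "rate_I \<nu> \<beta> \<eta> \<rho> = 1 / 2 * (2 * u0 + 2 * suminf u)" by (simp add: I split t0)
      also have "\<dots> = u0 + suminf u"
        using suminf_0_le[OF upos] t0' unfolding t0
        by (cases u0; cases "suminf u") (auto simp: numeral_eq_ereal one_ereal_def)
      also have "\<dots> = rate_I_tilde \<nu> \<beta> \<eta> \<rho>"
        using True fin unfolding rate_I_tilde_def u0_def u_def[abs_def] by simp
      finally show ?thesis .
    next
      case False
      \<comment> \<open>An infinite degree moment already makes the depth 2 term of
        \<open>rate_I\<close> infinite, matching the default value of
        \<open>rate_I_tilde\<close>.\<close>
      then have "rel_entropy (measure_pmf (R.\<mu> (Suc 0))) (measure_pmf (R.\<mu>s 0)) = \<infinity>"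
        using R.deg_log_deg_finite by blast
      then have "t (Suc 0) = \<infinity>" unfolding tS by (simp add: rel_entropy_not_MInfty)
      moreover have "(\<Sum>h<1. t (Suc h)) \<le> (\<Sum>h. t (Suc h))" by (rule suminf_upper[OF tpos])
      ultimately have "suminf t = \<infinity>" using split t0' by simp
      then have "rate_I \<nu> \<beta> \<eta> \<rho> = \<infinity>" by (simp add: I one_ereal_def numeral_eq_ereal)
      moreover have "rate_I_tilde \<nu> \<beta> \<eta> \<rho> = \<infinity>" using True False by (simp add: rate_I_tilde_def)
      ultimately show ?thesis by simp
    qed
  qed
qed

end
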